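(* Let $G$ be a locally compact, $\sigma$-compact abelian group and let $(X,G,m)$ be a dynamical system. Then the following holds. (a) For any FDS factor $(Y,G,n)$ of $(X,G,m)$ with factor map $\Phi:X\to Y$, the equality $\widehat{\gamma^{n}}=\varrho^{\delta_0\circ\Phi}$ holds. (b) For any continuous $f:X\to\mathbb{C}$, the equality $\widehat{\gamma^{\Phi^f(m)}}=\varrho^f$ holds. In particular, the map which sends an FDS factor $(Y,G,n)$ of $(X,G,m)$ to its diffraction $\widehat{\gamma^{n}}$ is a map from the FDS factors of $(X,G,m)$ onto the set $\{\varrho^f : f\in C(X)\}$ of spectral measures of continuous functions on $X$.
   Context: $G$ is written additively, with Haar measure $m_G$ and dual group $\widehat{G}$. A dynamical system $(X,G,m)$ consists of a compact (Hausdorff) space $X$ with a continuous action $(t,x)\mapsto\alpha_t(x)$ of $G$ and a $G$-invariant (Radon) probability measure $m$ on $X$. $\langle f,g\rangle=\int_X f\overline g\,dm$ and $T_tf=f\circ\alpha_{-t}$. The spectral measure of $f\in L^2(X,m)$ is the unique finite measure $\varrho^f$ on $\widehat{G}$ with $\langle T_tf,f\rangle=\int_{\widehat{G}}\eta(t)\,d\varrho^f(\eta)$ for all $t\in G$. A dynamical system $(Y,G,n)$ is a factor of $(X,G,m)$ if there is a continuous surjective $G$-equivariant map $\Phi:X\to Y$ (factor map) with $\Phi(m)=n$ (push-forward). $C(G)$ is the space of continuous functions $G\to\mathbb{C}$ with the topology of locally uniform convergence; $G$ acts on it by translations $(s\cdot h)(t)=h(t-s)$; $\delta_0:C(G)\to\mathbb{C}$,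 $\delta_0(h)=h(0)$. A function dynamical system (FDS) is a dynamical system $(Y,G,n)$ with $Y\subset C(G)$ compact and translation invariant and $n$ an invariant probability measure on $Y$. An FDS factor of $(X,G,m)$ is a factor that is an FDS. For $f\in C(X)$ and $x\in X$ let $\Phi^f_x\in C(G)$, $\Phi^f_x(t)=f(\alpha_{-t}x)$; then $\Phi^f:X\to C(G)$, $x\mapsto\Phi^f_x$, is continuous and equivariant; with $X^f=\Phi^f(X)$ and $\Phi^f(m)$ the push-forward, $(X^f,G,\Phi^f(m))$ is an FDS factor of $(X,G,m)$. For $\varphi,\psi\in C_c(G)$: $(\varphi\ast\psi)(t)=\int_G\varphi(t-s)\psi(s)\,dm_G(s)$, $\widetilde\varphi(t)=\overline{\varphi(-t)}$, $\check\varphi(\eta)=\int_G\eta(t)\varphi(t)\,dm_G(t)$. For an FDS $(Y,G,n)$ and $\varphi\in C_c(G)$ put $\mathcal{N}_\varphi(h)=\int_G\varphi(t)h(t)\,dm_G(t)$ for $h\in Y$. The autocorrelation $\gamma^n$ is the unique translation bounded measure on $G$ with $\gamma^n(\varphi\ast\widetilde\psi)=\langle\mathcal{N}_\varphi,\mathcal{N}_\psi\rangle_{L^2(Y,n)}$ for all $\varphi,\psi\in C_c(G)$. Its Fourier transform, the diffraction $\widehat{\gamma^n}$ of $(Y,G,n)$, is the unique positive measure on $\widehat{G}$ with $\gamma^n(\varphi\ast\widetilde\varphi)=\int_{\widehat{G}}|\check\varphi|^2\,d\widehat{\gamma^n}$ for all $\varphi\in C_c(G)$. *)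

theory Defs
  imports "HOL-Analysis.Analysis" "HOL-Probability.Probability_Measure"
begin

section \<open>Radon measures on topological spaces\<close>

definition borel_of :: "'a topology \<Rightarrow> 'a measure" where
  "borel_of X = sigma (topspace X) {U. openin X U}"

(* Positive Radon measures: Borel, finite on compact sets, outer regular on Borel sets, inner
   regular on open sets.  On a locally compact Hausdorff space these correspond bijectively to the
   positive functionals on the compactly supported continuous functions. *)
definition radon_measure :: "'a topology \<Rightarrow> 'a measure \<Rightarrow> bool" where
  "radon_measure X M \<longleftrightarrow>
     sets M = sets (borel_of X) \<and>
     (\<forall>K. compactin X K \<longrightarrow> emeasure M K < \<infinity>) \<and>
     (\<forall>A\<in>sets M. emeasure M A = (INF U\<in>{U. openin X U \<and> A \<subseteq> U}. emeasure M U)) \<and>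
     (\<forall>U. openin X U \<longrightarrow> emeasure M U = (SUP K\<in>{K. compactin X K \<and> K \<subseteq> U}. emeasure M K))"

definition l2_inner :: "'a measure \<Rightarrow> ('a \<Rightarrow> complex) \<Rightarrow> ('a \<Rightarrow> complex) \<Rightarrow> complex" where
  "l2_inner M f g = (\<integral>x. f x * cnj (g x) \<partial>M)"

section \<open>The group\<close>

definition sigma_compact :: "'a::topological_space set \<Rightarrow> bool" where
  "sigma_compact S \<longleftrightarrow> (\<exists>K :: nat \<Rightarrow> 'a set. (\<forall>n. compact (K n)) \<and> S = (\<Union>n. K n))"

definition haar_measure :: "'g::topological_ab_group_add measure \<Rightarrow> bool" where
  "haar_measure \<mu> \<longleftrightarrow>
     radon_measure euclidean \<mu> \<and> emeasure \<mu> UNIV \<noteq> 0 \<and> (\<forall>t. distr \<mu> \<mu> (\<lambda>s. t + s) = \<mu>)"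

definition CG :: "('g::topological_space \<Rightarrow> complex) set" where
  "CG = {h. continuous_on UNIV h}"

(* Uniform convergence on compact sets, which on a locally compact space is the same as locally
   uniform convergence. *)
definition CG_topology :: "('g::topological_space \<Rightarrow> complex) topology" where
  "CG_topology = topology (\<lambda>U. U \<subseteq> CG \<and>
     (\<forall>h\<in>U. \<exists>K \<epsilon>. compact K \<and> \<epsilon> > 0 \<and>
        (\<forall>k\<in>CG. (\<forall>t\<in>K. dist (k t) (h t) < \<epsilon>) \<longrightarrow> k \<in> U)))"

lemma openin_CG_topology:
  fixes U :: "('g::topological_space \<Rightarrow> complex) set"
  shows "openin CG_topology U \<longleftrightarrow> U \<subseteq> CG \<and>
     (\<forall>h\<in>U. \<exists>K \<epsilon>. compact K \<and> \<epsilon> > 0 \<and>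
        (\<forall>k\<in>CG. (\<forall>t\<in>K. dist (k t) (h t) < \<epsilon>) \<longrightarrow> k \<in> U))"
proof -
  let ?P = "\<lambda>U h K \<epsilon>. compact K \<and> \<epsilon> > 0 \<and>
        (\<forall>k\<in>CG. (\<forall>t\<in>K. dist (k t) (h t) < \<epsilon>) \<longrightarrow> k \<in> U)"
  let ?L = "\<lambda>U::('g \<Rightarrow> complex) set. U \<subseteq> CG \<and> (\<forall>h\<in>U. \<exists>K \<epsilon>. ?P U h K \<epsilon>)"
  have "istopology ?L"
    unfolding istopology_def
  proof (intro conjI allI impI)
    fix S T :: "('g \<Rightarrow> complex) set"
    assume S: "?L S" and T: "?L T"
    show "S \<inter> T \<subseteq> CG" using S by blast
    show "\<forall>h\<in>S \<inter> T. \<exists>K \<epsilon>. ?P (S \<inter> T) h K \<epsilon>"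
    proof
      fix h assume h: "h \<in> S \<inter> T"
      obtain K \<epsilon> where K: "?P S h K \<epsilon>" using S h by blast
      obtain K' \<epsilon>' where K': "?P T h K' \<epsilon>'" using T h by blast
      have "compact (K \<union> K')" "min \<epsilon> \<epsilon>' > 0" using K K' by auto
      moreover have "k \<in> S \<inter> T"
        if "k \<in> CG" and k: "\<forall>t\<in>K \<union> K'. dist (k t) (h t) < min \<epsilon> \<epsilon>'" for k
      proof
        have "\<forall>t\<in>K. dist (k t) (h t) < \<epsilon>" using k by simp
        then show "k \<in> S" using K \<open>k \<in> CG\<close> by blast
        have "\<forall>t\<in>K'. dist (k t) (h t) < \<epsilon>'" using k by simp
        then show "k \<in> T" using K' \<open>k \<in> CG\<close> by blast
      qed
      ultimately have "?P (S \<inter> T) h (K \<union> K') (min \<epsilon> \<epsilon>')" by blast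
      then show "\<exists>K \<epsilon>. ?P (S \<inter> T) h K \<epsilon>" by blast
    qed
  next
    fix \<K> :: "('g \<Rightarrow> complex) set set"
    assume \<K>: "\<forall>S\<in>\<K>. ?L S"
    show "\<Union>\<K> \<subseteq> CG" using \<K> by blast
    show "\<forall>h\<in>\<Union>\<K>. \<exists>K \<epsilon>. ?P (\<Union>\<K>) h K \<epsilon>"
    proof
      fix h assume "h \<in> \<Union>\<K>"
      then obtain S where S: "S \<in> \<K>" "h \<in> S" by (rule UnionE)
      have "?L S" using \<K> S(1) by (rule bspec)
      then have "\<exists>K \<epsilon>. ?P S h K \<epsilon>" using S(2) by (rule bspec[OF conjunct2])
      then obtain K \<epsilon> where K: "?P S h K \<epsilon>" by (elim exE)
      have "S \<subseteq> \<Union>\<K>" using S(1) by (rule Union_upper)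
      then have "?P (\<Union>\<K>) h K \<epsilon>" using K by (meson subsetD)
      then show "\<exists>K \<epsilon>. ?P (\<Union>\<K>) h K \<epsilon>" by blast
    qed
  qed
  then show ?thesis
    unfolding CG_topology_def by (rule fun_cong[OF topology_inverse'])
qed

lemma topspace_CG_topology:
  "topspace (CG_topology :: ('g::topological_space \<Rightarrow> complex) topology) = CG"
proof
  show "topspace CG_topology \<subseteq> (CG :: ('g \<Rightarrow> complex) set)"
    using openin_topspace[of CG_topology] unfolding openin_CG_topology by blast
  have "\<exists>K \<epsilon>. compact K \<and> \<epsilon> > 0 \<and> (\<forall>k\<in>CG. (\<forall>t\<in>K. dist (k t) (h t) < \<epsilon>) \<longrightarrow> k \<in> CG)"
    for h :: "'g \<Rightarrow> complex"
    by (intro exI[of _ "{}"] exI[of _ 1]) auto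
  then have "openin CG_topology (CG :: ('g \<Rightarrow> complex) set)"
    unfolding openin_CG_topology by blast
  then show "CG \<subseteq> topspace (CG_topology :: ('g \<Rightarrow> complex) topology)"
    by (rule openin_subset)
qed

definition dual_group :: "('g::topological_ab_group_add \<Rightarrow> complex) set" where
  "dual_group = {\<eta>. continuous_on UNIV \<eta> \<and> (\<forall>t. norm (\<eta> t) = 1) \<and> (\<forall>s t. \<eta> (s + t) = \<eta> s * \<eta> t)}"

definition dual_topology :: "('g::topological_ab_group_add \<Rightarrow> complex) topology" where
  "dual_topology = subtopology CG_topology dual_group"

section \<open>Compactly supported functions and complex measures on the group\<close>

definition supp :: "('g::topological_space \<Rightarrow> complex) \<Rightarrow> 'g set" where
  "supp \<phi> = closure {t. \<phi> t \<noteq> 0}"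

definition Cc :: "('g::topological_space \<Rightarrow> complex) set" where
  "Cc = {\<phi>. continuous_on UNIV \<phi> \<and> compact (supp \<phi>)}"

definition conv :: "'g::topological_ab_group_add measure \<Rightarrow>
    ('g \<Rightarrow> complex) \<Rightarrow> ('g \<Rightarrow> complex) \<Rightarrow> 'g \<Rightarrow> complex" where
  "conv mG \<phi> \<psi> t = (\<integral>s. \<phi> (t - s) * \<psi> s \<partial>mG)"

definition tilde :: "('g::topological_ab_group_add \<Rightarrow> complex) \<Rightarrow> 'g \<Rightarrow> complex" where
  "tilde \<phi> t = cnj (\<phi> (- t))"

definition check_transform :: "'g::topological_ab_group_add measure \<Rightarrow>
    ('g \<Rightarrow> complex) \<Rightarrow> ('g \<Rightarrow> complex) \<Rightarrow> complex" where
  "check_transform mG \<phi> \<eta> = (\<integral>t. \<eta> t * \<phi> t \<partial>mG)"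

(* A complex measure on G need not be finite, so its total variation may only be defined on
   relatively compact sets; such measures are therefore given, as usual, as linear functionals on Cc
   that are continuous in the inductive limit topology. *)
definition complex_radon_functional :: "(('g::topological_space \<Rightarrow> complex) \<Rightarrow> complex) \<Rightarrow> bool" where
  "complex_radon_functional \<gamma> \<longleftrightarrow>
     (\<forall>\<phi>\<in>Cc. \<forall>\<psi>\<in>Cc. \<gamma> (\<lambda>t. \<phi> t + \<psi> t) = \<gamma> \<phi> + \<gamma> \<psi>) \<and>
     (\<forall>c. \<forall>\<phi>\<in>Cc. \<gamma> (\<lambda>t. c * \<phi> t) = c * \<gamma> \<phi>) \<and>
     (\<forall>K. compact K \<longrightarrow> (\<exists>C::real. \<forall>\<phi>\<in>Cc. supp \<phi> \<subseteq> K \<longrightarrow>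
        norm (\<gamma> \<phi>) \<le> C * (SUP t. norm (\<phi> t))))"

definition total_variation :: "(('g::topological_space \<Rightarrow> complex) \<Rightarrow> complex) \<Rightarrow> 'g set \<Rightarrow> ennreal" where
  "total_variation \<gamma> A = (INF U\<in>{U. open U \<and> A \<subseteq> U}.
     SUP \<phi>\<in>{\<phi>\<in>Cc. supp \<phi> \<subseteq> U \<and> (\<forall>t. norm (\<phi> t) \<le> 1)}. ennreal (norm (\<gamma> \<phi>)))"

definition translation_bounded :: "(('g::topological_ab_group_add \<Rightarrow> complex) \<Rightarrow> complex) \<Rightarrow> bool" where
  "translation_bounded \<gamma> \<longleftrightarrow>
     (\<forall>K. compact K \<longrightarrow> (SUP t. total_variation \<gamma> ((\<lambda>s. t + s) ` K)) < \<infinity>)"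

section \<open>Dynamical systems, factors and spectral measures\<close>

definition dynamical_system ::
    "'x topology \<Rightarrow> ('g::topological_ab_group_add \<Rightarrow> 'x \<Rightarrow> 'x) \<Rightarrow> 'x measure \<Rightarrow> bool" where
  "dynamical_system X \<alpha> m \<longleftrightarrow>
     compact_space X \<and> Hausdorff_space X \<and>
     continuous_map (prod_topology euclidean X) X (\<lambda>(t, x). \<alpha> t x) \<and>
     (\<forall>x\<in>topspace X. \<alpha> 0 x = x) \<and>
     (\<forall>s t. \<forall>x\<in>topspace X. \<alpha> (s + t) x = \<alpha> s (\<alpha> t x)) \<and>
     radon_measure X m \<and> prob_space m \<and>
     (\<forall>t. distr m m (\<alpha> t) = m)"

definition factor_map ::
    "'x topology \<Rightarrow> ('g \<Rightarrow> 'x \<Rightarrow> 'x) \<Rightarrow> 'x measure \<Rightarrow>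
     'y topology \<Rightarrow> ('g \<Rightarrow> 'y \<Rightarrow> 'y) \<Rightarrow> 'y measure \<Rightarrow> ('x \<Rightarrow> 'y) \<Rightarrow> bool" where
  "factor_map X \<alpha> m Y \<beta> n \<Phi> \<longleftrightarrow>
     continuous_map X Y \<Phi> \<and> \<Phi> ` topspace X = topspace Y \<and>
     (\<forall>t. \<forall>x\<in>topspace X. \<Phi> (\<alpha> t x) = \<beta> t (\<Phi> x)) \<and>
     distr m (borel_of Y) \<Phi> = n"

definition koopman :: "('g::group_add \<Rightarrow> 'x \<Rightarrow> 'x) \<Rightarrow> 'g \<Rightarrow> ('x \<Rightarrow> complex) \<Rightarrow> 'x \<Rightarrow> complex" where
  "koopman \<alpha> t f = f \<circ> \<alpha> (- t)"

definition is_spectral_measure ::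
    "('g::topological_ab_group_add \<Rightarrow> 'x \<Rightarrow> 'x) \<Rightarrow> 'x measure \<Rightarrow> ('x \<Rightarrow> complex) \<Rightarrow>
     ('g \<Rightarrow> complex) measure \<Rightarrow> bool" where
  "is_spectral_measure \<alpha> m f \<rho> \<longleftrightarrow>
     radon_measure dual_topology \<rho> \<and> finite_measure \<rho> \<and>
     (\<forall>t. l2_inner m (koopman \<alpha> t f) f = (\<integral>\<eta>. \<eta> t \<partial>\<rho>))"

definition spectral_measure ::
    "('g::topological_ab_group_add \<Rightarrow> 'x \<Rightarrow> 'x) \<Rightarrow> 'x measure \<Rightarrow> ('x \<Rightarrow> complex) \<Rightarrow>
     ('g \<Rightarrow> complex) measure" where
  "spectral_measure \<alpha> m f = (THE \<rho>. is_spectral_measure \<alpha> m f \<rho>)"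

section \<open>Function dynamical systems and diffraction\<close>

definition translate :: "'g::group_add \<Rightarrow> ('g \<Rightarrow> complex) \<Rightarrow> 'g \<Rightarrow> complex" where
  "translate s h = (\<lambda>t. h (t - s))"

definition delta0 :: "('g::zero \<Rightarrow> complex) \<Rightarrow> complex" where
  "delta0 h = h 0"

(* Compactness and translation invariance of Y are part of dynamical_system. *)
definition FDS ::
    "('g::topological_ab_group_add \<Rightarrow> complex) set \<Rightarrow> ('g \<Rightarrow> complex) measure \<Rightarrow> bool" where
  "FDS Y n \<longleftrightarrow> Y \<subseteq> CG \<and> dynamical_system (subtopology CG_topology Y) translate n"

definition FDS_factor_map ::
    "'x topology \<Rightarrow> ('g::topological_ab_group_add \<Rightarrow> 'x \<Rightarrow> 'x) \<Rightarrow> 'x measure \<Rightarrow>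
     ('g \<Rightarrow> complex) set \<Rightarrow> ('g \<Rightarrow> complex) measure \<Rightarrow> ('x \<Rightarrow> 'g \<Rightarrow> complex) \<Rightarrow> bool" where
  "FDS_factor_map X \<alpha> m Y n \<Phi> \<longleftrightarrow>
     FDS Y n \<and> factor_map X \<alpha> m (subtopology CG_topology Y) translate n \<Phi>"

definition FDS_factors ::
    "'x topology \<Rightarrow> ('g::topological_ab_group_add \<Rightarrow> 'x \<Rightarrow> 'x) \<Rightarrow> 'x measure \<Rightarrow>
     (('g \<Rightarrow> complex) set \<times> ('g \<Rightarrow> complex) measure) set" where
  "FDS_factors X \<alpha> m = {(Y, n). \<exists>\<Phi>. FDS_factor_map X \<alpha> m Y n \<Phi>}"

(* For f in C(X): orbit_map is Phi^f, orbit_space is X^f, orbit_measure is the push-forward of m. *)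
definition orbit_map ::
    "('g::group_add \<Rightarrow> 'x \<Rightarrow> 'x) \<Rightarrow> ('x \<Rightarrow> complex) \<Rightarrow> 'x \<Rightarrow> 'g \<Rightarrow> complex" where
  "orbit_map \<alpha> f x = (\<lambda>t. f (\<alpha> (- t) x))"

definition orbit_space ::
    "'x topology \<Rightarrow> ('g::group_add \<Rightarrow> 'x \<Rightarrow> 'x) \<Rightarrow> ('x \<Rightarrow> complex) \<Rightarrow> ('g \<Rightarrow> complex) set" where
  "orbit_space X \<alpha> f = orbit_map \<alpha> f ` topspace X"

definition orbit_measure ::
    "'x topology \<Rightarrow> ('g::{topological_space,group_add} \<Rightarrow> 'x \<Rightarrow> 'x) \<Rightarrow> 'x measure \<Rightarrow>
     ('x \<Rightarrow> complex) \<Rightarrow> ('g \<Rightarrow> complex) measure" where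
  "orbit_measure X \<alpha> m f =
     distr m (borel_of (subtopology CG_topology (orbit_space X \<alpha> f))) (orbit_map \<alpha> f)"

definition pairing :: "'g measure \<Rightarrow> ('g \<Rightarrow> complex) \<Rightarrow> ('g \<Rightarrow> complex) \<Rightarrow> complex" where
  "pairing mG \<phi> h = (\<integral>t. \<phi> t * h t \<partial>mG)"

(* Membership in extensional Cc fixes the irrelevant values of the functional outside Cc. *)
definition is_autocorrelation ::
    "'g::topological_ab_group_add measure \<Rightarrow> ('g \<Rightarrow> complex) measure \<Rightarrow>
     (('g \<Rightarrow> complex) \<Rightarrow> complex) \<Rightarrow> bool" where
  "is_autocorrelation mG n \<gamma> \<longleftrightarrow>
     \<gamma> \<in> extensional Cc \<and> complex_radon_functional \<gamma> \<and> translation_bounded \<gamma> \<and>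
     (\<forall>\<phi>\<in>Cc. \<forall>\<psi>\<in>Cc. \<gamma> (conv mG \<phi> (tilde \<psi>)) = l2_inner n (pairing mG \<phi>) (pairing mG \<psi>))"

definition autocorrelation ::
    "'g::topological_ab_group_add measure \<Rightarrow> ('g \<Rightarrow> complex) measure \<Rightarrow>
     ('g \<Rightarrow> complex) \<Rightarrow> complex" where
  "autocorrelation mG n = (THE \<gamma>. is_autocorrelation mG n \<gamma>)"

(* has_bochner_integral rather than an equation of integrals: integrability is part of the claim. *)
definition is_diffraction ::
    "'g::topological_ab_group_add measure \<Rightarrow> ('g \<Rightarrow> complex) measure \<Rightarrow>
     ('g \<Rightarrow> complex) measure \<Rightarrow> bool" where
  "is_diffraction mG n \<mu> \<longleftrightarrow>
     radon_measure dual_topology \<mu> \<and>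
     (\<forall>\<phi>\<in>Cc. has_bochner_integral \<mu>
        (\<lambda>\<eta>. complex_of_real ((norm (check_transform mG \<phi> \<eta>))\<^sup>2))
        (autocorrelation mG n (conv mG \<phi> (tilde \<phi>))))"

definition diffraction ::
    "'g::topological_ab_group_add measure \<Rightarrow> ('g \<Rightarrow> complex) measure \<Rightarrow> ('g \<Rightarrow> complex) measure" where
  "diffraction mG n = (THE \<mu>. is_diffraction mG n \<mu>)"

end

(* Neither Bochner's theorem nor Fourier inversion is needed. Put A t = <T_t f, f>. If h = Phi x is the
   function t |-> f (alpha (-t) x), Fubini gives <N_phi, N_psi> = int int phi t cnj (psi s) A (t - s) ds dt,
   so the autocorrelation is the measure with density A; it is unique because the phi * tilde psi
   approximate every function in Cc. A Radon measure mu on the dual group is then the diffraction iff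
   int |check phi|^2 dmu is the quadratic form of A for all phi, and the spectral measure iff it is finite
   with int eta t dmu = A t. The second condition implies the first by Fubini. Conversely, for bumps phi, psi
   concentrated near t and 0, the polarized integrand check phi * cnj (check psi) is close to eta t
   uniformly on compact sets, while the form is close to A t; with t = 0 this also bounds mu.
   So both descriptions single out the same measures. *)
theory Submission
  imports Defs
begin

section \<open>Continuous functions of two variables\<close>

text \<open>Both \<open>diffraction\<close> and \<open>spectral_measure\<close> are
  \<open>THE\<close> terms, so they coincide as soon as their defining predicates hold for the same
  measures. The equivalence is proved once, for any continuous map \<open>\<Psi>\<close> into
  \<open>CG\<close> with \<open>\<Psi> x t = f (\<alpha> (- t) x)\<close>; factor maps and
  \<open>orbit_map\<close> are two instances. The obstacle is Fubini. No second countability is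
  assumed, so joint continuity does not give measurability for the product of two Borel
  sigma-algebras. It does on compact rectangles. Every exchange of integrals is therefore arranged
  with a compact set in one variable and, in the other, a sequence of compact sets that carries the
  measure up to a null set where the integrand matters. Functions in \<open>Cc\<close> bring their
  supports, \<open>X\<close> is compact, and on the dual group the sequence comes from inner
  regularity of a finite Radon measure. This is why a diffraction measure is first shown to be
  finite: on a compact set of characters the transform of a bump near 0 has modulus at least 1/2,
  which bounds the measure of that set uniformly.\<close>

lemma continuous_map_euclidean_iff:
  fixes g :: "'a \<Rightarrow> 'c::metric_space"
  shows "continuous_map X euclidean g \<longleftrightarrow>
    (\<forall>x\<in>topspace X. \<forall>e>0. \<exists>U. openin X U \<and> x \<in> U \<and> (\<forall>y\<in>U. dist (g y) (g x) < e))"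
  (is "?L \<longleftrightarrow> ?R")
proof
  assume L: ?L
  show ?R
  proof (intro ballI allI impI)
    fix x and e :: real assume "x \<in> topspace X" "e > 0"
    with openin_continuous_map_preimage[OF L, of "ball (g x) e"]
    show "\<exists>U. openin X U \<and> x \<in> U \<and> (\<forall>y\<in>U. dist (g y) (g x) < e)"
      by (intro exI[of _ "{y \<in> topspace X. g y \<in> ball (g x) e}"]) (auto simp: dist_commute)
  qed
next
  assume R: ?R
  show ?L
    unfolding continuous_map_def
  proof (intro conjI allI impI)
    fix U :: "'c set" assume "openin euclidean U"
    show "openin X {x \<in> topspace X. g x \<in> U}"
    proof (subst openin_subopen, intro ballI)
      fix x assume x: "x \<in> {x \<in> topspace X. g x \<in> U}"
      then obtain e where "e > 0" "ball (g x) e \<subseteq> U"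
        using \<open>openin euclidean U\<close> by (auto simp: open_contains_ball)
      have "x \<in> topspace X" using x by simp
      from R[rule_format, OF this \<open>e > 0\<close>] obtain V
        where "openin X V" "x \<in> V" "\<forall>y\<in>V. dist (g y) (g x) < e"
        by (elim exE conjE)
      with \<open>ball (g x) e \<subseteq> U\<close> show "\<exists>T. openin X T \<and> x \<in> T \<and> T \<subseteq> {x \<in> topspace X. g x \<in> U}"
        by (intro exI[of _ V]) (auto simp: dist_commute dest: openin_subset)
    qed
  qed auto
qed

lemma continuous_map_complex_mult:
  fixes f g :: "'a \<Rightarrow> complex"
  shows "continuous_map X euclidean f \<Longrightarrow> continuous_map X euclidean g \<Longrightarrow>
    continuous_map X euclidean (\<lambda>x. f x * g x)"
  by (simp add: continuous_map_atin tendsto_mult)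

lemma continuous_map_cnj:
  "continuous_map X euclidean f \<Longrightarrow> continuous_map X euclidean (\<lambda>x. cnj (f x))"
  by (simp add: continuous_map_atin tendsto_cnj)

lemma continuous_map_curry1:
  assumes "continuous_map (prod_topology A B) C (\<lambda>(x, y). k x y)" "y \<in> topspace B"
  shows "continuous_map A C (\<lambda>x. k x y)"
proof -
  have "continuous_map A (prod_topology A B) (\<lambda>x. (x, y))"
    using assms(2) by (intro continuous_map_pairedI) auto
  from continuous_map_compose[OF this assms(1)] show ?thesis
    by (simp add: o_def)
qed

lemma continuous_map_curry2:
  assumes "continuous_map (prod_topology A B) C (\<lambda>(x, y). k x y)" "x \<in> topspace A"
  shows "continuous_map B C (k x)"
proof -
  have "continuous_map B (prod_topology A B) (\<lambda>y. (x, y))"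
    using assms(2) by (intro continuous_map_pairedI) auto
  from continuous_map_compose[OF this assms(1)] show ?thesis
    by (simp add: o_def)
qed

lemma continuous_map_swap_args:
  assumes "continuous_map (prod_topology A B) C (\<lambda>(x, y). k x y)"
  shows "continuous_map (prod_topology B A) C (\<lambda>(y, x). k x y)"
proof -
  have "continuous_map (prod_topology B A) (prod_topology A B) (\<lambda>z. (snd z, fst z))"
    by (intro continuous_map_pairedI continuous_map_fst continuous_map_snd)
  from continuous_map_compose[OF this assms] show ?thesis
    by (simp add: o_def split_def)
qed

text \<open>The tube lemma, applied to the open set where \<open>d\<close> is below
  \<open>e\<close>, which contains \<open>K \<times> {y}\<close>. It replaces arguments by
  sequences, which need not describe these topologies, and yields continuity of parameter integrals,
  product measurability, equicontinuity of compact sets of characters and continuity of maps into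
  \<open>CG_topology\<close>.\<close>

lemma compactin_uniformly_close:
  fixes k :: "'a \<Rightarrow> 'b \<Rightarrow> 'c::metric_space"
  assumes k: "continuous_map (prod_topology A B) euclidean (\<lambda>(x, y). k x y)"
    and K: "compactin A K" and y: "y \<in> topspace B" and e: "e > 0"
  obtains V where "openin B V" "y \<in> V" "\<And>x z. x \<in> K \<Longrightarrow> z \<in> V \<Longrightarrow> dist (k x z) (k x y) < e"
proof -
  define d where "d = (\<lambda>(x, z). dist (k x z) (k x y))"
  have *: "continuous_map (prod_topology A B) euclidean (\<lambda>p. k (fst p) y)"
    using continuous_map_compose[OF continuous_map_fst continuous_map_curry1[OF k y]]
    by (simp add: o_def)
  have "continuous_map (prod_topology A B) euclideanreal d"
    using k * unfolding d_def
    by (simp add: continuous_map_atin split_def tendsto_dist)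
  then have op: "openin (prod_topology A B) {p \<in> topspace (prod_topology A B). d p \<in> {..<e}}"
    by (rule openin_continuous_map_preimage) auto
  have "K \<times> {y} \<subseteq> {p \<in> topspace (prod_topology A B). d p \<in> {..<e}}"
    using compactin_subset_topspace[OF K] y e by (auto simp: d_def)
  from tube_lemma_left[OF op K y this] obtain U V where
    "openin A U" "openin B V" "K \<subseteq> U" "y \<in> V"
    and sub: "U \<times> V \<subseteq> {p \<in> topspace (prod_topology A B). d p \<in> {..<e}}"
    by blast
  have "dist (k x z) (k x y) < e" if "x \<in> K" "z \<in> V" for x z
    using subsetD[OF sub, of "(x, z)"] that \<open>K \<subseteq> U\<close> by (auto simp: d_def)
  with \<open>openin B V\<close> \<open>y \<in> V\<close> show ?thesis
    by (rule that)
qed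

section \<open>Borel measures of topologies\<close>

lemma space_borel_of [simp]: "space (borel_of X) = topspace X"
  unfolding borel_of_def by (simp add: space_measure_of_conv)

lemma sets_borel_of: "sets (borel_of X) = sigma_sets (topspace X) {U. openin X U}"
  unfolding borel_of_def by (rule sets_measure_of) (auto dest: openin_subset)

lemma borel_of_euclidean: "sets (borel_of euclidean) = sets borel"
  unfolding sets_borel_of borel_def by (simp add: sets_measure_of_conv)

lemma space_eq_topspace: "sets M = sets (borel_of X) \<Longrightarrow> space M = topspace X"
  using sets_eq_imp_space_eq[of M "borel_of X"] by simp

lemma sets_borel_of_openin: "sets M = sets (borel_of X) \<Longrightarrow> openin X U \<Longrightarrow> U \<in> sets M"
  by (auto simp: sets_borel_of)

lemma sets_borel_of_closedin:
  assumes "sets M = sets (borel_of X)" "closedin X C"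
  shows "C \<in> sets M"
proof -
  have "topspace X - C \<in> sets M"
    using assms by (intro sets_borel_of_openin) auto
  then have "space M - (topspace X - C) \<in> sets M"
    by blast
  moreover have "space M - (topspace X - C) = C"
    using space_eq_topspace[OF assms(1)] closedin_subset[OF assms(2)] by auto
  ultimately show ?thesis by simp
qed

lemma sets_borel_of_compactin:
  "Hausdorff_space X \<Longrightarrow> sets M = sets (borel_of X) \<Longrightarrow> compactin X K \<Longrightarrow> K \<in> sets M"
  by (intro sets_borel_of_closedin compactin_imp_closedin)

lemma continuous_map_measurable_borel_of:
  assumes M: "sets M = sets (borel_of X)" and N: "sets N = sets (borel_of Y)"
    and f: "continuous_map X Y f"
  shows "f \<in> measurable M N"
proof (rule measurable_sigma_sets)
  show "sets N = sigma_sets (topspace Y) {U. openin Y U}"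
    using N by (simp add: sets_borel_of)
  show "f \<in> space M \<rightarrow> topspace Y"
    using f space_eq_topspace[OF M] by (auto simp: continuous_map_def)
  fix U assume "U \<in> {U. openin Y U}"
  then have "openin X {x \<in> topspace X. f x \<in> U}"
    using f by (auto simp: continuous_map_def)
  moreover have "f -` U \<inter> space M = {x \<in> topspace X. f x \<in> U}"
    using space_eq_topspace[OF M] by auto
  ultimately show "f -` U \<inter> space M \<in> sets M"
    using M by (metis sets_borel_of_openin)
qed (auto dest: openin_subset)

lemma continuous_map_borel_measurable:
  assumes "sets M = sets (borel_of X)" and "continuous_map X euclidean f"
  shows "f \<in> borel_measurable M"
  by (rule continuous_map_measurable_borel_of[OF assms(1) borel_of_euclidean[symmetric] assms(2)])

text \<open>Holds for every \<open>f\<close>: a function that is not integrable has integral 0 by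
  convention, and \<open>g\<close> is nonnegative on the space because it dominates a norm.\<close>

lemma norm_integral_le:
  fixes f :: "'a \<Rightarrow> 'c::{banach, second_countable_topology}"
  assumes "integrable M g" "\<And>x. x \<in> space M \<Longrightarrow> norm (f x) \<le> g x"
  shows "norm (integral\<^sup>L M f) \<le> integral\<^sup>L M g"
  using assms norm_ge_zero order_trans
  by (intro order_trans[OF integral_norm_bound integral_mono'[OF assms(1)]]) blast+

lemma integrable_continuous_bounded:
  fixes f :: "'a \<Rightarrow> 'c::{banach, second_countable_topology}"
  assumes "finite_measure M" "sets M = sets (borel_of X)" "continuous_map X euclidean f"
    and "\<And>x. x \<in> topspace X \<Longrightarrow> norm (f x) \<le> C"
  shows "integrable M f"
proof -
  interpret finite_measure M by fact
  show ?thesis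
    using assms continuous_map_borel_measurable[OF assms(2,3)]
    by (intro integrable_const_bound[of _ C]) (auto simp: space_eq_topspace)
qed

lemma continuous_map_compact_bounded:
  fixes f :: "'a \<Rightarrow> 'c::real_normed_vector"
  assumes "continuous_map X euclidean f" "compactin X K"
  obtains C where "C \<ge> 0" "\<And>x. x \<in> K \<Longrightarrow> norm (f x) \<le> C"
proof -
  have "compact (f ` K)"
    using image_compactin[OF assms(2,1)] by simp
  then have "bounded (f ` K)" by (rule compact_imp_bounded)
  then obtain C where "C > 0" "\<And>x. x \<in> K \<Longrightarrow> norm (f x) \<le> C"
    by (auto simp: bounded_pos)
  then show ?thesis by (intro that[of C]) auto
qed

lemma integrable_continuous_compact_support:
  fixes f :: "'a \<Rightarrow> 'c::{banach, second_countable_topology}"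
  assumes "Hausdorff_space X" "sets M = sets (borel_of X)" "continuous_map X euclidean f"
    and "compactin X K" "emeasure M K < \<infinity>" "\<And>x. x \<in> topspace X \<Longrightarrow> x \<notin> K \<Longrightarrow> f x = 0"
  shows "integrable M f"
proof -
  obtain C where "\<And>x. x \<in> K \<Longrightarrow> norm (f x) \<le> C"
    using continuous_map_compact_bounded[OF assms(3,4)] by blast
  then show ?thesis
    using assms continuous_map_borel_measurable[OF assms(2,3)]
    by (intro integrableI_bounded_set[of K _ _ C])
       (auto simp: sets_borel_of_compactin space_eq_topspace)
qed

text \<open>Near \<open>y\<close> the integrands are uniformly close on \<open>K\<close> and all
  vanish off \<open>K\<close>, so the integrals differ by at most a small constant times
  \<open>measure M K\<close>.\<close>

lemma continuous_map_parametric_integral: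
  fixes k :: "'a \<Rightarrow> 'b \<Rightarrow> complex"
  assumes A: "Hausdorff_space A" and M: "sets M = sets (borel_of A)"
    and k: "continuous_map (prod_topology A B) euclidean (\<lambda>(x, y). k x y)"
    and K: "compactin A K" "emeasure M K < \<infinity>"
    and zero: "\<And>x y. x \<in> topspace A \<Longrightarrow> y \<in> topspace B \<Longrightarrow> x \<notin> K \<Longrightarrow> k x y = 0"
  shows "continuous_map B euclidean (\<lambda>y. \<integral>x. k x y \<partial>M)"
  unfolding continuous_map_euclidean_iff
proof (intro ballI allI impI)
  fix y and e :: real assume y: "y \<in> topspace B" and "e > 0"
  \<comment> \<open>The summand 1 keeps the denominator positive when \<open>K\<close> is null and
    leaves room for a strict inequality at the end.\<close>
  define d where "d = e / (measure M K + 1)"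
  have "d > 0" using \<open>e > 0\<close> by (simp add: d_def add_nonneg_pos)
  obtain V where V: "openin B V" "y \<in> V"
    and Vd: "\<And>x z. x \<in> K \<Longrightarrow> z \<in> V \<Longrightarrow> dist (k x z) (k x y) < d"
    using compactin_uniformly_close[OF k K(1) y \<open>d > 0\<close>] by blast
  have int: "integrable M (\<lambda>x. k x z)" if "z \<in> topspace B" for z
    by (rule integrable_continuous_compact_support[OF A M continuous_map_curry1[OF k that] K])
      (use zero that in auto)
  have [measurable]: "K \<in> sets M"
    using A M K(1) by (rule sets_borel_of_compactin)
  have "dist (\<integral>x. k x z \<partial>M) (\<integral>x. k x y \<partial>M) < e" if "z \<in> V" for z
  proof -
    have z: "z \<in> topspace B" using V(1) that openin_subset by blast
    have "dist (\<integral>x. k x z \<partial>M) (\<integral>x. k x y \<partial>M) = norm (\<integral>x. k x z - k x y \<partial>M)"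
      using int[OF z] int[OF y] by (simp add: dist_norm)
    also have "\<dots> \<le> (\<integral>x. d * indicator K x \<partial>M)"
    proof (rule norm_integral_le)
      fix x assume "x \<in> space M"
      then have "x \<in> topspace A" using space_eq_topspace[OF M] by simp
      then show "norm (k x z - k x y) \<le> d * indicator K x"
        using Vd[OF _ that, of x] zero[of x y] zero[of x z] y z
        by (cases "x \<in> K") (auto simp: dist_norm)
    qed (use K(2) in auto)
    also have "\<dots> = d * measure M K"
      using K(2) by simp
    also have "\<dots> < e"
    proof -
      have "measure M K + 1 \<noteq> 0"
        using measure_nonneg[of M K] by linarith
      then have "d * (measure M K + 1) = e"
        unfolding d_def by simp
      with \<open>d > 0\<close> show ?thesis by (simp only: distrib_left)
    qed
    finally show ?thesis .
  qed
  then have "\<forall>z\<in>V. dist (\<integral>x. k x z \<partial>M) (\<integral>x. k x y \<partial>M) < e"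
    by (rule ballI)
  with V have "openin B V \<and> y \<in> V \<and> (\<forall>z\<in>V. dist (\<integral>x. k x z \<partial>M) (\<integral>x. k x y \<partial>M) < e)"
    by (intro conjI)
  then show "\<exists>U. openin B U \<and> y \<in> U \<and>
      (\<forall>z\<in>U. dist (\<integral>x. k x z \<partial>M) (\<integral>x. k x y \<partial>M) < e)"
    by (rule exI)
qed

text \<open>Without second countability the Borel sets of a product need not lie in the product of the
  Borel \<open>\<sigma>\<close>-algebras, but a continuous function on a product of compact sets is still measurable
  for the latter: it is a uniform limit of finite sums of products.\<close>

lemma borel_measurable_pair_compact:
  fixes k :: "'a \<Rightarrow> 'b \<Rightarrow> complex"
  assumes A: "Hausdorff_space A" "sets M = sets (borel_of A)"
    and B: "Hausdorff_space B" "sets N = sets (borel_of B)"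
    and k: "continuous_map (prod_topology A B) euclidean (\<lambda>(x, y). k x y)"
    and K: "compactin A K" and L: "compactin B L"
  shows "(\<lambda>(x, y). indicator K x * indicator L y * k x y) \<in> borel_measurable (M \<Otimes>\<^sub>M N)"
proof -
  have [measurable]: "K \<in> sets M" "L \<in> sets N"
    using A B K L by (auto intro: sets_borel_of_compactin)
  let ?F = "\<lambda>(x, y). indicator K x * indicator L y * k x y"
  have approx: "\<exists>s \<in> borel_measurable (M \<Otimes>\<^sub>M N). \<forall>z\<in>space (M \<Otimes>\<^sub>M N). dist (s z) (?F z) \<le> e"
    if e: "e > 0" for e :: real
  proof -
    have "\<forall>y\<in>L. \<exists>V. openin B V \<and> y \<in> V \<and> (\<forall>x\<in>K. \<forall>z\<in>V. dist (k x z) (k x y) < e)"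
      using compactin_uniformly_close[OF k K _ e] compactin_subset_topspace[OF L]
      by (metis subsetD)
    then obtain V where V: "\<And>y. y \<in> L \<Longrightarrow> openin B (V y)" "\<And>y. y \<in> L \<Longrightarrow> y \<in> V y"
      "\<And>x y z. y \<in> L \<Longrightarrow> x \<in> K \<Longrightarrow> z \<in> V y \<Longrightarrow> dist (k x z) (k x y) < e"
      by metis
    have "(\<forall>U\<in>V ` L. openin B U) \<and> L \<subseteq> \<Union>(V ` L)"
      using V(1,2) by blast
    with L have "\<exists>\<F>. finite \<F> \<and> \<F> \<subseteq> V ` L \<and> L \<subseteq> \<Union>\<F>"
      unfolding compactin_def by blast
    then obtain \<F> where \<F>: "finite \<F>" "\<F> \<subseteq> V ` L" "L \<subseteq> \<Union>\<F>"
      by blast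
    obtain S where S: "S \<subseteq> L" "finite S" "\<F> = V ` S"
      using finite_subset_image[OF \<F>(1,2)] by metis
    obtain ys :: "'b list" where ys: "set ys = S"
      using finite_list[OF S(2)] by blast
    \<comment> \<open>This makes the finite cover disjoint: each point of \<open>L\<close> lies in
      \<open>W i\<close> for exactly one index, the first whose neighbourhood contains it. Hence a
      single term of \<open>s\<close> survives, with \<open>y\<close> replaced by the centre
      \<open>ys ! i\<close>.\<close>
    define W where "W = (\<lambda>i. V (ys ! i) \<inter> L - (\<Union>j<i. V (ys ! j)))"
    have VN: "V (ys ! i) \<in> sets N" if "i < length ys" for i
      using that ys S(1) nth_mem[OF that] by (intro sets_borel_of_openin[OF B(2)] V(1)) blast
    have WN[measurable]: "W i \<in> sets N" if "i < length ys" for i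
      unfolding W_def using that by (intro sets.Diff sets.Int sets.finite_UN VN) auto
    define s where "s = (\<lambda>(x, y). \<Sum>i<length ys. indicator K x * indicator (W i) y * k x (ys ! i))"
    have ky: "(\<lambda>x. k x (ys ! i)) \<in> borel_measurable M" if "i < length ys" for i
    proof (rule continuous_map_borel_measurable[OF A(2)], rule continuous_map_curry1[OF k])
      show "ys ! i \<in> topspace B"
        using that ys S(1) compactin_subset_topspace[OF L] nth_mem[OF that] by blast
    qed
    have "s \<in> borel_measurable (M \<Otimes>\<^sub>M N)"
      unfolding s_def split_def
    proof (rule borel_measurable_sum)
      fix i assume "i \<in> {..<length ys}"
      then have [measurable]: "W i \<in> sets N" "(\<lambda>x. k x (ys ! i)) \<in> borel_measurable M"
        using WN ky by auto
      show "(\<lambda>z. indicator K (fst z) * indicator (W i) (snd z) * k (fst z) (ys ! i))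
          \<in> borel_measurable (M \<Otimes>\<^sub>M N)"
        by measurable
    qed
    moreover have "dist (s (x, y)) (?F (x, y)) \<le> e" for x y
    proof (cases "x \<in> K \<and> y \<in> L")
      case False
      then have "s (x, y) = 0"
        by (auto simp: s_def W_def indicator_def intro!: sum.neutral)
      with False e show ?thesis by (auto simp: indicator_def)
    next
      case True
      then have "\<exists>u\<in>set ys. y \<in> V u"
        using \<F>(3) S(3) ys by blast
      then have ex: "\<exists>i. i < length ys \<and> y \<in> V (ys ! i)"
        by (metis in_set_conv_nth)
      define i where "i = (LEAST i. i < length ys \<and> y \<in> V (ys ! i))"
      have i: "i < length ys" "y \<in> V (ys ! i)"
        using LeastI_ex[OF ex] unfolding i_def by auto
      have least: "y \<notin> V (ys ! j)" if "j < i" for j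
        using not_less_Least[of j "\<lambda>i. i < length ys \<and> y \<in> V (ys ! i)"] that i(1)
        unfolding i_def[symmetric] by auto
      have "y \<in> W j \<longleftrightarrow> j = i" if "j < length ys" for j
        using True i least unfolding W_def by (cases j i rule: linorder_cases) auto
      then have "indicator K x * indicator (W j) y * k x (ys ! j) = (if j = i then k x (ys ! i) else 0)"
        if "j < length ys" for j
        using True that by simp
      then have "s (x, y) = (\<Sum>j<length ys. if j = i then k x (ys ! i) else 0)"
        unfolding s_def prod.case by (intro sum.cong) auto
      also have "\<dots> = k x (ys ! i)"
        using i(1) by simp
      finally have "dist (s (x, y)) (?F (x, y)) = dist (k x y) (k x (ys ! i))"
        using True by (simp add: dist_commute)
      also have "\<dots> \<le> e"
        using V(3)[of "ys ! i" x y] True i ys S(1) nth_mem[OF i(1)] by (intro less_imp_le) blast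
      finally show ?thesis .
    qed
    ultimately show ?thesis by (intro bexI[of _ s]) auto
  qed
  have "\<exists>s. s \<in> borel_measurable (M \<Otimes>\<^sub>M N) \<and>
      (\<forall>z\<in>space (M \<Otimes>\<^sub>M N). dist (s z) (?F z) \<le> inverse (real (Suc n)))" for n
    using approx[of "inverse (real (Suc n))"] unfolding Bex_def by simp
  then have "\<exists>s. \<forall>n. s n \<in> borel_measurable (M \<Otimes>\<^sub>M N) \<and>
      (\<forall>z\<in>space (M \<Otimes>\<^sub>M N). dist (s n z) (?F z) \<le> inverse (real (Suc n)))"
    by (intro choice) (rule allI)
  then obtain s where s0: "\<forall>n. s n \<in> borel_measurable (M \<Otimes>\<^sub>M N) \<and>
      (\<forall>z\<in>space (M \<Otimes>\<^sub>M N). dist (s n z) (?F z) \<le> inverse (real (Suc n)))"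
    by (elim exE)
  note s = conjunct1[OF spec[OF s0]] bspec[OF conjunct2[OF spec[OF s0]]]
  show ?thesis
  proof (rule borel_measurable_LIMSEQ_metric[OF s(1)])
    fix z assume "z \<in> space (M \<Otimes>\<^sub>M N)"
    then have "\<forall>n. dist (s n z) (?F z) \<le> inverse (real (Suc n))"
      using s(2) by (intro allI)
    then have "(\<lambda>n. dist (s n z) (?F z)) \<longlonglongrightarrow> 0"
      by (intro tendsto_sandwich[OF _ _ tendsto_const LIMSEQ_inverse_real_of_nat] always_eventually)
        simp_all
    then show "(\<lambda>n. s n z) \<longlonglongrightarrow> ?F z"
      by (rule tendsto_dist_iff[THEN iffD2])
  qed
qed

text \<open>Only the part \<open>h\<close> of \<open>k\<close> over the sigma-compact set
  \<open>U\<close> is shown to be product measurable, as a limit of cutoffs to compact rectangles;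
  the rest is nonzero only for \<open>y\<close> in a null set. \<open>K \<times> T\<close> has
  finite product measure and carries the function, so the bound \<open>C\<close> gives
  integrability.\<close>

lemma Fubini_continuous:
  fixes k :: "'a \<Rightarrow> 'b \<Rightarrow> complex"
  assumes A: "Hausdorff_space A" "sets M = sets (borel_of A)" "sigma_finite_measure M"
    and B: "Hausdorff_space B" "sets N = sets (borel_of B)" "sigma_finite_measure N"
    and k: "continuous_map (prod_topology A B) euclidean (\<lambda>(x, y). k x y)"
    and K: "compactin A K" "emeasure M K < \<infinity>"
    and T: "T \<in> sets N" "emeasure N T < \<infinity>"
    and L: "\<And>n :: nat. compactin B (L n)" "AE y in N. y \<in> T \<longrightarrow> y \<in> (\<Union>n. L n)"
    and zero: "\<And>x y. x \<in> topspace A \<Longrightarrow> y \<in> topspace B \<Longrightarrow> \<not> (x \<in> K \<and> y \<in> T) \<Longrightarrow> k x y = 0"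
    and bound: "\<And>x y. x \<in> topspace A \<Longrightarrow> y \<in> topspace B \<Longrightarrow> norm (k x y) \<le> C"
  shows "(\<integral>x. \<integral>y. k x y \<partial>N \<partial>M) = (\<integral>y. \<integral>x. k x y \<partial>M \<partial>N)"
proof -
  interpret M: sigma_finite_measure M by fact
  interpret N: sigma_finite_measure N by fact
  interpret pair_sigma_finite M N ..
  note spA = space_eq_topspace[OF A(2)] and spB = space_eq_topspace[OF B(2)]
  have [measurable]: "K \<in> sets M" "T \<in> sets N" "L n \<in> sets N" for n
    using A B K L T by (auto intro: sets_borel_of_compactin)
  \<comment> \<open>Increasing unions, so that at every point the cutoffs to
    \<open>K \<times> J n\<close> are eventually constant, with the value of
    \<open>h\<close>.\<close>
  define J where "J = (\<lambda>n. \<Union>i\<le>n. L i)"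
  have J: "compactin B (J n)" for n
    unfolding J_def using L(1) by (intro compactin_Union) auto
  have [measurable]: "J n \<in> sets N" for n
    using B J by (auto intro: sets_borel_of_compactin)
  define U where "U = (\<Union>n. L n)"
  have [measurable]: "U \<in> sets N" unfolding U_def by measurable
  define h where "h = (\<lambda>x y. indicator U y * k x y)"
  have hmeas: "(\<lambda>(x, y). h x y) \<in> borel_measurable (M \<Otimes>\<^sub>M N)"
  proof (rule borel_measurable_LIMSEQ_metric)
    show "(\<lambda>(x, y). indicator K x * indicator (J n) y * k x y) \<in> borel_measurable (M \<Otimes>\<^sub>M N)" for n
      by (rule borel_measurable_pair_compact[OF A(1,2) B(1,2) k K(1) J])
    fix z assume "z \<in> space (M \<Otimes>\<^sub>M N)"
    then obtain x y where z: "z = (x, y)" "x \<in> topspace A" "y \<in> topspace B"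
      by (auto simp: space_pair_measure spA spB)
    have "eventually (\<lambda>n. indicator K x * indicator (J n) y * k x y = h x y) sequentially"
    proof (cases "y \<in> U")
      case True
      then obtain i where "y \<in> L i" by (auto simp: U_def)
      then have "\<forall>n\<ge>i. y \<in> J n" by (auto simp: J_def)
      then show ?thesis
        unfolding eventually_sequentially h_def using zero[OF z(2,3)] True
        by (intro exI[of _ i]) (auto simp: indicator_def)
    next
      case False
      then have "y \<notin> J n" for n by (auto simp: J_def U_def)
      then show ?thesis using False by (auto simp: h_def)
    qed
    then show "(\<lambda>n. case z of (x, y) \<Rightarrow> indicator K x * indicator (J n) y * k x y)
        \<longlonglongrightarrow> (case z of (x, y) \<Rightarrow> h x y)"
      unfolding z by (simp add: tendsto_eventually)
  qed
  have hint: "integrable (M \<Otimes>\<^sub>M N) (\<lambda>(x, y). h x y)"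
  proof (rule integrableI_bounded_set[where A = "K \<times> T" and B = C])
    show "K \<times> T \<in> sets (M \<Otimes>\<^sub>M N)" by simp
    show "emeasure (M \<Otimes>\<^sub>M N) (K \<times> T) < \<infinity>"
      using K(2) T(2) by (simp add: N.emeasure_pair_measure_Times ennreal_mult_less_top)
    show "AE z in M \<Otimes>\<^sub>M N. z \<in> K \<times> T \<longrightarrow> norm (case z of (x, y) \<Rightarrow> h x y) \<le> C"
    proof (intro AE_I2 impI)
      fix z assume "z \<in> space (M \<Otimes>\<^sub>M N)"
      then obtain x y where z: "z = (x, y)" "x \<in> topspace A" "y \<in> topspace B"
        by (auto simp: space_pair_measure spA spB)
      have "norm (h x y) \<le> norm (k x y)"
        by (simp add: h_def indicator_def)
      then show "norm (case z of (x, y) \<Rightarrow> h x y) \<le> C"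
        using bound[OF z(2,3)] z(1) by simp
    qed
    show "AE z in M \<Otimes>\<^sub>M N. z \<notin> K \<times> T \<longrightarrow> (case z of (x, y) \<Rightarrow> h x y) = 0"
    proof (intro AE_I2 impI)
      fix z assume "z \<in> space (M \<Otimes>\<^sub>M N)" "z \<notin> K \<times> T"
      then obtain x y where z: "z = (x, y)" "x \<in> topspace A" "y \<in> topspace B" "\<not> (x \<in> K \<and> y \<in> T)"
        by (auto simp: space_pair_measure spA spB)
      show "(case z of (x, y) \<Rightarrow> h x y) = 0"
        using zero[OF z(2-4)] z(1) by (simp add: h_def)
    qed
  qed (rule hmeas)
  have ae: "AE y in N. y \<in> T \<longrightarrow> y \<in> U"
    using L(2) by (simp add: U_def)
  have kB: "k x \<in> borel_measurable N" if "x \<in> topspace A" for x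
    by (rule continuous_map_borel_measurable[OF B(2) continuous_map_curry2[OF k that]])
  \<comment> \<open>For each fixed \<open>x\<close> the cut changes the integrand on a null set of
    \<open>y\<close> only, so the inner integrals agree exactly. In the other order they agree for
    almost every \<open>y\<close>, and there measurability of the parameter integral is needed as
    well.\<close>
  have "(\<integral>x. \<integral>y. k x y \<partial>N \<partial>M) = (\<integral>x. \<integral>y. h x y \<partial>N \<partial>M)"
  proof (rule Bochner_Integration.integral_cong[OF refl])
    fix x assume "x \<in> space M"
    then have x: "x \<in> topspace A" by (simp add: spA)
    have "AE y in N. k x y = h x y"
      using ae AE_space[of N] zero[OF x] by (auto simp: h_def spB indicator_def)
    then show "(\<integral>y. k x y \<partial>N) = (\<integral>y. h x y \<partial>N)"
      using kB[OF x] unfolding h_def by (intro integral_cong_AE) auto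
  qed
  also have "\<dots> = (\<integral>y. \<integral>x. h x y \<partial>M \<partial>N)"
    by (rule Fubini_integral[symmetric]) (rule hint)
  also have "\<dots> = (\<integral>y. indicator U y * (\<integral>x. k x y \<partial>M) \<partial>N)"
    unfolding h_def by (intro Bochner_Integration.integral_cong[OF refl]) simp
  also have "\<dots> = (\<integral>y. \<integral>x. k x y \<partial>M \<partial>N)"
  proof -
    have "(\<lambda>y. \<integral>x. k x y \<partial>M) \<in> borel_measurable N"
      using zero
      by (intro continuous_map_borel_measurable[OF B(2)]
          continuous_map_parametric_integral[OF A(1,2) k K]) auto
    moreover have "AE y in N. indicator U y * (\<integral>x. k x y \<partial>M) = (\<integral>x. k x y \<partial>M)"
    proof -
      have "(\<integral>x. k x y \<partial>M) = 0" if "y \<in> space N" "y \<notin> T" for y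
        using that zero by (auto simp: spA spB intro!: integral_eq_zero_AE)
      then show ?thesis
        using ae AE_space[of N] by (auto simp: indicator_def)
    qed
    ultimately show ?thesis
      by (intro integral_cong_AE borel_measurable_times borel_measurable_indicator) simp_all
  qed
  finally show ?thesis .
qed


section \<open>Compactly supported functions on a locally compact abelian group\<close>

lemma Cc_I:
  fixes \<phi> :: "'g::t2_space \<Rightarrow> complex"
  assumes "continuous_on UNIV \<phi>" "compact K" "\<And>t. t \<notin> K \<Longrightarrow> \<phi> t = 0"
  shows "\<phi> \<in> Cc"
proof -
  have "supp \<phi> \<subseteq> K"
    unfolding supp_def using assms by (intro closure_minimal compact_imp_closed) auto
  then have "compact (supp \<phi>)"
    using compact_Int_closed[OF assms(2), of "supp \<phi>"]
    by (simp add: supp_def Int_absorb1 inf.absorb2)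
  with assms(1) show ?thesis by (simp add: Cc_def)
qed

lemma Cc_continuous: "\<phi> \<in> Cc \<Longrightarrow> continuous_on UNIV \<phi>"
  and Cc_compact_supp: "\<phi> \<in> Cc \<Longrightarrow> compact (supp \<phi>)"
  by (auto simp: Cc_def)

lemma notin_supp:
  assumes "t \<notin> supp \<phi>"
  shows "\<phi> t = 0"
proof (rule ccontr)
  assume "\<phi> t \<noteq> 0"
  then have "t \<in> {t. \<phi> t \<noteq> 0}" by (rule CollectI)
  then have "t \<in> supp \<phi>" unfolding supp_def by (rule subsetD[OF closure_subset])
  with assms show False by (rule notE)
qed

lemma Cc_mult:
  fixes \<phi> g :: "'g::t2_space \<Rightarrow> complex"
  assumes "\<phi> \<in> Cc" "continuous_on UNIV g"
  shows "(\<lambda>t. \<phi> t * g t) \<in> Cc"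
  using assms notin_supp[of _ \<phi>]
  by (intro Cc_I[OF _ Cc_compact_supp[OF assms(1)]] continuous_on_mult Cc_continuous[OF assms(1)]) auto

lemma Cc_cmult:
  fixes \<phi> :: "'g::t2_space \<Rightarrow> complex"
  shows "\<phi> \<in> Cc \<Longrightarrow> (\<lambda>t. c * \<phi> t) \<in> Cc"
  using Cc_mult[of \<phi> "\<lambda>t. c"] by (simp add: mult.commute)

lemma Cc_add:
  fixes \<phi> \<psi> :: "'g::t2_space \<Rightarrow> complex"
  assumes "\<phi> \<in> Cc" "\<psi> \<in> Cc"
  shows "(\<lambda>t. \<phi> t + \<psi> t) \<in> Cc"
  using assms notin_supp[of _ \<phi>] notin_supp[of _ \<psi>]
  by (intro Cc_I[OF _ compact_Un[OF assms[THEN Cc_compact_supp]]] continuous_on_add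
      assms[THEN Cc_continuous]) auto

lemma Cc_cnj:
  fixes \<phi> :: "'g::t2_space \<Rightarrow> complex"
  assumes "\<phi> \<in> Cc"
  shows "(\<lambda>t. cnj (\<phi> t)) \<in> Cc"
  using assms notin_supp[of _ \<phi>]
  by (intro Cc_I[OF _ Cc_compact_supp[OF assms]] continuous_on_cnj Cc_continuous[OF assms]) auto

lemma compact_sum_set:
  fixes S T :: "'g::topological_ab_group_add set"
  assumes "compact S" "compact T"
  shows "compact ((\<lambda>(a, b). a + b) ` (S \<times> T))"
  unfolding split_def
  by (intro compact_continuous_image compact_Times continuous_intros assms)

lemma compact_diff_set:
  fixes S T :: "'g::topological_ab_group_add set"
  assumes "compact S" "compact T"
  shows "compact ((\<lambda>(a, b). a - b) ` (S \<times> T))"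
  unfolding split_def
  by (intro compact_continuous_image compact_Times continuous_intros assms)

lemma Cc_uminus:
  fixes \<phi> :: "'g::{topological_ab_group_add,t2_space} \<Rightarrow> complex"
  assumes "\<phi> \<in> Cc"
  shows "(\<lambda>t. \<phi> (- t)) \<in> Cc"
proof (rule Cc_I)
  show "continuous_on UNIV (\<lambda>t. \<phi> (- t))"
    by (rule continuous_on_compose2[OF Cc_continuous[OF assms]]) (auto intro: continuous_intros)
  show "compact (uminus ` supp \<phi>)"
    by (intro compact_continuous_image continuous_intros Cc_compact_supp[OF assms])
  show "\<phi> (- t) = 0" if "t \<notin> uminus ` supp \<phi>" for t
  proof (rule notin_supp[of "- t"])
    show "- t \<notin> supp \<phi>" using that by (metis image_eqI minus_minus)
  qed
qed

lemma Cc_tilde: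
  fixes \<phi> :: "'g::{topological_ab_group_add,t2_space} \<Rightarrow> complex"
  assumes "\<phi> \<in> Cc"
  shows "tilde \<phi> \<in> Cc"
  using Cc_cnj[OF Cc_uminus[OF assms]] unfolding tilde_def .

lemma continuous_on_compose_UNIV:
  assumes "continuous_on UNIV g" "continuous_on UNIV f"
  shows "continuous_on UNIV (\<lambda>x. g (f x))"
  by (rule continuous_on_compose2[OF assms]) auto

section \<open>Haar measure\<close>

locale haar_group =
  fixes mG :: "'g::{topological_ab_group_add,t2_space} measure"
  assumes lc: "locally_compact_space (euclidean :: 'g topology)"
    and sc: "sigma_compact (UNIV :: 'g set)"
    and haar: "haar_measure mG"
begin

lemma sets_mG': "sets mG = sets (borel_of euclidean)"
  using haar unfolding haar_measure_def radon_measure_def by auto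

lemma sets_mG [measurable_cong]: "sets mG = sets borel"
  using sets_mG' borel_of_euclidean by simp

lemma space_mG [simp]: "space mG = UNIV"
  using space_eq_topspace[OF sets_mG'] by simp

lemma emeasure_compact: "compact K \<Longrightarrow> emeasure mG K < top"
  using haar unfolding haar_measure_def radon_measure_def by auto

lemma Hausdorff_group: "Hausdorff_space (euclidean :: 'g topology)"
  unfolding Hausdorff_space_def disjnt_def using hausdorff by auto

lemma sets_compact: "compact K \<Longrightarrow> K \<in> sets mG"
  using sets_borel_of_compactin[OF Hausdorff_group sets_mG', of K] by simp

lemma sigma_finite: "sigma_finite_measure mG"
proof
  from sc obtain K :: "nat \<Rightarrow> 'g set" where K: "\<And>n. compact (K n)" "UNIV = (\<Union>n. K n)"
    unfolding sigma_compact_def by auto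
  have "range K \<subseteq> sets mG" using sets_compact K(1) by auto
  moreover have "\<forall>a\<in>range K. emeasure mG a \<noteq> \<infinity>"
    using emeasure_compact[OF K(1)] by (auto simp: less_top[symmetric])
  ultimately show "\<exists>A. countable A \<and> A \<subseteq> sets mG \<and> \<Union> A = space mG \<and> (\<forall>a\<in>A. emeasure mG a \<noteq> \<infinity>)"
    using K(2) by (intro exI[of _ "range K"]) simp
qed

lemma translation_measurable: "(\<lambda>s. t + s) \<in> measurable mG mG"
  by (rule continuous_map_measurable_borel_of[OF sets_mG' sets_mG'])
    (auto intro!: continuous_intros)

lemma distr_translation: "distr mG mG (\<lambda>s. t + s) = mG"
  using haar unfolding haar_measure_def by auto

lemma integral_translation:
  fixes f :: "'g \<Rightarrow> complex"
  assumes "continuous_on UNIV f"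
  shows "(\<integral>s. f (t + s) \<partial>mG) = (\<integral>s. f s \<partial>mG)"
proof -
  have "f \<in> borel_measurable mG"
    by (rule continuous_map_borel_measurable[OF sets_mG']) (use assms in auto)
  with integral_distr[OF translation_measurable this, of t] show ?thesis
    by (simp add: distr_translation)
qed

lemma emeasure_translation:
  assumes "open U"
  shows "emeasure mG ((\<lambda>s. t + s) ` U) = emeasure mG U"
proof -
  have eq: "(\<lambda>s. t + s) ` U = (\<lambda>s. - t + s) -` U"
    by (auto intro: image_eqI[of _ _ "- t + _"])
  have "emeasure mG U = emeasure (distr mG mG (\<lambda>s. - t + s)) U"
    by (subst distr_translation) (rule refl)
  also have "\<dots> = emeasure mG ((\<lambda>s. - t + s) -` U \<inter> space mG)"
    using assms by (intro emeasure_distr translation_measurable) (simp add: sets_mG)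
  finally show ?thesis by (simp add: eq)
qed

lemma open_translation:
  fixes U :: "'g set"
  assumes "open U"
  shows "open ((\<lambda>s. t + s) ` U)"
proof -
  have "(\<lambda>s. t + s) ` U = (\<lambda>s. - t + s) -` U"
    by (auto intro: image_eqI[of _ _ "- t + _"])
  moreover have "open ((\<lambda>s. - t + s) -` U)"
    using assms by (intro open_vimage continuous_intros)
  ultimately show ?thesis by simp
qed

text \<open>Finitely many translates of \<open>U\<close> cover any compact set. If \<open>U\<close>
  were null, all compact sets would be null and, by sigma-compactness, so would the whole
  group.\<close>

lemma emeasure_open_pos:
  assumes "open U" "U \<noteq> {}"
  shows "emeasure mG U \<noteq> 0"
proof
  assume 0: "emeasure mG U = 0"
  obtain u where u: "u \<in> U" using assms(2) by auto
  have null: "emeasure mG C = 0" if C: "compact C" for C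
  proof -
    have "C \<subseteq> (\<Union>t\<in>UNIV. (\<lambda>s. t + s) ` U)"
    proof
      fix x assume "x \<in> C"
      have "x = (x - u) + u" by simp
      then show "x \<in> (\<Union>t\<in>UNIV. (\<lambda>s. t + s) ` U)" using u by blast
    qed
    then obtain D where D: "finite D" "C \<subseteq> (\<Union>t\<in>D. (\<lambda>s. t + s) ` U)"
      using compactE_image[OF C, of UNIV "\<lambda>t. (\<lambda>s. t + s) ` U"] open_translation[OF assms(1)]
      by metis
    have "emeasure mG (\<Union>t\<in>D. (\<lambda>s. t + s) ` U) \<le> (\<Sum>t\<in>D. emeasure mG ((\<lambda>s. t + s) ` U))"
      using open_translation[OF assms(1)] D(1)
      by (intro emeasure_subadditive_finite) (auto simp: sets_mG)
    also have "\<dots> = 0"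
      using emeasure_translation[OF assms(1)] 0 by simp
    finally have "emeasure mG (\<Union>t\<in>D. (\<lambda>s. t + s) ` U) = 0" by simp
    moreover have "(\<Union>t\<in>D. (\<lambda>s. t + s) ` U) \<in> sets mG"
      using open_translation[OF assms(1)] unfolding sets_mG by (intro borel_open open_UN) auto
    ultimately show ?thesis
      using emeasure_mono[OF D(2), of mG] by simp
  qed
  from sc obtain K :: "nat \<Rightarrow> 'g set" where K: "\<And>n. compact (K n)" "UNIV = (\<Union>n. K n)"
    unfolding sigma_compact_def by auto
  have "emeasure mG (\<Union>n. K n) = 0"
    using K(1) null by (intro emeasure_UN_eq_0) (auto simp: sets_compact)
  with K(2) haar show False unfolding haar_measure_def by simp
qed

lemma Cc_integrable: "\<phi> \<in> Cc \<Longrightarrow> integrable mG \<phi>"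
  using notin_supp[of _ \<phi>]
  by (intro integrable_continuous_compact_support[OF Hausdorff_group sets_mG', of _ "supp \<phi>"])
    (auto simp: Cc_continuous Cc_compact_supp emeasure_compact)

lemma Cc_Fubini:
  fixes k :: "'g \<Rightarrow> 'g \<Rightarrow> complex"
  assumes k: "continuous_on UNIV (\<lambda>(x, y). k x y)" and K: "compact K" and L: "compact L"
    and zero: "\<And>x y. \<not> (x \<in> K \<and> y \<in> L) \<Longrightarrow> k x y = 0"
  shows "(\<integral>x. \<integral>y. k x y \<partial>mG \<partial>mG) = (\<integral>y. \<integral>x. k x y \<partial>mG \<partial>mG)"
proof -
  have "continuous_map euclidean euclidean (\<lambda>(x, y). k x y)" using k by simp
  moreover have "compactin euclidean (K \<times> L)"
    using K L by (simp add: compact_Times)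
  ultimately obtain C where C: "C \<ge> 0" "\<And>z. z \<in> K \<times> L \<Longrightarrow> norm (case z of (x, y) \<Rightarrow> k x y) \<le> C"
    by (rule continuous_map_compact_bounded) blast
  have bnd: "norm (k x y) \<le> C" for x y
    using C(2)[of "(x, y)"] zero[of x y] C(1) by (cases "(x, y) \<in> K \<times> L") auto
  show ?thesis
  proof (rule Fubini_continuous[where A = euclidean and B = euclidean and K = K and T = L
        and L = "\<lambda>_. L" and C = C])
    show "continuous_map (prod_topology euclidean euclidean) euclidean (\<lambda>(x, y). k x y)"
      using k by simp
  qed (use K L zero bnd Hausdorff_group in
      \<open>auto simp: sets_mG' sigma_finite emeasure_compact sets_compact[unfolded sets_mG']\<close>)
qed

lemma continuous_parametric:
  fixes k :: "'g \<Rightarrow> 'b::topological_space \<Rightarrow> complex"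
  assumes k: "continuous_on UNIV (\<lambda>(x, y). k x y)" and K: "compact K"
    and zero: "\<And>x y. x \<notin> K \<Longrightarrow> k x y = 0"
  shows "continuous_on UNIV (\<lambda>y. \<integral>x. k x y \<partial>mG)"
  using continuous_map_parametric_integral[OF Hausdorff_group sets_mG', of euclidean k K] k K zero
  by (simp add: emeasure_compact)

lemma conv_Cc:
  fixes \<phi> \<psi> :: "'g \<Rightarrow> complex"
  assumes "\<phi> \<in> Cc" "\<psi> \<in> Cc"
  shows "conv mG \<phi> \<psi> \<in> Cc"
proof (rule Cc_I)
  show "continuous_on UNIV (conv mG \<phi> \<psi>)"
    unfolding conv_def
  proof (rule continuous_parametric)
    show "continuous_on UNIV (\<lambda>(s, t). \<phi> (t - s) * \<psi> s)"
      unfolding split_def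
      by (intro continuous_intros continuous_on_compose_UNIV[OF Cc_continuous[OF assms(1)]]
          continuous_on_compose_UNIV[OF Cc_continuous[OF assms(2)]])
    show "compact (supp \<psi>)" by (rule Cc_compact_supp[OF assms(2)])
    show "\<phi> (y - x) * \<psi> x = 0" if "x \<notin> supp \<psi>" for x y
      using notin_supp[OF that] by simp
  qed
  show "compact ((\<lambda>(a, b). a + b) ` (supp \<phi> \<times> supp \<psi>))"
    by (intro compact_sum_set assms[THEN Cc_compact_supp])
  show "conv mG \<phi> \<psi> t = 0" if "t \<notin> (\<lambda>(a, b). a + b) ` (supp \<phi> \<times> supp \<psi>)" for t
  proof -
    have "\<phi> (t - s) * \<psi> s = 0" for s
    proof (rule ccontr)
      assume "\<phi> (t - s) * \<psi> s \<noteq> 0"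
      then have "(t - s, s) \<in> supp \<phi> \<times> supp \<psi>" using notin_supp by fastforce
      then have "(t - s) + s \<in> (\<lambda>(a, b). a + b) ` (supp \<phi> \<times> supp \<psi>)"
        by (metis (no_types, lifting) case_prod_conv image_eqI)
      with that show False by simp
    qed
    then show ?thesis by (simp only: conv_def Bochner_Integration.integral_zero)
  qed
qed

text \<open>A probability density with respect to \<open>mG\<close> concentrated on
  \<open>V\<close>. It is real-valued so that it can be compared with norms directly. Concentration
  means vanishing off \<open>V\<close>, the form in which \<open>bump_average\<close> uses
  it.\<close>

definition bump :: "'g set \<Rightarrow> ('g \<Rightarrow> real) \<Rightarrow> bool" where
  "bump V p \<longleftrightarrow> (\<lambda>t. complex_of_real (p t)) \<in> Cc \<and> (\<forall>t. 0 \<le> p t) \<and> (\<forall>t. t \<notin> V \<longrightarrow> p t = 0) \<and>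
     (\<integral>t. p t \<partial>mG) = 1"

lemma compact_nbhd:
  obtains U C :: "'g set" where "open U" "compact C" "t \<in> U" "U \<subseteq> C"
  using lc unfolding locally_compact_space_def by (metis UNIV_I compactin_euclidean_iff open_openin topspace_euclidean)

text \<open>Complete regularity of a locally compact Hausdorff space separates \<open>t0\<close>
  from the complement of \<open>V \<inter> U\<close>, and \<open>U\<close> lies in a compact set,
  whence the compact support. Normalisation is possible because nonempty open sets have positive
  Haar measure.\<close>

lemma bump_exists:
  assumes V: "open V" "t0 \<in> V"
  obtains p where "bump V p"
proof -
  obtain U C :: "'g set" where UC: "open U" "compact C" "t0 \<in> U" "U \<subseteq> C"
    by (rule compact_nbhd)
  have cr: "completely_regular_space (euclidean :: 'g topology)"
    using lc Hausdorff_group by (intro locally_compact_regular_imp_completely_regular_space) auto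
  have "openin euclidean (V \<inter> U)" using V UC by auto
  then obtain f where f: "continuous_map euclidean euclideanreal f" "f t0 = 0"
    "f ` (topspace euclidean - V \<inter> U) \<subseteq> {1}"
    using cr V UC unfolding completely_regular_space_alt' by (metis IntI)
  \<comment> \<open>\<open>f\<close> is 0 at \<open>t0\<close> and 1 off
    \<open>V \<inter> U\<close>, so \<open>1 - f\<close> is 1 at \<open>t0\<close> and vanishes
    where it should; the maximum is taken because \<open>f\<close> may exceed 1.\<close>
  define g where "g t = max 0 (1 - f t)" for t
  have cg: "continuous_on UNIV g"
    using f(1) unfolding g_def by (intro continuous_intros) auto
  have g0: "g t \<ge> 0" for t by (simp add: g_def)
  have gz: "g t = 0" if "t \<notin> V \<inter> U" for t
  proof -
    have "f t \<in> f ` (topspace euclidean - V \<inter> U)" using that by (intro imageI) simp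
    then have "f t \<in> {1}" by (rule subsetD[OF f(3)])
    then show ?thesis by (simp add: g_def)
  qed
  have gC: "(\<lambda>t. complex_of_real (c * g t)) \<in> Cc" for c
  proof (rule Cc_I[OF _ UC(2)])
    show "continuous_on UNIV (\<lambda>t. complex_of_real (c * g t))"
      by (intro continuous_intros cg)
    show "complex_of_real (c * g t) = 0" if "t \<notin> C" for t
    proof -
      have "t \<notin> V \<inter> U" using UC(4) that by blast
      then show ?thesis by (simp add: gz)
    qed
  qed
  have gi: "integrable mG g"
    using Cc_integrable[OF gC[of 1]] by (simp add: complex_of_real_integrable_eq)
  have "(\<integral>t. g t \<partial>mG) \<noteq> 0"
  proof
    assume "(\<integral>t. g t \<partial>mG) = 0"
    then have "AE t in mG. g t = 0"
      using integral_nonneg_eq_0_iff_AE[OF gi] g0 by simp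
    then have "emeasure mG {t \<in> space mG. g t \<noteq> 0} = 0"
      using borel_measurable_integrable[OF gi] by (subst (asm) AE_iff_measurable[OF _ refl]) auto
    moreover have "open {t. g t \<noteq> 0}"
      using cg by (intro open_Collect_neq continuous_intros)
    moreover have "t0 \<in> {t. g t \<noteq> 0}" using f(2) by (simp add: g_def)
    ultimately show False using emeasure_open_pos[of "{t. g t \<noteq> 0}"] by auto
  qed
  moreover have "(\<integral>t. g t \<partial>mG) \<ge> 0" using g0 by simp
  ultimately have "(\<integral>t. g t \<partial>mG) > 0" by simp
  then have "bump V (\<lambda>t. inverse (\<integral>t. g t \<partial>mG) * g t)"
    unfolding bump_def using gC[of "inverse (\<integral>t. g t \<partial>mG)"] g0 gz by auto
  then show ?thesis by (rule that)
qed

lemma bump_Cc: "bump V p \<Longrightarrow> (\<lambda>t. complex_of_real (p t)) \<in> Cc"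
  by (simp add: bump_def)

lemma bump_integral: "bump V p \<Longrightarrow> (\<integral>t. complex_of_real (p t) \<partial>mG) = 1"
  by (simp add: bump_def)

text \<open>Total mass 1 lets \<open>c\<close> be written as the average of the constant
  \<open>c\<close>, after which the difference is bounded pointwise. It is applied to translates of
  a \<open>Cc\<close> function, to kernels \<open>A (t - s)\<close> and to characters.\<close>

lemma bump_average:
  fixes g :: "'g \<Rightarrow> complex"
  assumes p: "bump V p" and g: "continuous_on UNIV g" and e: "\<And>t. t \<in> V \<Longrightarrow> norm (g t - c) \<le> e"
  shows "norm ((\<integral>t. complex_of_real (p t) * g t \<partial>mG) - c) \<le> e"
proof -
  note pC = bump_Cc[OF p]
  have pi: "integrable mG p"
    using Cc_integrable[OF pC] by (simp add: complex_of_real_integrable_eq)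
  have "(\<integral>t. complex_of_real (p t) * g t \<partial>mG) - c
      = (\<integral>t. complex_of_real (p t) * g t \<partial>mG) - (\<integral>t. complex_of_real (p t) * c \<partial>mG)"
    using bump_integral[OF p] by simp
  also have "\<dots> = (\<integral>t. complex_of_real (p t) * g t - complex_of_real (p t) * c \<partial>mG)"
    using Cc_integrable[OF Cc_mult[OF pC g]] Cc_integrable[OF pC] by simp
  also have "norm \<dots> \<le> (\<integral>t. p t * e \<partial>mG)"
  proof (rule norm_integral_le)
    fix t
    show "norm (complex_of_real (p t) * g t - complex_of_real (p t) * c) \<le> p t * e"
      using p e[of t]
      by (cases "t \<in> V")
        (auto simp: bump_def norm_mult mult_left_mono simp flip: right_diff_distrib)
  qed (use pi in auto)
  also have "\<dots> = e" using p by (simp add: bump_def)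
  finally show ?thesis .
qed

text \<open>Evaluating \<open>\<integral>\<integral> \<phi>(t) \<psi>(s + t) ds dt\<close> in both orders gives \<open>\<integral>\<phi> \<integral>\<psi>\<close> and \<open>\<integral>\<psi> \<integral>\<phi>(- \<cdot>)\<close>.\<close>

lemma integral_uminus:
  fixes \<phi> :: "'g \<Rightarrow> complex"
  assumes \<phi>: "\<phi> \<in> Cc"
  shows "(\<integral>t. \<phi> (- t) \<partial>mG) = (\<integral>t. \<phi> t \<partial>mG)"
proof -
  obtain p where p: "bump UNIV p" using bump_exists[of UNIV 0] by auto
  define \<psi> where "\<psi> t = complex_of_real (p t)" for t
  have \<psi>: "\<psi> \<in> Cc" "(\<integral>t. \<psi> t \<partial>mG) = 1"
    using bump_Cc[OF p] bump_integral[OF p] by (auto simp: \<psi>_def[abs_def])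
  note c\<phi> = continuous_on_compose_UNIV[OF Cc_continuous[OF \<phi>]]
    and c\<psi> = continuous_on_compose_UNIV[OF Cc_continuous[OF \<psi>(1)]]
  \<comment> \<open>In each double integral below the variable without a support of its own is a
    difference of a point where \<open>\<psi>\<close> is nonzero and one where \<open>\<phi>\<close>
    is nonzero. This compact set contains all such differences, as \<open>Cc_Fubini\<close>
    requires.\<close>
  let ?L = "(\<lambda>(a, b). a - b) ` (supp \<psi> \<times> supp \<phi>)"
  have L: "compact ?L" by (intro compact_diff_set Cc_compact_supp[OF \<phi>] Cc_compact_supp[OF \<psi>(1)])
  have inL: "a - b \<in> ?L" if "\<psi> a \<noteq> 0" "\<phi> b \<noteq> 0" for a b
    using that notin_supp[of a \<psi>] notin_supp[of b \<phi>] by (intro image_eqI[of _ _ "(a, b)"]) auto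
  have "(\<integral>t. \<phi> t \<partial>mG) = (\<integral>t. \<phi> t * (\<integral>s. \<psi> (t + s) \<partial>mG) \<partial>mG)"
    using integral_translation[OF Cc_continuous[OF \<psi>(1)]] \<psi>(2) by simp
  also have "\<dots> = (\<integral>t. \<integral>s. \<phi> t * \<psi> (t + s) \<partial>mG \<partial>mG)" by simp
  also have "\<dots> = (\<integral>s. \<integral>t. \<phi> t * \<psi> (t + s) \<partial>mG \<partial>mG)"
  proof (rule Cc_Fubini)
    show "continuous_on UNIV (\<lambda>(x, y). \<phi> x * \<psi> (x + y))"
      unfolding split_def by (intro continuous_intros c\<phi> c\<psi>)
    show "compact (supp \<phi>)" by (rule Cc_compact_supp[OF \<phi>])
    show "\<phi> x * \<psi> (x + y) = 0" if "\<not> (x \<in> supp \<phi> \<and> y \<in> ?L)" for x y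
      using inL[of "x + y" x] notin_supp[of x \<phi>] that by fastforce
  qed (rule L)
  also have "\<dots> = (\<integral>s. \<integral>t. \<phi> (t - s) * \<psi> t \<partial>mG \<partial>mG)"
  proof (rule Bochner_Integration.integral_cong[OF refl])
    fix s
    have "continuous_on UNIV (\<lambda>t. \<phi> (t - s) * \<psi> t)"
      by (intro continuous_intros c\<phi> c\<psi>)
    from integral_translation[OF this, of s]
    show "(\<integral>t. \<phi> t * \<psi> (t + s) \<partial>mG) = (\<integral>t. \<phi> (t - s) * \<psi> t \<partial>mG)"
      by (simp add: add.commute)
  qed
  also have "\<dots> = (\<integral>t. \<integral>s. \<phi> (t - s) * \<psi> t \<partial>mG \<partial>mG)"
  proof (rule Cc_Fubini[where K = ?L and L = "supp \<psi>"])
    show "continuous_on UNIV (\<lambda>(x, y). \<phi> (y - x) * \<psi> y)"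
      unfolding split_def by (intro continuous_intros c\<phi> c\<psi>)
    show "compact (supp \<psi>)" by (rule Cc_compact_supp[OF \<psi>(1)])
    show "\<phi> (y - x) * \<psi> y = 0" if "\<not> (x \<in> ?L \<and> y \<in> supp \<psi>)" for x y
      using inL[of y "y - x"] notin_supp[of y \<psi>] that by fastforce
  qed (rule L)
  also have "\<dots> = (\<integral>t. \<psi> t * (\<integral>s. \<phi> (- s) \<partial>mG) \<partial>mG)"
  proof (rule Bochner_Integration.integral_cong[OF refl])
    fix t
    have "continuous_on UNIV (\<lambda>s. \<phi> (- s))" by (intro c\<phi> continuous_intros)
    from integral_translation[OF this, of "- t"]
    have "(\<integral>s. \<phi> (t - s) \<partial>mG) = (\<integral>s. \<phi> (- s) \<partial>mG)" by simp
    then show "(\<integral>s. \<phi> (t - s) * \<psi> t \<partial>mG) = \<psi> t * (\<integral>s. \<phi> (- s) \<partial>mG)"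
      by (simp add: mult.commute)
  qed
  also have "\<dots> = (\<integral>s. \<phi> (- s) \<partial>mG)" using \<psi>(2) by simp
  finally show ?thesis by simp
qed

text \<open>Convolution with \<open>tilde \<psi>\<close> averages translates of
  \<open>\<theta>\<close> by small amounts. \<open>K\<close> is chosen before \<open>e\<close>
  because the continuity constant of a functional on \<open>Cc\<close> depends on the compact set
  that carries the functions.\<close>

lemma approximate_identity:
  fixes \<theta> :: "'g \<Rightarrow> complex"
  assumes \<theta>: "\<theta> \<in> Cc"
  obtains K where "compact K"
    "\<forall>e>0. \<exists>\<psi>\<in>Cc. (\<forall>t. norm (conv mG \<theta> (tilde \<psi>) t - \<theta> t) \<le> e) \<and>
       (\<forall>t. t \<notin> K \<longrightarrow> conv mG \<theta> (tilde \<psi>) t = 0 \<and> \<theta> t = 0)"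
proof -
  obtain U C :: "'g set" where UC: "open U" "compact C" "0 \<in> U" "U \<subseteq> C"
    by (rule compact_nbhd)
  note c\<theta> = continuous_on_compose_UNIV[OF Cc_continuous[OF \<theta>]]
  \<comment> \<open>Room for every shift of \<open>\<theta>\<close> by an element of
    \<open>U\<close>; as 0 lies in \<open>U\<close>, also \<open>\<theta>\<close> itself vanishes
    off \<open>K\<close>.\<close>
  define K where "K = (\<lambda>(a, b). a + b) ` (supp \<theta> \<times> C)"
  have K: "compact K" unfolding K_def by (intro compact_sum_set Cc_compact_supp[OF \<theta>] UC(2))
  have z: "\<theta> (t - u) = 0" if "t \<notin> K" "u \<in> U" for t u
  proof (rule notin_supp[of "t - u"], rule notI)
    assume "t - u \<in> supp \<theta>"
    then have "t \<in> K" unfolding K_def using UC(4) that(2)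
      by (intro image_eqI[of _ _ "(t - u, u)"]) auto
    with that show False by simp
  qed
  have "\<exists>\<psi>\<in>Cc. (\<forall>t. norm (conv mG \<theta> (tilde \<psi>) t - \<theta> t) \<le> e) \<and>
       (\<forall>t. t \<notin> K \<longrightarrow> conv mG \<theta> (tilde \<psi>) t = 0 \<and> \<theta> t = 0)" if e: "e > 0" for e
  proof -
    have "continuous_on UNIV (\<lambda>(t, u). \<theta> (t - u))"
      unfolding split_def by (intro c\<theta> continuous_intros)
    then have cont: "continuous_map (prod_topology euclidean euclidean) euclidean (\<lambda>(t, u). \<theta> (t - u))"
      by simp
    have "compactin euclidean K" "(0::'g) \<in> topspace euclidean" using K by auto
    from compactin_uniformly_close[OF cont this e]
    obtain W where W: "openin euclidean W" "0 \<in> W"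
      "\<And>t u. t \<in> K \<Longrightarrow> u \<in> W \<Longrightarrow> dist (\<theta> (t - u)) (\<theta> (t - 0)) < e" by blast
    have "open (W \<inter> U)" "0 \<in> W \<inter> U" using W UC by auto
    then obtain p where p: "bump (W \<inter> U) p" by (rule bump_exists)
    \<comment> \<open>The reflection cancels the one inside \<open>tilde\<close>, and
      \<open>p\<close> is real, so \<open>tilde \<psi>\<close> is just \<open>p\<close>.\<close>
    define \<psi> where "\<psi> t = complex_of_real (p (- t))" for t
    have \<psi>: "\<psi> \<in> Cc" unfolding \<psi>_def[abs_def] using Cc_uminus[OF bump_Cc[OF p]] by simp
    have conv: "conv mG \<theta> (tilde \<psi>) t = (\<integral>u. complex_of_real (p u) * \<theta> (t - u) \<partial>mG)" for t
      by (simp add: conv_def tilde_def \<psi>_def mult.commute)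
    have "norm (conv mG \<theta> (tilde \<psi>) t - \<theta> t) \<le> e" for t
      unfolding conv
    proof (rule bump_average[OF p])
      show "continuous_on UNIV (\<lambda>u. \<theta> (t - u))" by (intro c\<theta> continuous_intros)
      fix u assume u: "u \<in> W \<inter> U"
      show "norm (\<theta> (t - u) - \<theta> t) \<le> e"
        using W(3)[of t u] u e z[of t u] z[of t 0] UC(3)
        by (cases "t \<in> K") (auto simp: dist_norm)
    qed
    moreover have "conv mG \<theta> (tilde \<psi>) t = 0 \<and> \<theta> t = 0" if "t \<notin> K" for t
    proof
      have "complex_of_real (p u) * \<theta> (t - u) = 0" for u
        using z[OF that, of u] p by (cases "u \<in> U") (auto simp: bump_def)
      then show "conv mG \<theta> (tilde \<psi>) t = 0"
        by (simp only: conv Bochner_Integration.integral_zero)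
      show "\<theta> t = 0" using z[OF that UC(3)] by simp
    qed
    ultimately show ?thesis using \<psi> by (intro bexI[of _ \<psi>]) simp_all
  qed
  with K show ?thesis by (intro that allI impI)
qed

end


section \<open>The dual group\<close>

text \<open>The distance from a member \<open>h\<close> to \<open>h0\<close> attains its maximum on
  the compact set \<open>K\<close>, so it stays below \<open>e\<close> by a uniform gap
  \<open>d\<close>, and \<open>d\<close> serves as the radius around \<open>h\<close>.\<close>

lemma openin_CG_compact_nbhd:
  fixes h0 :: "'g::topological_space \<Rightarrow> complex"
  assumes K: "compact K" and h0: "h0 \<in> CG"
  shows "openin CG_topology {h \<in> CG. \<forall>t\<in>K. dist (h t) (h0 t) < e}"
  unfolding openin_CG_topology
proof (intro conjI ballI)
  fix h assume h: "h \<in> {h \<in> CG. \<forall>t\<in>K. dist (h t) (h0 t) < e}"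
  have "\<exists>d>0. \<forall>t\<in>K. dist (h t) (h0 t) + d \<le> e"
  proof (cases "K = {}")
    case True
    then show ?thesis by (intro exI[of _ 1]) simp
  next
    case False
    have "continuous_on K (\<lambda>t. dist (h t) (h0 t))"
      using h h0 by (intro continuous_on_dist) (auto simp: CG_def intro: continuous_on_subset)
    then obtain t0 where "t0 \<in> K" "\<forall>t\<in>K. dist (h t) (h0 t) \<le> dist (h t0) (h0 t0)"
      using continuous_attains_sup[OF K False] by blast
    then show ?thesis
      using h by (intro exI[of _ "e - dist (h t0) (h0 t0)"]) auto
  qed
  then obtain d where d: "d > 0" "\<And>t. t \<in> K \<Longrightarrow> dist (h t) (h0 t) + d \<le> e" by blast
  have "dist (k t) (h0 t) < e" if "t \<in> K" "dist (k t) (h t) < d" for k t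
    using dist_triangle[of "k t" "h0 t" "h t"] d(2)[OF that(1)] that(2) by linarith
  with d(1) K show "\<exists>K' d. compact K' \<and> d > 0 \<and> (\<forall>k\<in>CG. (\<forall>t\<in>K'. dist (k t) (h t) < d) \<longrightarrow>
      k \<in> {h \<in> CG. \<forall>t\<in>K. dist (h t) (h0 t) < e})"
    by (intro exI[of _ K] exI[of _ d]) simp
qed simp

lemma dual_group_subset_CG: "dual_group \<subseteq> CG"
  by (auto simp: dual_group_def CG_def)

lemma topspace_dual: "topspace dual_topology = dual_group"
  unfolding dual_topology_def topspace_subtopology topspace_CG_topology
  by (rule Int_absorb1[OF dual_group_subset_CG])

lemma dual_groupD:
  assumes "\<eta> \<in> dual_group"
  shows "norm (\<eta> t) = 1" "\<eta> (s + t) = \<eta> s * \<eta> t" "\<eta> 0 = 1" "\<eta> (t - s) = \<eta> t * cnj (\<eta> s)"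
    "continuous_on UNIV \<eta>"
proof -
  show n: "norm (\<eta> t) = 1" for t using assms by (simp add: dual_group_def)
  show a: "\<eta> (s + t) = \<eta> s * \<eta> t" for s t using assms by (simp add: dual_group_def)
  show "continuous_on UNIV \<eta>" using assms by (simp add: dual_group_def)
  have "\<eta> t * cnj (\<eta> s) = \<eta> (t - s) * (\<eta> s * cnj (\<eta> s))"
    using a[of "t - s" s] by (simp add: mult.assoc)
  also have "\<eta> s * cnj (\<eta> s) = 1"
    using n[of s] by (simp flip: complex_norm_square)
  finally show "\<eta> (t - s) = \<eta> t * cnj (\<eta> s)" by simp
  have "\<eta> 0 * \<eta> 0 = \<eta> 0" using a[of 0 0] by simp
  moreover have "\<eta> 0 \<noteq> 0" using n[of 0] by auto
  ultimately show "\<eta> 0 = 1" by simp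
qed

lemma continuous_map_fst_arg:
  "continuous_map A C f \<Longrightarrow> continuous_map (prod_topology A B) C (\<lambda>(x, y). f x)"
  using continuous_map_compose[OF continuous_map_fst, of A C f B] by (simp add: o_def split_def)

lemma continuous_map_snd_arg:
  "continuous_map B C f \<Longrightarrow> continuous_map (prod_topology A B) C (\<lambda>(x, y). f y)"
  using continuous_map_compose[OF continuous_map_snd, of B C f A] by (simp add: o_def split_def)

lemma continuous_map_mult2:
  fixes f g :: "'a \<Rightarrow> 'b \<Rightarrow> complex"
  assumes "continuous_map (prod_topology A B) euclidean (\<lambda>(x, y). f x y)"
    and "continuous_map (prod_topology A B) euclidean (\<lambda>(x, y). g x y)"
  shows "continuous_map (prod_topology A B) euclidean (\<lambda>(x, y). f x y * g x y)"
  using continuous_map_complex_mult[OF assms] by (simp add: split_def)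

lemma continuous_map_cnj2:
  assumes "continuous_map (prod_topology A B) euclidean (\<lambda>(x, y). f x y)"
  shows "continuous_map (prod_topology A B) euclidean (\<lambda>(x, y). cnj (f x y))"
  using continuous_map_cnj[OF assms] by (simp add: split_def)

context haar_group
begin

text \<open>Local compactness enters through a compact neighbourhood \<open>C\<close> of
  \<open>t0\<close>: a function close to \<open>h0\<close> on all of \<open>C\<close> is close to it
  at every \<open>t\<close> near \<open>t0\<close>, and \<open>h0\<close> itself varies little
  there.\<close>

lemma continuous_map_eval_CG:
  "continuous_map (prod_topology euclidean CG_topology) euclidean (\<lambda>(t :: 'g, h). h t)"
  unfolding continuous_map_euclidean_iff
proof (intro ballI allI impI)
  fix z :: "'g \<times> ('g \<Rightarrow> complex)" and e :: real
  assume "z \<in> topspace (prod_topology euclidean CG_topology)" and "e > 0"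
  then obtain t0 h0 where z: "z = (t0, h0)" "h0 \<in> CG"
    by (auto simp: topspace_CG_topology)
  obtain U C :: "'g set" where UC: "open U" "compact C" "t0 \<in> U" "U \<subseteq> C"
    by (rule compact_nbhd)
  define W where "W = h0 -` ball (h0 t0) (e / 2) \<inter> U"
  have W: "open W" "t0 \<in> W"
    using z(2) UC \<open>e > 0\<close> unfolding W_def CG_def
    by (auto intro!: open_Int open_vimage)
  define H where "H = {h \<in> CG. \<forall>t\<in>C. dist (h t) (h0 t) < e / 2}"
  have H: "openin CG_topology H"
    unfolding H_def by (rule openin_CG_compact_nbhd[OF UC(2) z(2)])
  have "h0 \<in> H" unfolding H_def using z(2) \<open>e > 0\<close> by simp
  have "dist (h t) (h0 t0) < e" if "t \<in> W" "h \<in> H" for t h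
  proof -
    have "dist (h t) (h0 t) < e / 2" using that UC(4) by (auto simp: W_def H_def)
    moreover have "dist (h0 t) (h0 t0) < e / 2" using that by (auto simp: W_def dist_commute)
    ultimately show ?thesis using dist_triangle[of "h t" "h0 t0" "h0 t"] by linarith
  qed
  then have "\<forall>w\<in>W \<times> H. dist (case w of (t, h) \<Rightarrow> h t) (case z of (t, h) \<Rightarrow> h t) < e"
    using z(1) by auto
  moreover have "openin (prod_topology euclidean CG_topology) (W \<times> H)"
    using W H by (simp add: openin_prod_Times_iff)
  moreover have "z \<in> W \<times> H" using z W \<open>h0 \<in> H\<close> by simp
  ultimately show "\<exists>U. openin (prod_topology euclidean CG_topology) U \<and> z \<in> U \<and>
      (\<forall>w\<in>U. dist (case w of (t, h) \<Rightarrow> h t) (case z of (t, h) \<Rightarrow> h t) < e)"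
    by (intro exI[of _ "W \<times> H"] conjI)
qed

lemma continuous_map_eval_sub:
  "continuous_map (prod_topology euclidean (subtopology CG_topology Y)) euclidean (\<lambda>(t :: 'g, h). h t)"
  unfolding prod_topology_subtopology
  by (rule continuous_map_from_subtopology[OF continuous_map_eval_CG])

lemma Hausdorff_CG: "Hausdorff_space (CG_topology :: ('g \<Rightarrow> complex) topology)"
  unfolding Hausdorff_space_def
proof (intro allI impI)
  fix h k :: "'g \<Rightarrow> complex"
  assume *: "h \<in> topspace CG_topology \<and> k \<in> topspace CG_topology \<and> h \<noteq> k"
  then obtain t where "h t \<noteq> k t" by auto
  then obtain U V where UV: "open U" "open V" "h t \<in> U" "k t \<in> V" "U \<inter> V = {}"
    using hausdorff by metis
  have ev: "continuous_map CG_topology euclidean (\<lambda>h. h t)"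
    using continuous_map_curry2[OF continuous_map_eval_CG, of t] by simp
  let ?P = "\<lambda>U. {h \<in> topspace CG_topology. h t \<in> U}"
  have "openin CG_topology (?P U)" "openin CG_topology (?P V)"
    using UV by (auto intro!: openin_continuous_map_preimage[OF ev])
  moreover have "h \<in> ?P U" "k \<in> ?P V" "disjnt (?P U) (?P V)"
    using * UV by (auto simp: disjnt_def)
  ultimately show "\<exists>U V. openin CG_topology U \<and> openin CG_topology V \<and> h \<in> U \<and> k \<in> V \<and> disjnt U V"
    by (intro exI[of _ "?P U"] exI[of _ "?P V"] conjI)
qed

lemma Hausdorff_dual: "Hausdorff_space (dual_topology :: ('g \<Rightarrow> complex) topology)"
  unfolding dual_topology_def by (rule Hausdorff_space_subtopology[OF Hausdorff_CG])

lemma continuous_map_eval_dual: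
  "continuous_map (prod_topology euclidean dual_topology) euclidean (\<lambda>(t :: 'g, \<eta>). \<eta> t)"
  unfolding dual_topology_def by (rule continuous_map_eval_sub)

end

section \<open>Sesquilinear forms\<close>

lemma Cc_bounded:
  assumes "\<phi> \<in> Cc"
  obtains C where "C \<ge> 0" "\<And>t. norm (\<phi> t) \<le> C"
proof -
  have "continuous_map euclidean euclidean \<phi>" "compactin euclidean (supp \<phi>)"
    using Cc_continuous[OF assms] Cc_compact_supp[OF assms] by auto
  then obtain C where C: "C \<ge> 0" "\<And>t. t \<in> supp \<phi> \<Longrightarrow> norm (\<phi> t) \<le> C"
    by (rule continuous_map_compact_bounded) blast
  have "norm (\<phi> t) \<le> C" for t
    using C notin_supp[of t \<phi>] by (cases "t \<in> supp \<phi>") auto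
  with C(1) show ?thesis by (rule that)
qed

context haar_group
begin

text \<open>The form with kernel \<open>A (t - s)\<close>. As an iterated integral with
  \<open>\<phi> t\<close> outside, each layer integrates a \<open>Cc\<close> function times a
  continuous one when \<open>A\<close> is continuous, so integrability is always at hand.\<close>

definition sesq :: "('g \<Rightarrow> complex) \<Rightarrow> ('g \<Rightarrow> complex) \<Rightarrow> ('g \<Rightarrow> complex) \<Rightarrow> complex" where
  "sesq A \<phi> \<psi> = (\<integral>t. \<phi> t * (\<integral>s. cnj (\<psi> s) * A (t - s) \<partial>mG) \<partial>mG)"

lemma continuous_map_Cc_integral:
  fixes k :: "'g \<Rightarrow> 'b \<Rightarrow> complex"
  assumes k: "continuous_map (prod_topology euclidean B) euclidean (\<lambda>(t, y). k t y)" and \<phi>: "\<phi> \<in> Cc"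
  shows "continuous_map B euclidean (\<lambda>y. \<integral>t. \<phi> t * k t y \<partial>mG)"
proof (rule continuous_map_parametric_integral[OF Hausdorff_group sets_mG'])
  have "continuous_map euclidean euclidean \<phi>" using Cc_continuous[OF \<phi>] by simp
  from continuous_map_mult2[OF continuous_map_fst_arg[OF this] k]
  show "continuous_map (prod_topology euclidean B) euclidean (\<lambda>(t, y). \<phi> t * k t y)" .
  show "compactin euclidean (supp \<phi>)" using Cc_compact_supp[OF \<phi>] by simp
  show "emeasure mG (supp \<phi>) < \<infinity>" using emeasure_compact[OF Cc_compact_supp[OF \<phi>]] by simp
  show "\<phi> x * k x y = 0" if "x \<notin> supp \<phi>" for x y using notin_supp[OF that] by simp
qed

lemma norm_Cc_integral_le:
  fixes g :: "'g \<Rightarrow> complex"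
  assumes \<phi>: "\<phi> \<in> Cc" and g: "\<And>t. norm (g t) \<le> C"
  shows "norm (\<integral>t. \<phi> t * g t \<partial>mG) \<le> (\<integral>t. norm (\<phi> t) \<partial>mG) * C"
proof -
  have "norm (\<integral>t. \<phi> t * g t \<partial>mG) \<le> (\<integral>t. norm (\<phi> t) * C \<partial>mG)"
    using Cc_integrable[OF \<phi>] g by (intro norm_integral_le) (auto simp: norm_mult mult_left_mono)
  then show ?thesis by simp
qed

text \<open>Finiteness of \<open>N\<close> allows the whole space as the set \<open>T\<close> of
  \<open>Fubini_continuous\<close>; compactness in the group variable is that of
  \<open>supp \<phi>\<close>.\<close>

lemma Fubini_Cc_finite:
  fixes k :: "'g \<Rightarrow> 'b \<Rightarrow> complex"
  assumes B: "Hausdorff_space B" "sets N = sets (borel_of B)" "finite_measure N"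
    and k: "continuous_map (prod_topology euclidean B) euclidean (\<lambda>(t, y). k t y)"
    and L: "\<And>n :: nat. compactin B (L n)" "AE y in N. y \<in> (\<Union>n. L n)"
    and bound: "\<And>t y. y \<in> topspace B \<Longrightarrow> norm (k t y) \<le> C" and \<phi>: "\<phi> \<in> Cc"
  shows "(\<integral>t. \<phi> t * (\<integral>y. k t y \<partial>N) \<partial>mG) = (\<integral>y. \<integral>t. \<phi> t * k t y \<partial>mG \<partial>N)"
proof -
  interpret N: finite_measure N by fact
  obtain C' where C': "C' \<ge> 0" "\<And>t. norm (\<phi> t) \<le> C'" using Cc_bounded[OF \<phi>] by blast
  have \<phi>c: "continuous_map euclidean euclidean \<phi>" using Cc_continuous[OF \<phi>] by simp
  have "(\<integral>t. \<integral>y. \<phi> t * k t y \<partial>N \<partial>mG) = (\<integral>y. \<integral>t. \<phi> t * k t y \<partial>mG \<partial>N)"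
  proof (rule Fubini_continuous[OF Hausdorff_group sets_mG' sigma_finite B(1,2) N.sigma_finite_measure_axioms,
        where K = "supp \<phi>" and T = "topspace B" and C = "C' * C" and L = L])
    show "continuous_map (prod_topology euclidean B) euclidean (\<lambda>(t, y). \<phi> t * k t y)"
      by (rule continuous_map_mult2[OF continuous_map_fst_arg[OF \<phi>c] k])
    show "compactin euclidean (supp \<phi>)" using Cc_compact_supp[OF \<phi>] by simp
    show "emeasure mG (supp \<phi>) < \<infinity>" using emeasure_compact[OF Cc_compact_supp[OF \<phi>]] by simp
    show "topspace B \<in> sets N" using sets.top[of N] space_eq_topspace[OF B(2)] by simp
    show "emeasure N (topspace B) < \<infinity>" by (simp add: N.emeasure_finite less_top[symmetric])
    show "compactin B (L n)" for n by (rule L(1))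
    show "AE y in N. y \<in> topspace B \<longrightarrow> y \<in> (\<Union>n. L n)" using L(2) by eventually_elim simp
    show "\<phi> t * k t y = 0" if "y \<in> topspace B" "\<not> (t \<in> supp \<phi> \<and> y \<in> topspace B)" for t y
      using that notin_supp[of t \<phi>] by auto
    show "norm (\<phi> t * k t y) \<le> C' * C" if "y \<in> topspace B" for t y
      unfolding norm_mult using C' bound[OF that] by (intro mult_mono) auto
  qed
  then show ?thesis by simp
qed

text \<open>The common source of both sides of the theorem. With
  \<open>k t x = f (\<alpha> (- t) x)\<close> and \<open>N = m\<close> it evaluates the inner
  product of two pairings; with \<open>k t \<eta> = \<eta> t\<close> and a measure on the dual group
  it evaluates the integral of the squared modulus of \<open>check_transform\<close>.\<close>

lemma sesq_kernel:
  fixes k :: "'g \<Rightarrow> 'b \<Rightarrow> complex"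
  assumes B: "Hausdorff_space B" "sets N = sets (borel_of B)" "finite_measure N"
    and k: "continuous_map (prod_topology euclidean B) euclidean (\<lambda>(t, y). k t y)"
    and L: "\<And>n :: nat. compactin B (L n)" "AE y in N. y \<in> (\<Union>n. L n)"
    and bound: "\<And>t y. y \<in> topspace B \<Longrightarrow> norm (k t y) \<le> C"
    and A: "\<And>t s. (\<integral>y. k t y * cnj (k s y) \<partial>N) = A (t - s)"
    and \<phi>: "\<phi> \<in> Cc" and \<psi>: "\<psi> \<in> Cc"
  shows "(\<integral>y. (\<integral>t. \<phi> t * k t y \<partial>mG) * cnj (\<integral>s. \<psi> s * k s y \<partial>mG) \<partial>N) = sesq A \<phi> \<psi>"
proof -
  \<comment> \<open>The second factor is kept as one bounded continuous function of \<open>y\<close>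
    while the \<open>t\<close>-integral moves outside, and is unfolded only afterwards. So each
    exchange involves a single group variable.\<close>
  define m where "m y = cnj (\<integral>s. \<psi> s * k s y \<partial>mG)" for y
  have mc: "continuous_map B euclidean m"
    unfolding m_def by (intro continuous_map_cnj continuous_map_Cc_integral k \<psi>)
  have mb: "norm (m y) \<le> (\<integral>t. norm (\<psi> t) \<partial>mG) * C" if "y \<in> topspace B" for y
    unfolding m_def complex_mod_cnj using bound[OF that] by (intro norm_Cc_integral_le \<psi>)
  have m': "m y = (\<integral>s. cnj (\<psi> s) * cnj (k s y) \<partial>mG)" for y
    unfolding m_def complex_cnj_mult[symmetric] by (rule Bochner_Integration.integral_cnj[symmetric])
  have "(\<integral>y. (\<integral>t. \<phi> t * k t y \<partial>mG) * m y \<partial>N) = (\<integral>y. \<integral>t. \<phi> t * (k t y * m y) \<partial>mG \<partial>N)"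
    by (simp flip: mult.assoc)
  also have "\<dots> = (\<integral>t. \<phi> t * (\<integral>y. k t y * m y \<partial>N) \<partial>mG)"
  proof (rule Fubini_Cc_finite[symmetric, OF B _ L _ \<phi>])
    show "continuous_map (prod_topology euclidean B) euclidean (\<lambda>(t, y). k t y * m y)"
      by (rule continuous_map_mult2[OF k continuous_map_snd_arg[OF mc]])
    show "norm (k t y * m y) \<le> C * ((\<integral>t. norm (\<psi> t) \<partial>mG) * C)" if "y \<in> topspace B" for t y
      unfolding norm_mult using bound[OF that] mb[OF that]
      by (intro mult_mono order_trans[OF norm_ge_zero bound[OF that]]) auto
  qed
  also have "\<dots> = sesq A \<phi> \<psi>"
    unfolding sesq_def
  proof (intro Bochner_Integration.integral_cong[OF refl] arg_cong2[of _ _ _ _ times] refl)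
    fix t
    have "(\<integral>y. k t y * m y \<partial>N) = (\<integral>y. \<integral>s. cnj (\<psi> s) * (k t y * cnj (k s y)) \<partial>mG \<partial>N)"
      unfolding m' by (simp add: mult.left_commute flip: integral_mult_right_zero)
    also have "\<dots> = (\<integral>s. cnj (\<psi> s) * (\<integral>y. k t y * cnj (k s y) \<partial>N) \<partial>mG)"
    proof (rule Fubini_Cc_finite[symmetric, OF B _ L _ Cc_cnj[OF \<psi>]])
      show "continuous_map (prod_topology euclidean B) euclidean (\<lambda>(s, y). k t y * cnj (k s y))"
        using continuous_map_curry2[OF k, of t]
        by (intro continuous_map_mult2 continuous_map_cnj2 k continuous_map_snd_arg) simp
      show "norm (k t y * cnj (k s y)) \<le> C * C" if "y \<in> topspace B" for s y
        unfolding norm_mult complex_mod_cnj using bound[OF that]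
        by (intro mult_mono order_trans[OF norm_ge_zero bound[OF that]]) auto
    qed
    finally show "(\<integral>y. k t y * m y \<partial>N) = (\<integral>s. cnj (\<psi> s) * A (t - s) \<partial>mG)"
      by (simp add: A)
  qed
  finally show ?thesis by (simp add: m_def)
qed

lemma continuous_Cc_conv:
  fixes A :: "'g \<Rightarrow> complex"
  assumes A: "continuous_on UNIV A" and \<psi>: "\<psi> \<in> Cc" and "continuous_on UNIV (\<lambda>(s, t). f s t)"
  shows "continuous_on UNIV (\<lambda>t. \<integral>s. \<psi> s * A (f s t) \<partial>mG)"
proof -
  have "continuous_on UNIV (\<lambda>(s, t). A (f s t))"
    using continuous_on_compose_UNIV[OF A assms(3)] by (simp add: split_def)
  then show ?thesis
    using continuous_map_Cc_integral[of euclidean "\<lambda>s t. A (f s t)", OF _ \<psi>] by simp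
qed

lemma continuous_Cc_conv_diff:
  fixes A :: "'g \<Rightarrow> complex"
  assumes A: "continuous_on UNIV A" and \<psi>: "\<psi> \<in> Cc"
  shows "continuous_on UNIV (\<lambda>t. \<integral>s. \<psi> s * A (t - s) \<partial>mG)"
  by (rule continuous_Cc_conv[OF A \<psi>]) (auto simp: split_def intro!: continuous_intros)

lemma continuous_diff_left: "continuous_on UNIV (A :: 'g \<Rightarrow> complex) \<Longrightarrow> continuous_on UNIV (\<lambda>s. A (t - s))"
  by (erule continuous_on_compose_UNIV) (intro continuous_intros)

lemma sesq_add_left:
  assumes A: "continuous_on UNIV A" and \<phi>: "\<phi> \<in> Cc" and \<phi>': "\<phi>' \<in> Cc" and \<psi>: "\<psi> \<in> Cc"
  shows "sesq A (\<lambda>t. \<phi> t + \<phi>' t) \<psi> = sesq A \<phi> \<psi> + sesq A \<phi>' \<psi>"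
  unfolding sesq_def distrib_right
  by (intro Bochner_Integration.integral_add Cc_integrable Cc_mult[OF \<phi>] Cc_mult[OF \<phi>']
      continuous_Cc_conv_diff A Cc_cnj \<psi>)

lemma sesq_add_right:
  assumes A: "continuous_on UNIV A" and \<phi>: "\<phi> \<in> Cc" and \<psi>: "\<psi> \<in> Cc" and \<psi>': "\<psi>' \<in> Cc"
  shows "sesq A \<phi> (\<lambda>t. \<psi> t + \<psi>' t) = sesq A \<phi> \<psi> + sesq A \<phi> \<psi>'"
proof -
  have "(\<integral>s. cnj (\<psi> s + \<psi>' s) * A (t - s) \<partial>mG)
      = (\<integral>s. cnj (\<psi> s) * A (t - s) \<partial>mG) + (\<integral>s. cnj (\<psi>' s) * A (t - s) \<partial>mG)" for t
    unfolding complex_cnj_add distrib_right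
    by (intro Bochner_Integration.integral_add Cc_integrable Cc_mult[OF Cc_cnj[OF \<psi>]]
        Cc_mult[OF Cc_cnj[OF \<psi>']] continuous_diff_left A)
  then show ?thesis
    unfolding sesq_def
    by (simp only: distrib_left)
      (intro Bochner_Integration.integral_add Cc_integrable Cc_mult[OF \<phi>]
        continuous_Cc_conv_diff A Cc_cnj[OF \<psi>] Cc_cnj[OF \<psi>'])
qed

lemma sesq_scale_left: "sesq A (\<lambda>t. c * \<phi> t) \<psi> = c * sesq A \<phi> \<psi>"
  by (simp add: sesq_def mult.assoc)

lemma sesq_scale_right: "sesq A \<phi> (\<lambda>t. c * \<psi> t) = cnj c * sesq A \<phi> \<psi>"
  by (simp add: sesq_def mult.assoc mult.left_commute)

lemma sesq_quadratic:
  assumes A: "continuous_on UNIV A" and \<phi>: "\<phi> \<in> Cc" and \<psi>: "\<psi> \<in> Cc"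
  shows "sesq A (\<lambda>t. \<phi> t + c * \<psi> t) (\<lambda>t. \<phi> t + c * \<psi> t)
    = sesq A \<phi> \<phi> + cnj c * sesq A \<phi> \<psi> + c * sesq A \<psi> \<phi> + c * cnj c * sesq A \<psi> \<psi>"
proof -
  note c = Cc_cmult[OF \<psi>, of c]
  show ?thesis
    by (simp only: sesq_add_left[OF A \<phi> c Cc_add[OF \<phi> c]] sesq_add_right[OF A \<phi> \<phi> c]
        sesq_add_right[OF A \<psi> \<phi> c] sesq_scale_left sesq_scale_right) (simp add: algebra_simps)
qed

text \<open>Two nested averages: for each \<open>t\<close> in \<open>V\<close> the inner one stays
  within \<open>e\<close> of \<open>c\<close>, hence so does the average of these values over
  \<open>t\<close>.\<close>

lemma sesq_bump:
  assumes A: "continuous_on UNIV A" and p: "bump V p" and q: "bump W q"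
    and e: "\<And>t s. t \<in> V \<Longrightarrow> s \<in> W \<Longrightarrow> norm (A (t - s) - c) \<le> e"
  shows "norm (sesq A (\<lambda>t. complex_of_real (p t)) (\<lambda>t. complex_of_real (q t)) - c) \<le> e"
  unfolding sesq_def
proof (rule bump_average[OF p])
  show "continuous_on UNIV (\<lambda>t. \<integral>s. cnj (complex_of_real (q s)) * A (t - s) \<partial>mG)"
    by (intro continuous_Cc_conv_diff A Cc_cnj bump_Cc[OF q])
  show "norm ((\<integral>s. cnj (complex_of_real (q s)) * A (t - s) \<partial>mG) - c) \<le> e" if "t \<in> V" for t
    unfolding complex_cnj_complex_of_real
    using e[OF that] by (intro bump_average[OF q] continuous_diff_left A)
qed

end


section \<open>Autocorrelation\<close>

context haar_group
begin

text \<open>Linearity turns the sup-norm bound into a Lipschitz estimate, in a form that speaks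
  neither of \<open>supp\<close> nor of suprema. The given constant may be negative; its absolute
  value is used so that the bound is monotone in \<open>e\<close>.\<close>

lemma complex_radon_functionalD:
  fixes \<gamma> :: "('g \<Rightarrow> complex) \<Rightarrow> complex"
  assumes \<gamma>: "complex_radon_functional \<gamma>" and K: "compact K"
  shows "\<exists>C\<ge>0. \<forall>\<phi>\<in>Cc. \<forall>\<psi>\<in>Cc. \<forall>e. (\<forall>t. t \<notin> K \<longrightarrow> \<phi> t = 0 \<and> \<psi> t = 0) \<longrightarrow>
    (\<forall>t. norm (\<phi> t - \<psi> t) \<le> e) \<longrightarrow> norm (\<gamma> \<phi> - \<gamma> \<psi>) \<le> C * e"
proof -
  from conjunct2[OF conjunct2[OF \<gamma>[unfolded complex_radon_functional_def]], rule_format, OF K]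
  obtain C where "\<forall>\<phi>\<in>Cc. supp \<phi> \<subseteq> K \<longrightarrow> norm (\<gamma> \<phi>) \<le> C * (SUP t. norm (\<phi> t))"
    by (rule exE)
  note C = this[rule_format]
  have "norm (\<gamma> \<phi> - \<gamma> \<psi>) \<le> \<bar>C\<bar> * e"
    if \<phi>: "\<phi> \<in> Cc" and \<psi>: "\<psi> \<in> Cc" and z: "\<forall>t. t \<notin> K \<longrightarrow> \<phi> t = 0 \<and> \<psi> t = 0"
      and e: "\<forall>t. norm (\<phi> t - \<psi> t) \<le> e" for \<phi> \<psi> e
  proof -
    define \<theta> where "\<theta> = (\<lambda>t. \<phi> t + (-1) * \<psi> t)"
    have \<theta>: "\<theta> \<in> Cc" unfolding \<theta>_def by (intro Cc_add Cc_cmult \<phi> \<psi>)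
    have "\<gamma> \<theta> = \<gamma> \<phi> + \<gamma> (\<lambda>t. (-1) * \<psi> t)"
      unfolding \<theta>_def
      by (rule conjunct1[OF \<gamma>[unfolded complex_radon_functional_def], rule_format, OF \<phi> Cc_cmult[OF \<psi>]])
    also have "\<gamma> (\<lambda>t. (-1) * \<psi> t) = (-1) * \<gamma> \<psi>"
      using conjunct1[OF conjunct2[OF \<gamma>[unfolded complex_radon_functional_def]]] \<psi> by blast
    finally have eq: "\<gamma> \<theta> = \<gamma> \<phi> - \<gamma> \<psi>" by simp
    have "supp \<theta> \<subseteq> K"
      unfolding supp_def using z K by (intro closure_minimal compact_imp_closed) (auto simp: \<theta>_def)
    then have "norm (\<gamma> \<theta>) \<le> C * (SUP t. norm (\<theta> t))" by (rule C[OF \<theta>])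
    also have "\<dots> \<le> \<bar>C\<bar> * (SUP t. norm (\<theta> t))"
    proof (rule mult_right_mono)
      have "bdd_above (range (\<lambda>t. norm (\<theta> t)))"
        using e by (intro bdd_aboveI[of _ e]) (auto simp: \<theta>_def)
      then have "norm (\<theta> 0) \<le> (SUP t. norm (\<theta> t))" by (rule cSUP_upper[OF UNIV_I])
      then show "0 \<le> (SUP t. norm (\<theta> t))" by (rule order_trans[OF norm_ge_zero])
    qed simp
    also have "\<dots> \<le> \<bar>C\<bar> * e"
      using e by (intro mult_left_mono cSUP_least) (auto simp: \<theta>_def)
    finally show ?thesis by (simp add: eq)
  qed
  then show ?thesis by (intro exI[of _ "\<bar>C\<bar>"] conjI ballI allI impI abs_ge_zero)
qed

lemma autocorrelation_unique:
  assumes "is_autocorrelation mG n \<gamma>" "is_autocorrelation mG n \<gamma>'"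
  shows "\<gamma> = \<gamma>'"
proof (rule extensionalityI)
  show "\<gamma> \<in> extensional Cc" "\<gamma>' \<in> extensional Cc"
    using assms by (auto simp: is_autocorrelation_def)
  fix \<theta> :: "'g \<Rightarrow> complex" assume \<theta>: "\<theta> \<in> Cc"
  obtain K where K: "compact K"
    and appr: "\<forall>e>0. \<exists>\<psi>\<in>Cc. (\<forall>t. norm (conv mG \<theta> (tilde \<psi>) t - \<theta> t) \<le> e) \<and>
       (\<forall>t. t \<notin> K \<longrightarrow> conv mG \<theta> (tilde \<psi>) t = 0 \<and> \<theta> t = 0)"
    by (rule approximate_identity[OF \<theta>])
  have "complex_radon_functional \<gamma>" "complex_radon_functional \<gamma>'"
    using assms by (auto simp: is_autocorrelation_def)
  from complex_radon_functionalD[OF this(1) K] complex_radon_functionalD[OF this(2) K]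
  obtain C C' where C: "C \<ge> 0" "\<forall>\<phi>\<in>Cc. \<forall>\<psi>\<in>Cc. \<forall>e. (\<forall>t. t \<notin> K \<longrightarrow> \<phi> t = 0 \<and> \<psi> t = 0) \<longrightarrow>
      (\<forall>t. norm (\<phi> t - \<psi> t) \<le> e) \<longrightarrow> norm (\<gamma> \<phi> - \<gamma> \<psi>) \<le> C * e"
    and C': "C' \<ge> 0" "\<forall>\<phi>\<in>Cc. \<forall>\<psi>\<in>Cc. \<forall>e. (\<forall>t. t \<notin> K \<longrightarrow> \<phi> t = 0 \<and> \<psi> t = 0) \<longrightarrow>
      (\<forall>t. norm (\<phi> t - \<psi> t) \<le> e) \<longrightarrow> norm (\<gamma>' \<phi> - \<gamma>' \<psi>) \<le> C' * e"
    by (elim exE conjE)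
  have "norm (\<gamma> \<theta> - \<gamma>' \<theta>) \<le> (C + C') * e" if e: "e > 0" for e
  proof -
    obtain \<psi> where \<psi>: "\<psi> \<in> Cc" "\<And>t. norm (conv mG \<theta> (tilde \<psi>) t - \<theta> t) \<le> e"
      "\<And>t. t \<notin> K \<Longrightarrow> conv mG \<theta> (tilde \<psi>) t = 0 \<and> \<theta> t = 0"
      using appr[rule_format, OF e] by blast
    have cv: "conv mG \<theta> (tilde \<psi>) \<in> Cc" by (intro conv_Cc Cc_tilde \<theta> \<psi>(1))
    have "\<gamma> (conv mG \<theta> (tilde \<psi>)) = \<gamma>' (conv mG \<theta> (tilde \<psi>))"
      using assms \<theta> \<psi>(1) by (simp add: is_autocorrelation_def)
    moreover have "norm (\<gamma> (conv mG \<theta> (tilde \<psi>)) - \<gamma> \<theta>) \<le> C * e"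
      using \<psi>(2,3) by (intro C(2)[rule_format] cv \<theta>)
    moreover have "norm (\<gamma>' (conv mG \<theta> (tilde \<psi>)) - \<gamma>' \<theta>) \<le> C' * e"
      using \<psi>(2,3) by (intro C'(2)[rule_format] cv \<theta>)
    ultimately have "norm (\<gamma> \<theta> - \<gamma>' \<theta>) \<le> C' * e + C * e"
      using norm_triangle_ineq4[of "\<gamma>' (conv mG \<theta> (tilde \<psi>)) - \<gamma>' \<theta>" "\<gamma> (conv mG \<theta> (tilde \<psi>)) - \<gamma> \<theta>"]
      by simp
    then show ?thesis by (simp add: algebra_simps)
  qed
  note * = this
  have "norm (\<gamma> \<theta> - \<gamma>' \<theta>) \<le> 0 + d" if "d > 0" for d
  proof -
    \<comment> \<open>The summand 1 covers the case that both constants are 0.\<close>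
    define e where "e = d / (C + C' + 1)"
    have "e > 0" using C(1) C'(1) that by (simp add: e_def)
    have "(C + C' + 1) * e = d" using C(1) C'(1) by (simp add: e_def)
    then have "(C + C') * e \<le> d" using \<open>e > 0\<close> by (simp add: distrib_right)
    then show ?thesis using *[OF \<open>e > 0\<close>] by simp
  qed
  then have "norm (\<gamma> \<theta> - \<gamma>' \<theta>) \<le> 0" by (rule field_le_epsilon)
  then show "\<gamma> \<theta> = \<gamma>' \<theta>" by simp
qed

text \<open>\<open>total_variation\<close> is an infimum over open neighbourhoods, so one choice
  bounds it: a fixed relatively compact open \<open>U\<close> around \<open>K\<close>, translated
  along with \<open>K\<close>. Invariance makes its Haar measure, and with it the bound, independent
  of the translate.\<close>

lemma translation_bounded_density:
  fixes A :: "'g \<Rightarrow> complex"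
  assumes A: "\<And>t. norm (A t) \<le> C" and \<gamma>: "\<And>\<phi>. \<phi> \<in> Cc \<Longrightarrow> \<gamma> \<phi> = (\<integral>t. \<phi> t * A t \<partial>mG)"
  shows "translation_bounded \<gamma>"
  unfolding translation_bounded_def
proof (intro allI impI)
  fix K :: "'g set" assume K: "compact K"
  obtain U L :: "'g set" where U: "open U" "compact L" "K \<subseteq> U" "U \<subseteq> L"
    using lc K Hausdorff_group locally_compact_space_compact_closed_compact[of "euclidean :: 'g topology"]
    by (metis compactin_euclidean_iff open_openin)
  have Ufin: "emeasure mG U < top"
    using emeasure_mono[OF U(4) sets_compact[OF U(2)]] emeasure_compact[OF U(2)] by simp
  have "total_variation \<gamma> ((\<lambda>s. t + s) ` K) \<le> ennreal (C * measure mG U)" for t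
  proof -
    let ?W = "(\<lambda>s. t + s) ` U"
    have W: "open ?W" "(\<lambda>s. t + s) ` K \<subseteq> ?W" using open_translation[OF U(1)] U(3) by auto
    have em: "emeasure mG ?W = emeasure mG U" by (rule emeasure_translation[OF U(1)])
    then have mW: "measure mG ?W = measure mG U" by (simp add: measure_def)
    have [measurable]: "?W \<in> sets mG" using W(1) by (simp add: sets_mG)
    have "ennreal (norm (\<gamma> \<phi>)) \<le> ennreal (C * measure mG U)"
      if \<phi>: "\<phi> \<in> Cc" "supp \<phi> \<subseteq> ?W" "\<And>t. norm (\<phi> t) \<le> 1" for \<phi>
    proof (rule ennreal_leI)
      have "norm (\<gamma> \<phi>) \<le> (\<integral>s. C * indicator ?W s \<partial>mG)"
        unfolding \<gamma>[OF \<phi>(1)]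
      proof (rule norm_integral_le)
        show "integrable mG (\<lambda>s. C * indicator ?W s)"
          using Ufin em by (intro integrable_mult_right integrable_real_indicator) auto
        fix s
        show "norm (\<phi> s * A s) \<le> C * indicator ?W s"
        proof (cases "s \<in> ?W")
          case True
          have "norm (\<phi> s * A s) \<le> 1 * C"
            unfolding norm_mult by (intro mult_mono \<phi>(3) A) auto
          with True show ?thesis by simp
        next
          case False
          then have "\<phi> s = 0" using \<phi>(2) notin_supp[of s \<phi>] by blast
          with False show ?thesis by simp
        qed
      qed
      then show "norm (\<gamma> \<phi>) \<le> C * measure mG U" using mW by simp
    qed
    then have "(SUP \<phi>\<in>{\<phi>\<in>Cc. supp \<phi> \<subseteq> ?W \<and> (\<forall>t. norm (\<phi> t) \<le> 1)}. ennreal (norm (\<gamma> \<phi>)))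
        \<le> ennreal (C * measure mG U)"
      by (intro SUP_least) blast
    moreover have "?W \<in> {U. open U \<and> (\<lambda>s. t + s) ` K \<subseteq> U}" using W by simp
    ultimately show ?thesis
      unfolding total_variation_def by (rule INF_lower2[rotated])
  qed
  then have "(SUP t. total_variation \<gamma> ((\<lambda>s. t + s) ` K)) \<le> ennreal (C * measure mG U)"
    by (rule SUP_least)
  also have "\<dots> < \<infinity>" by simp
  finally show "(SUP t. total_variation \<gamma> ((\<lambda>s. t + s) ` K)) < \<infinity>" .
qed

lemma complex_radon_functional_density:
  assumes A: "continuous_on UNIV A" and bd: "\<And>t. norm (A t) \<le> C"
    and \<gamma>: "\<And>\<phi>. \<phi> \<in> Cc \<Longrightarrow> \<gamma> \<phi> = (\<integral>t. \<phi> t * A t \<partial>mG)"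
  shows "complex_radon_functional \<gamma>"
  unfolding complex_radon_functional_def
proof (intro conjI ballI allI impI)
  fix \<phi> \<psi> :: "'g \<Rightarrow> complex" assume *: "\<phi> \<in> Cc" "\<psi> \<in> Cc"
  show "\<gamma> (\<lambda>t. \<phi> t + \<psi> t) = \<gamma> \<phi> + \<gamma> \<psi>"
    unfolding \<gamma>[OF *(1)] \<gamma>[OF *(2)] \<gamma>[OF Cc_add[OF *]] distrib_right
    by (intro Bochner_Integration.integral_add Cc_integrable Cc_mult * A)
next
  fix c and \<phi> :: "'g \<Rightarrow> complex" assume \<phi>: "\<phi> \<in> Cc"
  show "\<gamma> (\<lambda>t. c * \<phi> t) = c * \<gamma> \<phi>"
    unfolding \<gamma>[OF \<phi>] \<gamma>[OF Cc_cmult[OF \<phi>]] by (simp add: mult.assoc)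
next
  fix K :: "'g set" assume K: "compact K"
  have [measurable]: "K \<in> sets mG" by (rule sets_compact[OF K])
  have C0: "C \<ge> 0" using bd[of 0] norm_ge_zero order_trans by blast
  have "norm (\<gamma> \<phi>) \<le> (C * measure mG K) * (SUP t. norm (\<phi> t))" if \<phi>: "\<phi> \<in> Cc" "supp \<phi> \<subseteq> K" for \<phi>
  proof -
    obtain B where "\<And>t. norm (\<phi> t) \<le> B" using Cc_bounded[OF \<phi>(1)] by blast
    then have bdd: "bdd_above (range (\<lambda>t. norm (\<phi> t)))" by (intro bdd_aboveI[of _ B]) auto
    have up: "norm (\<phi> t) \<le> (SUP t. norm (\<phi> t))" for t by (rule cSUP_upper[OF UNIV_I bdd])
    have "norm (\<gamma> \<phi>) \<le> (\<integral>t. (SUP t. norm (\<phi> t)) * C * indicator K t \<partial>mG)"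
      unfolding \<gamma>[OF \<phi>(1)]
    proof (rule norm_integral_le)
      show "integrable mG (\<lambda>t. (SUP t. norm (\<phi> t)) * C * indicator K t)"
        using emeasure_compact[OF K] by (intro integrable_mult_right integrable_real_indicator) auto
      fix t
      have "norm (\<phi> t * A t) \<le> (SUP t. norm (\<phi> t)) * C"
        unfolding norm_mult using up bd C0 order_trans[OF norm_ge_zero up] by (intro mult_mono) auto
      moreover have "\<phi> t = 0" if "t \<notin> K" using that \<phi>(2) notin_supp[of t \<phi>] by blast
      ultimately show "norm (\<phi> t * A t) \<le> (SUP t. norm (\<phi> t)) * C * indicator K t"
        by (cases "t \<in> K") auto
    qed
    then show ?thesis by (simp add: mult_ac)
  qed
  then show "\<exists>C. \<forall>\<phi>\<in>Cc. supp \<phi> \<subseteq> K \<longrightarrow> norm (\<gamma> \<phi>) \<le> C * (SUP t. norm (\<phi> t))" by blast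
qed

text \<open>Fubini and the shift \<open>u = t + s\<close> leave \<open>A (t + s)\<close> weighted
  with \<open>tilde \<psi> s\<close>. The reflection hidden in \<open>tilde\<close> is then undone
  by the invariance of Haar measure under inversion, \<open>integral_uminus\<close>.\<close>

lemma integral_conv_tilde:
  assumes A: "continuous_on UNIV A" and \<phi>: "\<phi> \<in> Cc" and \<psi>: "\<psi> \<in> Cc"
  shows "(\<integral>u. conv mG \<phi> (tilde \<psi>) u * A u \<partial>mG) = sesq A \<phi> \<psi>"
proof -
  note c\<phi> = continuous_on_compose_UNIV[OF Cc_continuous[OF \<phi>]]
    and c\<psi> = continuous_on_compose_UNIV[OF Cc_continuous[OF \<psi>]]
    and cA = continuous_on_compose_UNIV[OF A]
    and ct = continuous_on_compose_UNIV[OF Cc_continuous[OF Cc_tilde[OF \<psi>]]]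
  let ?P = "supp (tilde \<psi>)"
  let ?L = "(\<lambda>(a, b). a + b) ` (supp \<phi> \<times> ?P)"
  have P: "compact ?P" by (rule Cc_compact_supp[OF Cc_tilde[OF \<psi>]])
  have L: "compact ?L" by (intro compact_sum_set Cc_compact_supp[OF \<phi>] P)
  have inL: "u \<in> ?L" if "u - s \<in> supp \<phi>" "s \<in> ?P" for u s
    using that by (intro image_eqI[of _ _ "(u - s, s)"]) auto
  have "(\<integral>u. conv mG \<phi> (tilde \<psi>) u * A u \<partial>mG) = (\<integral>u. \<integral>s. \<phi> (u - s) * tilde \<psi> s * A u \<partial>mG \<partial>mG)"
    by (simp add: conv_def)
  also have "\<dots> = (\<integral>s. \<integral>u. \<phi> (u - s) * tilde \<psi> s * A u \<partial>mG \<partial>mG)"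
  proof (rule Cc_Fubini[OF _ L P])
    show "continuous_on UNIV (\<lambda>(u, s). \<phi> (u - s) * tilde \<psi> s * A u)"
      unfolding split_def by (intro continuous_on_mult c\<phi> ct cA continuous_intros)
    show "\<phi> (u - s) * tilde \<psi> s * A u = 0" if "\<not> (u \<in> ?L \<and> s \<in> ?P)" for u s
      using that inL[of u s] notin_supp[of "u - s" \<phi>] notin_supp[of s "tilde \<psi>"] by auto
  qed
  \<comment> \<open>Writing \<open>t - (- s)\<close> exhibits the outer integrand as a function of
    \<open>- s\<close>, ready for the reflection.\<close>
  also have "\<dots> = (\<integral>s. tilde \<psi> s * (\<integral>t. \<phi> t * A (t - (- s)) \<partial>mG) \<partial>mG)"
  proof (rule Bochner_Integration.integral_cong[OF refl])
    fix s
    have "continuous_on UNIV (\<lambda>u. \<phi> (u - s) * A u)"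
      by (intro continuous_on_mult c\<phi> A continuous_intros)
    from integral_translation[OF this, of s]
    have "(\<integral>u. \<phi> (u - s) * A u \<partial>mG) = (\<integral>t. \<phi> t * A (t - (- s)) \<partial>mG)"
      by (simp add: add.commute)
    moreover have "(\<integral>u. \<phi> (u - s) * tilde \<psi> s * A u \<partial>mG) = (\<integral>u. tilde \<psi> s * (\<phi> (u - s) * A u) \<partial>mG)"
      by (simp add: mult_ac)
    ultimately show "(\<integral>u. \<phi> (u - s) * tilde \<psi> s * A u \<partial>mG) = tilde \<psi> s * (\<integral>t. \<phi> t * A (t - (- s)) \<partial>mG)"
      by simp
  qed
  also have "\<dots> = (\<integral>s. cnj (\<psi> s) * (\<integral>t. \<phi> t * A (t - s) \<partial>mG) \<partial>mG)"
  proof -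
    have c: "continuous_on UNIV (\<lambda>s. \<integral>t. \<phi> t * A (t - s) \<partial>mG)"
      by (rule continuous_Cc_conv[OF A \<phi>]) (auto simp: split_def intro!: continuous_intros)
    from integral_uminus[OF Cc_mult[OF Cc_cnj[OF \<psi>] c]] show ?thesis
      by (simp add: tilde_def)
  qed
  also have "\<dots> = (\<integral>s. \<integral>t. \<phi> t * (cnj (\<psi> s) * A (t - s)) \<partial>mG \<partial>mG)"
    by (simp add: mult_ac flip: integral_mult_right_zero)
  also have "\<dots> = (\<integral>t. \<integral>s. \<phi> t * (cnj (\<psi> s) * A (t - s)) \<partial>mG \<partial>mG)"
  proof (rule Cc_Fubini[symmetric, OF _ Cc_compact_supp[OF \<phi>] Cc_compact_supp[OF \<psi>]])
    show "continuous_on UNIV (\<lambda>(t, s). \<phi> t * (cnj (\<psi> s) * A (t - s)))"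
      unfolding split_def by (intro continuous_on_mult continuous_on_cnj c\<phi> c\<psi> cA continuous_intros)
    show "\<phi> t * (cnj (\<psi> s) * A (t - s)) = 0" if "\<not> (t \<in> supp \<phi> \<and> s \<in> supp \<psi>)" for t s
      using that notin_supp[of t \<phi>] notin_supp[of s \<psi>] by auto
  qed
  finally show ?thesis by (simp add: sesq_def)
qed

text \<open>The functional with density \<open>A\<close> satisfies the definition, so by uniqueness
  it is what \<open>THE\<close> denotes; \<open>restrict\<close> provides membership in
  \<open>extensional Cc\<close>.\<close>

lemma autocorrelation_conv:
  assumes A: "continuous_on UNIV A" and bd: "\<And>t. norm (A t) \<le> C"
    and n: "\<And>\<phi> \<psi>. \<phi> \<in> Cc \<Longrightarrow> \<psi> \<in> Cc \<Longrightarrow> l2_inner n (pairing mG \<phi>) (pairing mG \<psi>) = sesq A \<phi> \<psi>"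
    and \<phi>: "\<phi> \<in> Cc" and \<psi>: "\<psi> \<in> Cc"
  shows "autocorrelation mG n (conv mG \<phi> (tilde \<psi>)) = sesq A \<phi> \<psi>"
proof -
  define \<gamma> where "\<gamma> = restrict (\<lambda>\<phi>. \<integral>t. \<phi> t * A t \<partial>mG) Cc"
  have \<gamma>: "\<gamma> \<phi> = (\<integral>t. \<phi> t * A t \<partial>mG)" if "\<phi> \<in> Cc" for \<phi>
    using that by (simp add: \<gamma>_def)
  have eq: "\<gamma> (conv mG \<phi> (tilde \<psi>)) = sesq A \<phi> \<psi>" if "\<phi> \<in> Cc" "\<psi> \<in> Cc" for \<phi> \<psi>
    unfolding \<gamma>[OF conv_Cc[OF that(1) Cc_tilde[OF that(2)]]] by (rule integral_conv_tilde[OF A that])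
  have "is_autocorrelation mG n \<gamma>"
    unfolding is_autocorrelation_def
  proof (intro conjI ballI)
    show "\<gamma> \<in> extensional Cc" unfolding \<gamma>_def by (rule restrict_extensional)
    show "complex_radon_functional \<gamma>" by (rule complex_radon_functional_density[OF A bd \<gamma>])
    show "translation_bounded \<gamma>" by (rule translation_bounded_density[OF bd \<gamma>])
    show "\<gamma> (conv mG \<phi> (tilde \<psi>)) = l2_inner n (pairing mG \<phi>) (pairing mG \<psi>)"
      if "\<phi> \<in> Cc" "\<psi> \<in> Cc" for \<phi> \<psi>
      by (simp add: eq n that)
  qed
  then have "autocorrelation mG n = \<gamma>"
    unfolding autocorrelation_def by (intro the_equality) (auto intro: autocorrelation_unique)
  then show ?thesis by (simp add: eq \<phi> \<psi>)
qed

end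

section \<open>Diffraction and spectral measures\<close>

text \<open>The whole space is open, hence inner regular, and a supremum in \<open>ennreal\<close>
  is already the supremum of a sequence of its members. By finiteness, equal measure means a null
  complement. This supplies the compact sets for Fubini on the dual group.\<close>

lemma radon_finite_tight:
  assumes H: "Hausdorff_space B" and \<rho>: "radon_measure B \<rho>" and fin: "finite_measure \<rho>"
  obtains L :: "nat \<Rightarrow> 'a set" where "\<And>n. compactin B (L n)" "AE y in \<rho>. y \<in> (\<Union>n. L n)"
proof -
  interpret finite_measure \<rho> by fact
  have sets: "sets \<rho> = sets (borel_of B)" using \<rho> by (simp add: radon_measure_def)
  let ?\<K> = "{K. compactin B K \<and> K \<subseteq> topspace B}"
  have SUP: "emeasure \<rho> (topspace B) = (SUP K\<in>?\<K>. emeasure \<rho> K)"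
    using \<rho> unfolding radon_measure_def by blast
  have "{} \<in> ?\<K>" by simp
  then have "?\<K> \<noteq> {}" by (rule ex_in_conv[THEN iffD1, OF exI])
  then have "emeasure \<rho> ` ?\<K> \<noteq> {}" by (simp only: image_is_empty not_False_eq_True)
  from ennreal_Sup_countable_SUP[OF this] obtain f :: "nat \<Rightarrow> ennreal"
    where f: "range f \<subseteq> emeasure \<rho> ` ?\<K>" "(SUP K\<in>?\<K>. emeasure \<rho> K) = Sup (range f)"
    by (elim exE conjE)
  have "\<exists>K. compactin B K \<and> emeasure \<rho> K = f n" for n
  proof -
    have "f n \<in> emeasure \<rho> ` ?\<K>" by (rule subsetD[OF f(1) rangeI])
    then show ?thesis by (elim imageE) auto
  qed
  then have "\<exists>L. \<forall>n. compactin B (L n) \<and> emeasure \<rho> (L n) = f n" by (intro choice) (rule allI)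
  then obtain L where "\<forall>n. compactin B (L n) \<and> emeasure \<rho> (L n) = f n" by (rule exE)
  then have L: "\<And>n. compactin B (L n)" "\<And>n. emeasure \<rho> (L n) = f n" by simp_all
  have [measurable]: "L n \<in> sets \<rho>" for n by (rule sets_borel_of_compactin[OF H sets L(1)])
  have "emeasure \<rho> (space \<rho>) \<le> emeasure \<rho> (\<Union>n. L n)"
    unfolding space_eq_topspace[OF sets] SUP f(2)
    by (intro Sup_least) (auto simp flip: L(2) intro!: emeasure_mono)
  then have "emeasure \<rho> (\<Union>n. L n) = emeasure \<rho> (space \<rho>)"
    by (intro antisym emeasure_space)
  then have "emeasure \<rho> (space \<rho> - (\<Union>n. L n)) = 0"
    by (subst emeasure_compl) (simp_all add: ennreal_minus_eq_0)
  then have "AE y in \<rho>. y \<in> (\<Union>n. L n)"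
    by (intro AE_I[where N = "space \<rho> - (\<Union>n. L n)"]) auto
  with L(1) show ?thesis by (rule that)
qed

text \<open>Inner regularity in quantitative form: one compact set misses less than \<open>e\<close>
  of the mass, so off that set a crude bound on an integrand is enough.\<close>

lemma radon_compact_approx:
  assumes \<rho>: "radon_measure B \<rho>" and fin: "finite_measure \<rho>" and e: "e > 0"
  obtains L where "compactin B L" "measure \<rho> (space \<rho>) < measure \<rho> L + e"
proof -
  interpret finite_measure \<rho> by fact
  have sets: "sets \<rho> = sets (borel_of B)" using \<rho> by (simp add: radon_measure_def)
  let ?\<K> = "{K. compactin B K \<and> K \<subseteq> topspace B}"
  have SUP: "emeasure \<rho> (space \<rho>) = (SUP K\<in>?\<K>. emeasure \<rho> K)"
    using \<rho> unfolding radon_measure_def space_eq_topspace[OF sets] by blast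
  have "{} \<in> ?\<K>" by simp
  then have "?\<K> \<noteq> {}" by (rule ex_in_conv[THEN iffD1, OF exI])
  moreover have "emeasure \<rho> (space \<rho>) \<noteq> \<infinity>" by simp
  ultimately obtain K where K: "K \<in> ?\<K>" "emeasure \<rho> (space \<rho>) < emeasure \<rho> K + ennreal e"
    using SUP_approx_ennreal[of e ?\<K> _ "emeasure \<rho>"] SUP e by auto
  then have "measure \<rho> (space \<rho>) < measure \<rho> K + e"
    using e by (simp add: emeasure_eq_measure ennreal_less_iff flip: ennreal_plus)
  with K(1) show ?thesis by (intro that[of K]) auto
qed

context haar_group
begin

text \<open>The squared modulus is a product with a conjugate, and
  \<open>\<eta> t * cnj (\<eta> s) = \<eta> (t - s)\<close>, so \<open>sesq_kernel\<close> gives the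
  value. Integrability is separate: the integrand is continuous and bounded by the square of the L1
  norm of \<open>\<phi>\<close>, and \<open>\<rho>\<close> is finite.\<close>

lemma spectral_imp_diffraction:
  assumes \<rho>: "radon_measure dual_topology \<rho>" "finite_measure \<rho>" and A: "\<And>t. A t = (\<integral>\<eta>. \<eta> t \<partial>\<rho>)"
    and \<phi>: "\<phi> \<in> Cc"
  shows "has_bochner_integral \<rho> (\<lambda>\<eta>. complex_of_real ((norm (check_transform mG \<phi> \<eta>))\<^sup>2)) (sesq A \<phi> \<phi>)"
proof -
  have sets: "sets \<rho> = sets (borel_of dual_topology)" using \<rho>(1) by (simp add: radon_measure_def)
  note sp = space_eq_topspace[OF sets, unfolded topspace_dual]
  obtain L where L: "\<And>n :: nat. compactin dual_topology (L n)" "AE y in \<rho>. y \<in> (\<Union>n. L n)"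
    using radon_finite_tight[OF Hausdorff_dual \<rho>] by blast
  have ch: "check_transform mG \<phi> \<eta> = (\<integral>t. \<phi> t * \<eta> t \<partial>mG)" for \<eta>
    by (simp add: check_transform_def mult.commute)
  have cc: "complex_of_real ((norm (check_transform mG \<phi> \<eta>))\<^sup>2)
      = (\<integral>t. \<phi> t * \<eta> t \<partial>mG) * cnj (\<integral>s. \<phi> s * \<eta> s \<partial>mG)" for \<eta>
    by (simp only: ch complex_norm_square)
  have "(\<integral>\<eta>. (\<integral>t. \<phi> t * \<eta> t \<partial>mG) * cnj (\<integral>s. \<phi> s * \<eta> s \<partial>mG) \<partial>\<rho>) = sesq A \<phi> \<phi>"
  proof (rule sesq_kernel[OF Hausdorff_dual sets \<rho>(2) continuous_map_eval_dual L _ _ \<phi> \<phi>])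
    show "norm (\<eta> t) \<le> 1" if "\<eta> \<in> topspace dual_topology" for t and \<eta> :: "'g \<Rightarrow> complex"
      using that dual_groupD(1)[of \<eta> t] by (simp add: topspace_dual)
    show "(\<integral>\<eta>. \<eta> t * cnj (\<eta> s) \<partial>\<rho>) = A (t - s)" for t s
      unfolding A by (intro Bochner_Integration.integral_cong[OF refl]) (simp add: sp dual_groupD(4))
  qed
  moreover have "integrable \<rho> (\<lambda>\<eta>. (\<integral>t. \<phi> t * \<eta> t \<partial>mG) * cnj (\<integral>s. \<phi> s * \<eta> s \<partial>mG))"
  proof (rule integrable_continuous_bounded[OF \<rho>(2) sets])
    show "continuous_map dual_topology euclidean
        (\<lambda>\<eta>. (\<integral>t. \<phi> t * \<eta> t \<partial>mG) * cnj (\<integral>s. \<phi> s * \<eta> s \<partial>mG))"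
      by (intro continuous_map_complex_mult continuous_map_cnj
          continuous_map_Cc_integral[OF continuous_map_eval_dual \<phi>])
    show "norm ((\<integral>t. \<phi> t * \<eta> t \<partial>mG) * cnj (\<integral>s. \<phi> s * \<eta> s \<partial>mG))
        \<le> ((\<integral>t. norm (\<phi> t) \<partial>mG) * 1) * ((\<integral>t. norm (\<phi> t) \<partial>mG) * 1)"
      if "\<eta> \<in> topspace dual_topology" for \<eta>
      unfolding norm_mult complex_mod_cnj using that dual_groupD(1)[of \<eta>]
      by (intro mult_mono norm_Cc_integral_le[OF \<phi>]) (auto simp: topspace_dual)
  qed
  ultimately show ?thesis
    unfolding cc by (simp add: has_bochner_integral_iff)
qed

section \<open>Recovering the Fourier transform of a measure from its quadratic form\<close>

context
  fixes A :: "'g \<Rightarrow> complex" and C :: real and \<mu> :: "('g \<Rightarrow> complex) measure"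
  assumes A: "continuous_on UNIV A" and bd: "\<And>t. norm (A t) \<le> C"
    and \<mu>: "radon_measure dual_topology \<mu>"
    and sq: "\<And>\<phi>. \<phi> \<in> Cc \<Longrightarrow> has_bochner_integral \<mu>
        (\<lambda>\<eta>. complex_of_real ((norm (check_transform mG \<phi> \<eta>))\<^sup>2)) (sesq A \<phi> \<phi>)"
begin

lemma sets_mu: "sets \<mu> = sets (borel_of dual_topology)"
  using \<mu> by (simp add: radon_measure_def)

lemma space_mu: "space \<mu> = dual_group"
  using space_eq_topspace[OF sets_mu] by (simp add: topspace_dual)

text \<open>Equicontinuity of a compact set of characters, from joint continuity of evaluation with
  the compact set now on the side of the characters.\<close>

lemma dual_compact_close:
  assumes L: "compactin dual_topology L" and e: "e > 0"
  shows "\<exists>V. open V \<and> (t0 :: 'g) \<in> V \<and> (\<forall>\<eta>\<in>L. \<forall>t\<in>V. norm (\<eta> t - \<eta> t0) \<le> e)"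
proof -
  have t0: "t0 \<in> topspace euclidean" by simp
  obtain V where "openin euclidean V" "t0 \<in> V" "\<And>\<eta> t. \<eta> \<in> L \<Longrightarrow> t \<in> V \<Longrightarrow> dist (\<eta> t) (\<eta> t0) < e"
    using compactin_uniformly_close[OF continuous_map_swap_args[OF continuous_map_eval_dual] L t0 e]
    by blast
  then show ?thesis by (intro exI[of _ V]) (auto simp: dist_norm intro: less_imp_le)
qed

lemma bump_transform_close:
  assumes L: "L \<subseteq> dual_group" and V: "\<forall>\<eta>\<in>L. \<forall>t\<in>V. norm (\<eta> t - \<eta> t0) \<le> e"
    and p: "bump V p" and \<eta>: "\<eta> \<in> L"
  shows "norm (check_transform mG (\<lambda>t. complex_of_real (p t)) \<eta> - \<eta> t0) \<le> e"
proof -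
  have "check_transform mG (\<lambda>t. complex_of_real (p t)) \<eta> = (\<integral>t. complex_of_real (p t) * \<eta> t \<partial>mG)"
    by (simp add: check_transform_def mult.commute)
  moreover have "continuous_on UNIV \<eta>" using dual_groupD(5) L \<eta> by blast
  ultimately show ?thesis using bump_average[OF p, of \<eta> "\<eta> t0" e] V \<eta> by simp
qed

lemma bump_transform_le:
  assumes p: "bump V p" and \<eta>: "\<eta> \<in> dual_group"
  shows "norm (check_transform mG (\<lambda>t. complex_of_real (p t)) \<eta>) \<le> 1"
proof -
  have "check_transform mG (\<lambda>t. complex_of_real (p t)) \<eta> = (\<integral>t. complex_of_real (p t) * \<eta> t \<partial>mG)"
    by (simp add: check_transform_def mult.commute)
  \<comment> \<open>Centre 0 and radius 1, as characters have modulus 1.\<close>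
  then show ?thesis using bump_average[OF p, of \<eta> 0 1] dual_groupD(1,5)[OF \<eta>] by simp
qed

text \<open>For a bump close enough to 0 the transform is within 1/2 of 1 on \<open>L\<close>, so 4
  times its squared modulus dominates the indicator of \<open>L\<close>. The integral of the squared
  modulus is \<open>sesq A \<phi> \<phi>\<close>, an average of values of \<open>A\<close>, hence at
  most \<open>C\<close>. The bound is the same for all \<open>L\<close>.\<close>

lemma measure_compact_le:
  assumes L: "compactin dual_topology L"
  shows "emeasure \<mu> L \<le> ennreal (4 * C)"
proof -
  have Ls: "L \<in> sets \<mu>" by (rule sets_borel_of_compactin[OF Hausdorff_dual sets_mu L])
  have Ld: "L \<subseteq> dual_group" using compactin_subset_topspace[OF L] by (simp add: topspace_dual)
  have Lfin: "emeasure \<mu> L < \<infinity>" using \<mu> L by (simp add: radon_measure_def)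
  obtain V where V: "open V" "(0::'g) \<in> V" "\<forall>\<eta>\<in>L. \<forall>t\<in>V. norm (\<eta> t - \<eta> 0) \<le> 1/2"
    using dual_compact_close[OF L half_gt_zero[OF zero_less_one], of 0] by (elim exE conjE)
  obtain p where p: "bump V p" by (rule bump_exists[OF V(1,2)])
  define \<phi> where "\<phi> t = complex_of_real (p t)" for t
  have \<phi>: "\<phi> \<in> Cc" using bump_Cc[OF p] by (simp add: \<phi>_def[abs_def])
  have half: "1/2 \<le> norm (check_transform mG \<phi> \<eta>)" if "\<eta> \<in> L" for \<eta>
  proof -
    have "\<eta> \<in> dual_group" using that Ld by blast
    then have "norm (check_transform mG \<phi> \<eta> - 1) \<le> 1/2"
      using bump_transform_close[OF Ld V(3) p that] dual_groupD(3)[of \<eta>] unfolding \<phi>_def[abs_def] by simp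
    then show ?thesis
      using norm_triangle_ineq2[of 1 "1 - check_transform mG \<phi> \<eta>"] by (simp add: norm_minus_commute)
  qed
  have int: "integrable \<mu> (\<lambda>\<eta>. (norm (check_transform mG \<phi> \<eta>))\<^sup>2)"
    and eq: "complex_of_real (\<integral>\<eta>. (norm (check_transform mG \<phi> \<eta>))\<^sup>2 \<partial>\<mu>) = sesq A \<phi> \<phi>"
    using sq[OF \<phi>] unfolding has_bochner_integral_iff complex_of_real_integrable_eq integral_complex_of_real
    by auto
  have "measure \<mu> L = (\<integral>\<eta>. indicator L \<eta> \<partial>\<mu>)"
    using Ls by simp
  also have "\<dots> \<le> (\<integral>\<eta>. 4 * (norm (check_transform mG \<phi> \<eta>))\<^sup>2 \<partial>\<mu>)"
  proof (rule integral_mono')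
    fix \<eta> show "indicator L \<eta> \<le> 4 * (norm (check_transform mG \<phi> \<eta>))\<^sup>2"
    proof (cases "\<eta> \<in> L")
      case True
      have "(1/2)\<^sup>2 \<le> (norm (check_transform mG \<phi> \<eta>))\<^sup>2"
        using half[OF True] by (intro power_mono) auto
      with True show ?thesis by (simp add: power2_eq_square)
    qed simp
  qed (use int in auto)
  also have "\<dots> = 4 * (\<integral>\<eta>. (norm (check_transform mG \<phi> \<eta>))\<^sup>2 \<partial>\<mu>)" by simp
  also have "\<dots> \<le> 4 * norm (sesq A \<phi> \<phi>)"
    unfolding eq[symmetric] norm_of_real by simp
  also have "\<dots> \<le> 4 * C"
    using sesq_bump[OF A p p, of 0 C] bd unfolding \<phi>_def[abs_def] by simp
  finally have "measure \<mu> L \<le> 4 * C" .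
  then show ?thesis
    using Lfin by (subst emeasure_eq_ennreal_measure) (auto intro: ennreal_leI)
qed

text \<open>Inner regularity of the whole dual group passes the uniform bound on compact sets to the
  total mass.\<close>

lemma finite_mu: "finite_measure \<mu>"
proof
  have "emeasure \<mu> (space \<mu>) = (SUP K\<in>{K. compactin dual_topology K \<and> K \<subseteq> topspace dual_topology}. emeasure \<mu> K)"
    using \<mu> unfolding radon_measure_def space_eq_topspace[OF sets_mu] by blast
  also have "\<dots> \<le> ennreal (4 * C)"
    using measure_compact_le by (intro SUP_least) auto
  finally show "emeasure \<mu> (space \<mu>) \<noteq> \<infinity>"
    by (metis ennreal_less_top infinity_ennreal_def leD)
qed

text \<open>Polarization: \<open>4 a cnj b\<close> is the sum of \<open>c \<bar>a + c b\<bar>\<^sup>2\<close> over \<open>c \<in> {1, -1, \<i>, -\<i>}\<close>.\<close>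

lemma check_transform_polarized:
  assumes \<phi>: "\<phi> \<in> Cc" and \<psi>: "\<psi> \<in> Cc"
  shows "has_bochner_integral \<mu>
    (\<lambda>\<eta>. check_transform mG \<phi> \<eta> * cnj (check_transform mG \<psi> \<eta>)) (sesq A \<phi> \<psi>)"
proof -
  define f where "f c \<eta> = complex_of_real ((norm (check_transform mG \<phi> \<eta> + c * check_transform mG \<psi> \<eta>))\<^sup>2)" for c \<eta>
  define q where "q c = sesq A (\<lambda>t. \<phi> t + c * \<psi> t) (\<lambda>t. \<phi> t + c * \<psi> t)" for c
  have lin: "check_transform mG (\<lambda>t. \<phi> t + c * \<psi> t) \<eta> = check_transform mG \<phi> \<eta> + c * check_transform mG \<psi> \<eta>"
    if "\<eta> \<in> dual_group" for c \<eta>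
  proof -
    have "integrable mG (\<lambda>t. \<eta> t * \<phi> t)" "integrable mG (\<lambda>t. \<eta> t * \<psi> t)"
      using Cc_integrable[OF Cc_mult[OF \<phi> dual_groupD(5)[OF that]]]
        Cc_integrable[OF Cc_mult[OF \<psi> dual_groupD(5)[OF that]]] by (simp_all add: mult.commute)
    then show ?thesis
      unfolding check_transform_def by (simp add: distrib_left mult.left_commute)
  qed
  have *: "has_bochner_integral \<mu> (f c) (q c)" for c
  proof -
    \<comment> \<open>Additivity of the transform is established for characters only, so the
      integrands are compared on the space of \<open>\<mu>\<close>, which is
      \<open>dual_group\<close>.\<close>
    have "has_bochner_integral \<mu> (f c) (q c) \<longleftrightarrow> has_bochner_integral \<mu>
        (\<lambda>\<eta>. complex_of_real ((norm (check_transform mG (\<lambda>t. \<phi> t + c * \<psi> t) \<eta>))\<^sup>2)) (q c)"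
      by (intro has_bochner_integral_cong refl) (simp add: space_mu lin f_def)
    then show ?thesis
      using sq[OF Cc_add[OF \<phi> Cc_cmult[OF \<psi>]]] by (simp add: q_def)
  qed
  have "has_bochner_integral \<mu> (\<lambda>\<eta>. (1/4) * (1 * f 1 \<eta> + (-1) * f (-1) \<eta> + \<i> * f \<i> \<eta> + (-\<i>) * f (-\<i>) \<eta>))
      ((1/4) * (1 * q 1 + (-1) * q (-1) + \<i> * q \<i> + (-\<i>) * q (-\<i>)))"
    by (intro has_bochner_integral_mult_right has_bochner_integral_add *)
  moreover have "(1/4) * (1 * f 1 \<eta> + (-1) * f (-1) \<eta> + \<i> * f \<i> \<eta> + (-\<i>) * f (-\<i>) \<eta>)
      = check_transform mG \<phi> \<eta> * cnj (check_transform mG \<psi> \<eta>)" for \<eta>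
    unfolding f_def complex_norm_square by (simp add: algebra_simps)
  moreover have "(1/4) * (1 * q 1 + (-1) * q (-1) + \<i> * q \<i> + (-\<i>) * q (-\<i>)) = sesq A \<phi> \<psi>"
    unfolding q_def sesq_quadratic[OF A \<phi> \<psi>] by (simp add: algebra_simps)
  ultimately show ?thesis by simp
qed

text \<open>The error \<open>(2 * M + 3) * e\<close> consists of \<open>2 * e\<close> for the
  integrand on a compact set \<open>L\<close>, integrated over total mass \<open>M\<close>; of the
  crude bound 2 off \<open>L\<close>, where the mass is below \<open>e\<close>; and of
  \<open>e\<close> for the distance of the form from \<open>A t0\<close>.\<close>

lemma diffraction_transform: "A t0 = (\<integral>\<eta>. \<eta> t0 \<partial>\<mu>)"
proof -
  interpret finite_measure \<mu> by (rule finite_mu)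
  define M where "M = measure \<mu> (space \<mu>)"
  have est: "norm (A t0 - (\<integral>\<eta>. \<eta> t0 \<partial>\<mu>)) \<le> (2 * M + 3) * e" if e: "e > 0" for e
  proof -
    obtain L where L: "compactin dual_topology L" "M < measure \<mu> L + e"
      using radon_compact_approx[OF \<mu> finite_mu e] unfolding M_def by blast
    have [measurable]: "L \<in> sets \<mu>" by (rule sets_borel_of_compactin[OF Hausdorff_dual sets_mu L(1)])
    have Ld: "L \<subseteq> dual_group" using compactin_subset_topspace[OF L(1)] by (simp add: topspace_dual)
    obtain V where V: "open V" "t0 \<in> V" "\<forall>\<eta>\<in>L. \<forall>t\<in>V. norm (\<eta> t - \<eta> t0) \<le> e"
      using dual_compact_close[OF L(1) e, of t0] by (elim exE conjE)
    obtain W where W: "open W" "(0::'g) \<in> W" "\<forall>\<eta>\<in>L. \<forall>t\<in>W. norm (\<eta> t - \<eta> 0) \<le> e"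
      using dual_compact_close[OF L(1) e, of 0] by (elim exE conjE)
    \<comment> \<open>\<open>V\<close> and \<open>W\<close> control the characters in
      \<open>L\<close>, near \<open>t0\<close> and near 0. Continuity of \<open>A (t - s)\<close> at
      \<open>(t0, 0)\<close> gives \<open>V'\<close> and \<open>W'\<close>, which control the form;
      the bumps live in the intersections.\<close>
    have "open ((\<lambda>z. A (fst z - snd z)) -` ball (A t0) e)"
      by (intro open_vimage open_ball continuous_on_compose_UNIV[OF A] continuous_intros)
    moreover have "(t0, 0) \<in> (\<lambda>z. A (fst z - snd z)) -` ball (A t0) e" using e by simp
    ultimately obtain V' W' where VW: "open V'" "open W'" "t0 \<in> V'" "0 \<in> W'"
      and sub: "V' \<times> W' \<subseteq> (\<lambda>z. A (fst z - snd z)) -` ball (A t0) e"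
      by (rule open_prod_elim) (auto simp: mem_Times_iff)
    have close: "norm (A (t - s) - A t0) \<le> e" if "t \<in> V \<inter> V'" "s \<in> W \<inter> W'" for t s
      using subsetD[OF sub, of "(t, s)"] that by (auto simp: dist_norm norm_minus_commute)
    have "open (V \<inter> V')" "t0 \<in> V \<inter> V'" using V VW by auto
    then obtain p where p: "bump (V \<inter> V') p" by (rule bump_exists)
    have "open (W \<inter> W')" "0 \<in> W \<inter> W'" using W VW by auto
    then obtain q where q: "bump (W \<inter> W') q" by (rule bump_exists)
    define P where "P = check_transform mG (\<lambda>t. complex_of_real (p t))"
    define Q where "Q = check_transform mG (\<lambda>t. complex_of_real (q t))"
    define S where "S = sesq A (\<lambda>t. complex_of_real (p t)) (\<lambda>t. complex_of_real (q t))"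
    have S: "has_bochner_integral \<mu> (\<lambda>\<eta>. P \<eta> * cnj (Q \<eta>)) S"
      unfolding P_def Q_def S_def by (intro check_transform_polarized bump_Cc[OF p] bump_Cc[OF q])
    have SA: "norm (S - A t0) \<le> e" unfolding S_def by (rule sesq_bump[OF A p q close])
    have ie: "integrable \<mu> (\<lambda>\<eta>. \<eta> t0)"
    proof (rule integrable_continuous_bounded[OF finite_mu sets_mu])
      show "continuous_map dual_topology euclidean (\<lambda>\<eta> :: 'g \<Rightarrow> complex. \<eta> t0)"
        using continuous_map_curry2[OF continuous_map_eval_dual, of t0] by simp
      show "norm (\<eta> t0) \<le> 1" if "\<eta> \<in> topspace dual_topology" for \<eta> :: "'g \<Rightarrow> complex"
        using that by (simp add: topspace_dual dual_groupD(1))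
    qed
    \<comment> \<open>Off \<open>L\<close> both transforms have modulus at most 1 and
      \<open>\<eta> t0\<close> has modulus 1, whence the factor 2.\<close>
    define i2 where "i2 \<eta> = (2 :: real) * indicator (space \<mu> - L) \<eta>" for \<eta>
    have i2: "integrable \<mu> i2"
      unfolding i2_def by (intro integrable_mult_right integrable_real_indicator)
        (auto simp: less_top[symmetric] emeasure_finite)
    have "norm (S - (\<integral>\<eta>. \<eta> t0 \<partial>\<mu>)) = norm (\<integral>\<eta>. P \<eta> * cnj (Q \<eta>) - \<eta> t0 \<partial>\<mu>)"
      using S ie by (simp add: has_bochner_integral_iff)
    also have "\<dots> \<le> (\<integral>\<eta>. 2 * e + i2 \<eta> \<partial>\<mu>)"
    proof (rule norm_integral_le)
      show "integrable \<mu> (\<lambda>\<eta>. 2 * e + i2 \<eta>)"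
        by (intro Bochner_Integration.integrable_add integrable_const i2)
      fix \<eta> assume "\<eta> \<in> space \<mu>"
      then have \<eta>: "\<eta> \<in> dual_group" by (simp add: space_mu)
      have P1: "norm (P \<eta>) \<le> 1" and Q1: "norm (Q \<eta>) \<le> 1"
        unfolding P_def Q_def by (rule bump_transform_le[OF p \<eta>] bump_transform_le[OF q \<eta>])+
      show "norm (P \<eta> * cnj (Q \<eta>) - \<eta> t0) \<le> 2 * e + i2 \<eta>"
      proof (cases "\<eta> \<in> L")
        case True
        have Pe: "norm (P \<eta> - \<eta> t0) \<le> e"
          unfolding P_def by (rule bump_transform_close[OF Ld _ p True]) (use V in blast)
        have Qe: "norm (Q \<eta> - \<eta> 0) \<le> e"
          unfolding Q_def by (rule bump_transform_close[OF Ld _ q True]) (use W in blast)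
        \<comment> \<open>The identity uses \<open>\<eta> 0 = 1\<close>: the bump near 0 contributes
          a factor close to 1, the bump near \<open>t0\<close> a factor close to
          \<open>\<eta> t0\<close>.\<close>
        have "P \<eta> * cnj (Q \<eta>) - \<eta> t0 = (P \<eta> - \<eta> t0) * cnj (Q \<eta>) + \<eta> t0 * cnj (Q \<eta> - \<eta> 0)"
          by (simp add: algebra_simps dual_groupD(3)[OF \<eta>])
        also have "norm \<dots> \<le> norm ((P \<eta> - \<eta> t0) * cnj (Q \<eta>)) + norm (\<eta> t0 * cnj (Q \<eta> - \<eta> 0))"
          by (rule norm_triangle_ineq)
        also have "\<dots> \<le> e * 1 + 1 * e"
          unfolding norm_mult complex_mod_cnj dual_groupD(1)[OF \<eta>]
          using Pe Qe Q1 e by (intro add_mono mult_mono) auto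
        finally have "norm (P \<eta> * cnj (Q \<eta>) - \<eta> t0) \<le> e * 1 + 1 * e" .
        then show ?thesis using True by (simp add: i2_def)
      next
        case False
        have "norm (P \<eta> * cnj (Q \<eta>) - \<eta> t0) \<le> norm (P \<eta>) * norm (Q \<eta>) + norm (\<eta> t0)"
          using norm_triangle_ineq4[of "P \<eta> * cnj (Q \<eta>)" "\<eta> t0"] by (simp add: norm_mult)
        also have "\<dots> \<le> 1 * 1 + 1"
          using P1 Q1 dual_groupD(1)[OF \<eta>, of t0] by (intro add_mono mult_mono) auto
        finally show ?thesis using False \<open>\<eta> \<in> space \<mu>\<close> e by (simp add: i2_def)
      qed
    qed
    also have "\<dots> = 2 * e * M + (\<integral>\<eta>. i2 \<eta> \<partial>\<mu>)"
      using i2 by (simp add: M_def mult.commute)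
    also have "(\<integral>\<eta>. i2 \<eta> \<partial>\<mu>) = 2 * (M - measure \<mu> L)"
      by (simp add: i2_def[abs_def] M_def finite_measure_compl)
    also have "2 * e * M + 2 * (M - measure \<mu> L) \<le> 2 * e * M + 2 * e" using L(2) by simp
    finally have "norm (S - (\<integral>\<eta>. \<eta> t0 \<partial>\<mu>)) \<le> 2 * e * M + 2 * e" .
    then have "norm (A t0 - (\<integral>\<eta>. \<eta> t0 \<partial>\<mu>)) \<le> e + (2 * e * M + 2 * e)"
      using norm_triangle_ineq4[of "S - (\<integral>\<eta>. \<eta> t0 \<partial>\<mu>)" "S - A t0"] SA by simp
    then show ?thesis by (simp add: algebra_simps)
  qed
  have "M \<ge> 0" by (simp add: M_def)
  then have "norm (A t0 - (\<integral>\<eta>. \<eta> t0 \<partial>\<mu>)) \<le> 0 + d" if "d > 0" for d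
    using est[of "d / (2 * M + 3)"] that by simp
  then have "norm (A t0 - (\<integral>\<eta>. \<eta> t0 \<partial>\<mu>)) \<le> 0" by (rule field_le_epsilon)
  then show ?thesis by simp
qed

end

end


section \<open>Function dynamical systems\<close>

text \<open>Compactness of \<open>X\<close> makes images of closed sets closed, so an open set
  around a preimage contains the preimage of an open set; this transports outer regularity. For
  inner regularity, compact subsets of a preimage are pushed forward to compact sets, whose
  preimages can only be larger.\<close>

lemma radon_measure_distr:
  assumes X: "compact_space X" and Y: "Hausdorff_space Y" and m: "radon_measure X m" "finite_measure m"
    and \<Psi>: "continuous_map X Y \<Psi>"
  shows "radon_measure Y (distr m (borel_of Y) \<Psi>)"
proof -
  interpret finite_measure m by fact
  have sets: "sets m = sets (borel_of X)" using m(1) by (simp add: radon_measure_def)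
  note sp = space_eq_topspace[OF sets]
  have \<Psi>m[measurable]: "\<Psi> \<in> measurable m (borel_of Y)"
    by (rule continuous_map_measurable_borel_of[OF sets refl \<Psi>])
  let ?n = "distr m (borel_of Y) \<Psi>"
  have em: "emeasure ?n B = emeasure m (\<Psi> -` B \<inter> topspace X)" if "B \<in> sets (borel_of Y)" for B
    using emeasure_distr[OF \<Psi>m that] by (simp add: sp)
  have op: "U \<in> sets (borel_of Y)" if "openin Y U" for U by (rule sets_borel_of_openin[OF refl that])
  have co: "K \<in> sets (borel_of Y)" if "compactin Y K" for K by (rule sets_borel_of_compactin[OF Y refl that])
  have outer: "emeasure ?n B = (INF U\<in>{U. openin Y U \<and> B \<subseteq> U}. emeasure ?n U)"
    if B: "B \<in> sets (borel_of Y)" for B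
  proof (rule antisym)
    show "emeasure ?n B \<le> (INF U\<in>{U. openin Y U \<and> B \<subseteq> U}. emeasure ?n U)"
      using op by (intro INF_greatest emeasure_mono) auto
    show "(INF U\<in>{U. openin Y U \<and> B \<subseteq> U}. emeasure ?n U) \<le> emeasure ?n B"
    proof (rule ennreal_le_epsilon)
      fix e :: real assume e: "e > 0"
      let ?Q = "\<Psi> -` B \<inter> topspace X"
      have Q: "?Q \<in> sets m" using measurable_sets[OF \<Psi>m B] by (simp add: sp)
      have "emeasure m ?Q = (INF U\<in>{U. openin X U \<and> ?Q \<subseteq> U}. emeasure m U)"
        using m(1) Q by (simp add: radon_measure_def)
      then have "(INF U\<in>{U. openin X U \<and> ?Q \<subseteq> U}. emeasure m U) < emeasure m ?Q + ennreal e"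
        using e emeasure_finite[of ?Q] by (metis ennreal_add_left_cancel_less add.right_neutral ennreal_less_zero_iff infinity_ennreal_def less_top)
      then obtain W where W: "openin X W" "?Q \<subseteq> W" "emeasure m W < emeasure m ?Q + ennreal e"
        unfolding INF_less_iff by blast
      \<comment> \<open>The largest subset of \<open>topspace Y\<close> whose preimage in
        \<open>X\<close> lies inside \<open>W\<close>; it is open because the removed image is
        compact.\<close>
      define U where "U = topspace Y - \<Psi> ` (topspace X - W)"
      have "compactin X (topspace X - W)"
        using X W(1) by (intro closedin_compact_space) auto
      then have "closedin Y (\<Psi> ` (topspace X - W))"
        by (intro compactin_imp_closedin[OF Y] image_compactin[OF _ \<Psi>])
      then have U: "openin Y U" by (auto simp: U_def)
      have "B \<subseteq> U"
        using sets.sets_into_space[OF B] W(2) by (auto simp: U_def)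
      have "emeasure ?n U \<le> emeasure m W"
        unfolding em[OF op[OF U]]
        using sets_borel_of_openin[OF sets W(1)] by (intro emeasure_mono) (auto simp: U_def)
      also have "\<dots> \<le> emeasure ?n B + ennreal e" using W(3) by (simp add: em[OF B])
      finally have "emeasure ?n U \<le> emeasure ?n B + ennreal e" .
      moreover have "U \<in> {U. openin Y U \<and> B \<subseteq> U}" using U \<open>B \<subseteq> U\<close> by simp
      ultimately show "(INF U\<in>{U. openin Y U \<and> B \<subseteq> U}. emeasure ?n U) \<le> emeasure ?n B + ennreal e"
        by (rule INF_lower2[rotated])
    qed
  qed
  have inner: "emeasure ?n U = (SUP K\<in>{K. compactin Y K \<and> K \<subseteq> U}. emeasure ?n K)" if U: "openin Y U" for U
  proof (rule antisym)
    show "(SUP K\<in>{K. compactin Y K \<and> K \<subseteq> U}. emeasure ?n K) \<le> emeasure ?n U"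
      using op[OF U] by (intro SUP_least emeasure_mono) auto
    have eq: "\<Psi> -` U \<inter> topspace X = {x \<in> topspace X. \<Psi> x \<in> U}" by auto
    have "openin X (\<Psi> -` U \<inter> topspace X)"
      unfolding eq by (rule openin_continuous_map_preimage[OF \<Psi> U])
    then have "emeasure ?n U = (SUP K\<in>{K. compactin X K \<and> K \<subseteq> \<Psi> -` U \<inter> topspace X}. emeasure m K)"
      using m(1) unfolding em[OF op[OF U]] radon_measure_def by blast
    also have "\<dots> \<le> (SUP K\<in>{K. compactin Y K \<and> K \<subseteq> U}. emeasure ?n K)"
    proof (rule SUP_least)
      fix K assume K: "K \<in> {K. compactin X K \<and> K \<subseteq> \<Psi> -` U \<inter> topspace X}"
      then have \<Psi>K: "compactin Y (\<Psi> ` K)" using image_compactin[OF _ \<Psi>] by simp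
      have "emeasure m K \<le> emeasure ?n (\<Psi> ` K)"
        unfolding em[OF co[OF \<Psi>K]] using K measurable_sets[OF \<Psi>m co[OF \<Psi>K]]
        by (intro emeasure_mono) (auto simp: sp)
      moreover have "\<Psi> ` K \<in> {K. compactin Y K \<and> K \<subseteq> U}" using K \<Psi>K by auto
      ultimately show "emeasure m K \<le> (SUP K\<in>{K. compactin Y K \<and> K \<subseteq> U}. emeasure ?n K)"
        by (rule SUP_upper2[rotated])
    qed
    finally show "emeasure ?n U \<le> (SUP K\<in>{K. compactin Y K \<and> K \<subseteq> U}. emeasure ?n K)" .
  qed
  have "emeasure ?n K < \<infinity>" if "compactin Y K" for K
    unfolding em[OF co[OF that]] by (simp add: emeasure_finite less_top[symmetric])
  with outer inner show ?thesis
    unfolding radon_measure_def by simp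
qed

text \<open>Currying: a basic neighbourhood in \<open>CG_topology\<close> asks for closeness on one
  compact set, which is what \<open>compactin_uniformly_close\<close> delivers.\<close>

lemma continuous_map_into_CG:
  fixes k :: "'g::topological_space \<Rightarrow> 'b \<Rightarrow> complex"
  assumes k: "continuous_map (prod_topology euclidean B) euclidean (\<lambda>(t, y). k t y)"
  shows "continuous_map B CG_topology (\<lambda>y t. k t y)"
  unfolding continuous_map_def
proof (intro conjI allI impI)
  have CG: "(\<lambda>t. k t y) \<in> CG" if "y \<in> topspace B" for y
    using continuous_map_curry1[OF k that] by (simp add: CG_def)
  then show "(\<lambda>y t. k t y) \<in> topspace B \<rightarrow> topspace CG_topology"
    by (simp add: topspace_CG_topology)
  fix U :: "('g \<Rightarrow> complex) set" assume U: "openin CG_topology U"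
  show "openin B {y \<in> topspace B. (\<lambda>t. k t y) \<in> U}"
  proof (subst openin_subopen, intro ballI)
    fix y assume "y \<in> {y \<in> topspace B. (\<lambda>t. k t y) \<in> U}"
    then have y: "y \<in> topspace B" "(\<lambda>t. k t y) \<in> U" by auto
    from U[unfolded openin_CG_topology, THEN conjunct2, rule_format, OF y(2)]
    obtain K e where K: "compact K" and e: "e > 0"
      and sub: "\<forall>h\<in>CG. (\<forall>t\<in>K. dist (h t) (k t y) < e) \<longrightarrow> h \<in> U"
      by (elim exE conjE)
    have "compactin euclidean K" using K by simp
    show "\<exists>T. openin B T \<and> y \<in> T \<and> T \<subseteq> {y \<in> topspace B. (\<lambda>t. k t y) \<in> U}"
    proof (rule compactin_uniformly_close[OF k \<open>compactin euclidean K\<close> y(1) e])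
      fix V assume V: "openin B V" "y \<in> V" "\<And>t z. t \<in> K \<Longrightarrow> z \<in> V \<Longrightarrow> dist (k t z) (k t y) < e"
      have "z \<in> topspace B \<and> (\<lambda>t. k t z) \<in> U" if "z \<in> V" for z
        using that openin_subset[OF V(1)] CG[of z] sub V(3)[OF _ that] by (simp add: subset_iff)
      then have "V \<subseteq> {y \<in> topspace B. (\<lambda>t. k t y) \<in> U}"
        by (intro subsetI CollectI)
      with V(1,2) show ?thesis by (intro exI[of _ V] conjI)
    qed
  qed
qed

section \<open>Continuous functions on a dynamical system, their correlations and orbit
  factors\<close>

locale dynamical_haar = haar_group mG for mG :: "'g::{topological_ab_group_add,t2_space} measure" +
  fixes X :: "'x topology" and \<alpha> :: "'g \<Rightarrow> 'x \<Rightarrow> 'x" and m :: "'x measure"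
  assumes system: "dynamical_system X \<alpha> m"
begin

lemma X_compact: "compact_space X" and X_Hausdorff: "Hausdorff_space X"
  and action: "continuous_map (prod_topology euclidean X) X (\<lambda>(t, x). \<alpha> t x)"
  and action_add: "x \<in> topspace X \<Longrightarrow> \<alpha> (s + t) x = \<alpha> s (\<alpha> t x)"
  and m_radon: "radon_measure X m" and m_prob: "prob_space m"
  and m_invariant: "distr m m (\<alpha> t) = m"
  using system unfolding dynamical_system_def by auto

lemma sets_m: "sets m = sets (borel_of X)"
  using m_radon by (simp add: radon_measure_def)

lemma space_m: "space m = topspace X"
  by (rule space_eq_topspace[OF sets_m])

lemma m_finite: "finite_measure m"
  using m_prob by (simp add: prob_space_def)

lemma action_map: "continuous_map X X (\<alpha> t)"
  using continuous_map_curry2[OF action, of t] by simp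

lemma action_in: "x \<in> topspace X \<Longrightarrow> \<alpha> t x \<in> topspace X"
  using action_map[of t] by (auto simp: continuous_map_def)

lemma action_measurable: "\<alpha> t \<in> measurable m m"
  by (rule continuous_map_measurable_borel_of[OF sets_m sets_m action_map])

lemma integral_action:
  fixes g :: "'x \<Rightarrow> complex"
  assumes "continuous_map X euclidean g"
  shows "(\<integral>x. g (\<alpha> t x) \<partial>m) = (\<integral>x. g x \<partial>m)"
  using integral_distr[OF action_measurable continuous_map_borel_measurable[OF sets_m assms], of t]
  by (simp add: m_invariant)

lemma continuous_map_orbit:
  fixes f :: "'x \<Rightarrow> complex"
  assumes "continuous_map X euclidean f"
  shows "continuous_map (prod_topology euclidean X) euclidean (\<lambda>(t, x). f (\<alpha> (- t) x))"
proof -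
  have "continuous_map (prod_topology (euclidean :: 'g topology) X) euclidean (uminus \<circ> fst)"
    by (rule continuous_map_compose[OF continuous_map_fst]) (simp add: continuous_on_minus continuous_on_id)
  then have "continuous_map (prod_topology (euclidean :: 'g topology) X) euclidean (\<lambda>z. - fst z)"
    by (simp add: o_def)
  then have "continuous_map (prod_topology euclidean X) (prod_topology euclidean X) (\<lambda>z. (- fst z :: 'g, snd z))"
    by (intro continuous_map_pairedI continuous_map_snd)
  from continuous_map_compose[OF continuous_map_compose[OF this action] assms]
  show ?thesis by (simp add: o_def split_def)
qed

lemma X_bounded:
  fixes f :: "'x \<Rightarrow> complex"
  assumes "continuous_map X euclidean f"
  obtains C where "C \<ge> 0" "\<And>x. x \<in> topspace X \<Longrightarrow> norm (f x) \<le> C"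
  using continuous_map_compact_bounded[OF assms] X_compact unfolding compact_space_def by blast

context
  fixes f :: "'x \<Rightarrow> complex"
  assumes f: "continuous_map X euclidean f"
begin

text \<open>This function takes the place of \<open>A\<close> in the results on
  \<open>sesq\<close>.\<close>

definition correlation :: "'g \<Rightarrow> complex" where
  "correlation t = l2_inner m (koopman \<alpha> t f) f"

lemma correlation_eq: "correlation t = (\<integral>x. f (\<alpha> (- t) x) * cnj (f x) \<partial>m)"
  by (simp add: correlation_def l2_inner_def koopman_def)

lemma continuous_correlation: "continuous_on UNIV correlation"
proof -
  interpret finite_measure m by (rule m_finite)
  have "continuous_map (prod_topology X euclidean) euclidean (\<lambda>(x, t). f (\<alpha> (- t) x) * cnj (f x))"
    by (intro continuous_map_mult2 continuous_map_swap_args[OF continuous_map_orbit[OF f]]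
        continuous_map_fst_arg continuous_map_cnj f)
  from continuous_map_parametric_integral[OF X_Hausdorff sets_m this, of "topspace X"]
  have "continuous_map euclidean euclidean (\<lambda>t. \<integral>x. f (\<alpha> (- t) x) * cnj (f x) \<partial>m)"
    using X_compact by (simp add: compact_space_def emeasure_finite less_top[symmetric])
  then show ?thesis by (simp add: correlation_eq[abs_def])
qed

lemma correlation_bounded: "\<exists>C. \<forall>t. norm (correlation t) \<le> C"
proof -
  interpret prob_space m by (rule m_prob)
  obtain C where C: "C \<ge> 0" "\<And>x. x \<in> topspace X \<Longrightarrow> norm (f x) \<le> C" by (rule X_bounded[OF f]) blast
  have "norm (correlation t) \<le> (\<integral>x. C * C \<partial>m)" for t
    unfolding correlation_eq
  proof (rule norm_integral_le)
    show "norm (f (\<alpha> (- t) x) * cnj (f x)) \<le> C * C" if "x \<in> space m" for x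
      unfolding norm_mult complex_mod_cnj using that C action_in[of x "- t"]
      by (intro mult_mono) (auto simp: space_m)
  qed simp
  then show ?thesis by (intro exI[of _ "\<integral>x. C * C \<partial>m"] allI)
qed

text \<open>Invariance of \<open>m\<close> under \<open>\<alpha> (- s)\<close>. The correlation of
  two points of an orbit thus depends on \<open>t - s\<close> alone, which is the assumption on the
  kernel in \<open>sesq_kernel\<close>.\<close>

lemma integral_orbit:
  "(\<integral>x. f (\<alpha> (- t) x) * cnj (f (\<alpha> (- s) x)) \<partial>m) = correlation (t - s)"
proof -
  have "continuous_map X euclidean (\<lambda>x. f (\<alpha> (- (t - s)) x) * cnj (f x))"
    using continuous_map_compose[OF action_map f, of "- (t - s)"]
    by (intro continuous_map_complex_mult continuous_map_cnj f) (simp add: o_def)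
  from integral_action[OF this, of "- s"]
  have "(\<integral>x. f (\<alpha> (- (t - s)) (\<alpha> (- s) x)) * cnj (f (\<alpha> (- s) x)) \<partial>m) = correlation (t - s)"
    by (simp add: correlation_eq)
  moreover have "f (\<alpha> (- (t - s)) (\<alpha> (- s) x)) = f (\<alpha> (- t) x)" if "x \<in> space m" for x
    using action_add[of x "- (t - s)" "- s"] that by (simp add: space_m)
  ultimately show ?thesis by (simp cong: Bochner_Integration.integral_cong)
qed

text \<open>\<open>\<Psi>\<close> is left arbitrary, constrained only by its values along orbits, so
  that the result applies to a given factor map and to \<open>orbit_map\<close> alike. The integral
  over \<open>n\<close> is pulled back to \<open>X\<close>, where \<open>sesq_kernel\<close>
  applies.\<close>

lemma l2_inner_pairing:
  assumes \<Psi>: "continuous_map X (subtopology CG_topology Y) \<Psi>"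
    and \<Psi>f: "\<And>x t. x \<in> topspace X \<Longrightarrow> \<Psi> x t = f (\<alpha> (- t) x)"
    and n: "n = distr m (borel_of (subtopology CG_topology Y)) \<Psi>"
    and \<phi>: "\<phi> \<in> Cc" and \<psi>: "\<psi> \<in> Cc"
  shows "l2_inner n (pairing mG \<phi>) (pairing mG \<psi>) = sesq correlation \<phi> \<psi>"
proof -
  let ?S = "subtopology CG_topology Y"
  have \<Psi>m: "\<Psi> \<in> measurable m (borel_of ?S)"
    by (rule continuous_map_measurable_borel_of[OF sets_m refl \<Psi>])
  have c: "continuous_map ?S euclidean (pairing mG \<phi>)" if "\<phi> \<in> Cc" for \<phi> :: "'g \<Rightarrow> complex"
    using continuous_map_Cc_integral[OF continuous_map_eval_sub that] by (simp add: pairing_def[abs_def])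
  have "(\<lambda>h. pairing mG \<phi> h * cnj (pairing mG \<psi> h)) \<in> borel_measurable (borel_of ?S)"
    by (rule continuous_map_borel_measurable[OF refl])
      (intro continuous_map_complex_mult continuous_map_cnj c \<phi> \<psi>)
  then have "l2_inner n (pairing mG \<phi>) (pairing mG \<psi>)
      = (\<integral>x. pairing mG \<phi> (\<Psi> x) * cnj (pairing mG \<psi> (\<Psi> x)) \<partial>m)"
    unfolding l2_inner_def n by (rule integral_distr[OF \<Psi>m])
  also have "\<dots> = (\<integral>x. (\<integral>t. \<phi> t * f (\<alpha> (- t) x) \<partial>mG) * cnj (\<integral>s. \<psi> s * f (\<alpha> (- s) x) \<partial>mG) \<partial>m)"
    by (intro Bochner_Integration.integral_cong[OF refl]) (simp add: pairing_def \<Psi>f space_m)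
  also have "\<dots> = sesq correlation \<phi> \<psi>"
  proof -
    obtain C where C: "C \<ge> 0" "\<And>x. x \<in> topspace X \<Longrightarrow> norm (f x) \<le> C" by (rule X_bounded[OF f]) blast
    show ?thesis
    proof (rule sesq_kernel[OF X_Hausdorff sets_m m_finite continuous_map_orbit[OF f],
          where L = "\<lambda>n :: nat. topspace X" and C = C])
      show "compactin X (topspace X)" using X_compact by (simp add: compact_space_def)
      show "AE x in m. x \<in> (\<Union>n :: nat. topspace X)" using AE_space[of m] by (simp add: space_m)
      show "norm (f (\<alpha> (- t) x)) \<le> C" if "x \<in> topspace X" for t x
        by (rule C(2)[OF action_in[OF that]])
    qed (use integral_orbit \<phi> \<psi> in auto)
  qed
  finally show ?thesis .
qed

text \<open>An equivalence for each \<open>\<mu>\<close> separately, because two \<open>THE\<close>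
  terms are to be identified. The diffraction condition speaks about the autocorrelation, whose
  values on the relevant convolutions \<open>ac\<close> supplies.\<close>

lemma is_diffraction_iff_spectral:
  assumes \<Psi>: "continuous_map X (subtopology CG_topology Y) \<Psi>"
    and \<Psi>f: "\<And>x t. x \<in> topspace X \<Longrightarrow> \<Psi> x t = f (\<alpha> (- t) x)"
    and n: "n = distr m (borel_of (subtopology CG_topology Y)) \<Psi>"
  shows "is_diffraction mG n \<mu> \<longleftrightarrow> is_spectral_measure \<alpha> m f \<mu>"
proof -
  obtain C where C: "\<And>t. norm (correlation t) \<le> C" using correlation_bounded by blast
  have ac: "autocorrelation mG n (conv mG \<phi> (tilde \<phi>)) = sesq correlation \<phi> \<phi>" if "\<phi> \<in> Cc" for \<phi>
    by (rule autocorrelation_conv[OF continuous_correlation C l2_inner_pairing[OF \<Psi> \<Psi>f n] that that])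
  show ?thesis
  proof
    assume D: "is_diffraction mG n \<mu>"
    then have \<mu>: "radon_measure dual_topology \<mu>" by (simp add: is_diffraction_def)
    have sq: "has_bochner_integral \<mu>
        (\<lambda>\<eta>. complex_of_real ((norm (check_transform mG \<phi> \<eta>))\<^sup>2)) (sesq correlation \<phi> \<phi>)"
      if "\<phi> \<in> Cc" for \<phi>
      using D that unfolding is_diffraction_def ac[OF that, symmetric] by blast
    from finite_mu[OF continuous_correlation C \<mu> sq] diffraction_transform[OF continuous_correlation C \<mu> sq] \<mu>
    show "is_spectral_measure \<alpha> m f \<mu>"
      unfolding is_spectral_measure_def correlation_def by blast
  next
    assume S: "is_spectral_measure \<alpha> m f \<mu>"
    then have \<mu>: "radon_measure dual_topology \<mu>" "finite_measure \<mu>"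
      and eq: "\<And>t. correlation t = (\<integral>\<eta>. \<eta> t \<partial>\<mu>)"
      by (simp_all add: is_spectral_measure_def correlation_def)
    show "is_diffraction mG n \<mu>"
      unfolding is_diffraction_def using \<mu>(1) spectral_imp_diffraction[OF \<mu> eq] by (simp add: ac)
  qed
qed

lemma diffraction_eq_spectral:
  assumes "continuous_map X (subtopology CG_topology Y) \<Psi>"
    and "\<And>x t. x \<in> topspace X \<Longrightarrow> \<Psi> x t = f (\<alpha> (- t) x)"
    and "n = distr m (borel_of (subtopology CG_topology Y)) \<Psi>"
  shows "diffraction mG n = spectral_measure \<alpha> m f"
proof -
  have "is_diffraction mG n = is_spectral_measure \<alpha> m f"
    by (rule ext) (rule is_diffraction_iff_spectral[OF assms])
  then show ?thesis by (simp only: diffraction_def spectral_measure_def)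
qed

lemma continuous_map_orbit_map:
  "continuous_map X (subtopology CG_topology (orbit_space X \<alpha> f)) (orbit_map \<alpha> f)"
proof (rule continuous_map_into_subtopology)
  show "continuous_map X CG_topology (orbit_map \<alpha> f)"
    using continuous_map_into_CG[OF continuous_map_orbit[OF f]] by (simp add: orbit_map_def[abs_def])
qed (simp add: orbit_space_def)

lemma diffraction_orbit: "diffraction mG (orbit_measure X \<alpha> m f) = spectral_measure \<alpha> m f"
  by (rule diffraction_eq_spectral[OF continuous_map_orbit_map])
    (auto simp: orbit_map_def orbit_measure_def)

lemma orbit_map_equivariant:
  "x \<in> topspace X \<Longrightarrow> orbit_map \<alpha> f (\<alpha> t x) = translate t (orbit_map \<alpha> f x)"
  by (rule ext) (simp add: orbit_map_def translate_def add.commute flip: action_add)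

lemma orbit_space_subset: "orbit_space X \<alpha> f \<subseteq> CG"
proof -
  have "orbit_map \<alpha> f \<in> topspace X \<rightarrow> topspace (subtopology CG_topology (orbit_space X \<alpha> f))"
    using continuous_map_orbit_map by (simp add: continuous_map_def)
  then show ?thesis by (auto simp: orbit_space_def topspace_CG_topology)
qed

lemma topspace_orbit: "topspace (subtopology CG_topology (orbit_space X \<alpha> f)) = orbit_space X \<alpha> f"
  using orbit_space_subset by (simp add: topspace_CG_topology Int_absorb1)

text \<open>\<open>translate s h\<close> at \<open>t\<close> is the evaluation of \<open>h\<close>
  at \<open>t - s\<close>, jointly continuous in all three variables; currying the variable
  \<open>t\<close> gives continuity into \<open>CG_topology\<close>. Equivariance of
  \<open>orbit_map\<close> keeps the values in the orbit space.\<close>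

lemma continuous_map_translate:
  "continuous_map (prod_topology euclidean (subtopology CG_topology (orbit_space X \<alpha> f)))
     (subtopology CG_topology (orbit_space X \<alpha> f)) (\<lambda>(s, h). translate s h)"
    (is "continuous_map (prod_topology euclidean ?S) _ _")
proof (rule continuous_map_into_subtopology)
  have "continuous_map (prod_topology euclidean (prod_topology euclidean ?S)) (prod_topology euclidean euclidean)
      (\<lambda>p. (fst p, fst (snd p)))"
    using continuous_map_compose[OF continuous_map_snd continuous_map_fst]
    by (intro continuous_map_pairedI continuous_map_fst) (simp add: o_def)
  then have "continuous_map (prod_topology euclidean (prod_topology euclidean ?S)) euclidean
      ((\<lambda>z. fst z - snd z :: 'g) \<circ> (\<lambda>p. (fst p, fst (snd p))))"
    by (rule continuous_map_compose)
      (simp add: continuous_on_diff continuous_on_fst continuous_on_snd)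
  then have "continuous_map (prod_topology euclidean (prod_topology euclidean ?S)) euclidean
      (\<lambda>p. fst p - fst (snd p) :: 'g)"
    by (simp add: o_def)
  moreover have "continuous_map (prod_topology euclidean (prod_topology euclidean ?S)) ?S (\<lambda>p. snd (snd p))"
    using continuous_map_compose[OF continuous_map_snd continuous_map_snd] by (simp add: o_def)
  ultimately have "continuous_map (prod_topology euclidean (prod_topology euclidean ?S))
      (prod_topology euclidean ?S) (\<lambda>p. (fst p - fst (snd p) :: 'g, snd (snd p)))"
    by (rule continuous_map_pairedI)
  from continuous_map_compose[OF this continuous_map_eval_sub]
  have "continuous_map (prod_topology euclidean (prod_topology euclidean ?S)) euclidean
      (\<lambda>(t, z). snd z (t - fst z))"
    by (simp add: o_def split_def)
  from continuous_map_into_CG[OF this]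
  show "continuous_map (prod_topology euclidean ?S) CG_topology (\<lambda>(s, h). translate s h)"
    by (simp add: translate_def[abs_def] split_def)
  have "translate s (orbit_map \<alpha> f x) \<in> orbit_space X \<alpha> f" if "x \<in> topspace X" for s x
    unfolding orbit_map_equivariant[OF that, symmetric] orbit_space_def by (intro imageI action_in that)
  then show "(\<lambda>(s, h). translate s h) \<in> topspace (prod_topology euclidean ?S) \<rightarrow> orbit_space X \<alpha> f"
    using topspace_orbit by (auto simp: orbit_space_def)
qed

text \<open>Everything is transported along \<open>orbit_map\<close>: compactness as a continuous
  image, the Radon property by \<open>radon_measure_distr\<close>, and invariance of the measure by
  exchanging \<open>translate t\<close> for \<open>\<alpha> t\<close> through equivariance.\<close>

lemma FDS_orbit: "FDS (orbit_space X \<alpha> f) (orbit_measure X \<alpha> m f)"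
  unfolding FDS_def dynamical_system_def
proof (intro conjI allI ballI)
  let ?S = "subtopology CG_topology (orbit_space X \<alpha> f)"
  let ?n = "orbit_measure X \<alpha> m f"
  show "orbit_space X \<alpha> f \<subseteq> CG" by (rule orbit_space_subset)
  have "compactin ?S (orbit_map \<alpha> f ` topspace X)"
    using X_compact by (intro image_compactin[OF _ continuous_map_orbit_map]) (simp add: compact_space_def)
  then show "compact_space ?S"
    unfolding compact_space_def topspace_orbit by (simp add: orbit_space_def)
  show H: "Hausdorff_space ?S" by (rule Hausdorff_space_subtopology[OF Hausdorff_CG])
  show "continuous_map (prod_topology euclidean ?S) ?S (\<lambda>(t, h). translate t h)"
    by (rule continuous_map_translate)
  show "translate 0 h = h" for h :: "'g \<Rightarrow> complex" by (simp add: translate_def)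
  show "translate (s + t) h = translate s (translate t h)" for s t and h :: "'g \<Rightarrow> complex"
    by (simp add: translate_def algebra_simps)
  show "radon_measure ?S ?n"
    unfolding orbit_measure_def
    by (rule radon_measure_distr[OF X_compact H m_radon m_finite continuous_map_orbit_map])
  have \<Phi>: "orbit_map \<alpha> f \<in> measurable m (borel_of ?S)"
    by (rule continuous_map_measurable_borel_of[OF sets_m refl continuous_map_orbit_map])
  show "prob_space ?n"
    unfolding orbit_measure_def by (rule prob_space.prob_space_distr[OF m_prob \<Phi>])
  fix t
  have T: "translate t \<in> measurable (borel_of ?S) (borel_of ?S)"
    using continuous_map_curry2[OF continuous_map_translate, of t]
    by (intro continuous_map_measurable_borel_of[OF refl refl]) simp
  \<comment> \<open>Only the sigma-algebra of the target matters to \<open>distr\<close>, and that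
    of \<open>?n\<close> is \<open>borel_of ?S\<close>.\<close>
  have "distr ?n ?n (translate t) = distr ?n (borel_of ?S) (translate t)"
    by (rule distr_cong) (simp_all add: orbit_measure_def)
  also have "\<dots> = distr m (borel_of ?S) (translate t \<circ> orbit_map \<alpha> f)"
    unfolding orbit_measure_def by (rule distr_distr[OF T \<Phi>])
  also have "\<dots> = distr m (borel_of ?S) (orbit_map \<alpha> f \<circ> \<alpha> t)"
    by (rule distr_cong) (simp_all add: space_m orbit_map_equivariant)
  also have "\<dots> = distr (distr m m (\<alpha> t)) (borel_of ?S) (orbit_map \<alpha> f)"
    by (rule distr_distr[OF \<Phi> action_measurable, symmetric])
  finally show "distr ?n ?n (translate t) = ?n"
    by (simp add: m_invariant orbit_measure_def)
qed

lemma FDS_factor_map_orbit: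
  "FDS_factor_map X \<alpha> m (orbit_space X \<alpha> f) (orbit_measure X \<alpha> m f) (orbit_map \<alpha> f)"
  unfolding FDS_factor_map_def factor_map_def topspace_orbit
  using FDS_orbit continuous_map_orbit_map
  by (auto simp: orbit_space_def orbit_map_equivariant orbit_measure_def)

end

section \<open>Arbitrary factors given by function dynamical systems\<close>

context
  fixes Y n \<Phi>
  assumes \<Phi>: "FDS_factor_map X \<alpha> m Y n \<Phi>"
begin

lemma factor_continuous: "continuous_map X (subtopology CG_topology Y) \<Phi>"
  and factor_equivariant: "x \<in> topspace X \<Longrightarrow> \<Phi> (\<alpha> t x) = translate t (\<Phi> x)"
  and factor_distr: "n = distr m (borel_of (subtopology CG_topology Y)) \<Phi>"
  using \<Phi> unfolding FDS_factor_map_def factor_map_def by auto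

lemma continuous_delta0_factor: "continuous_map X euclidean (delta0 \<circ> \<Phi>)"
proof (rule continuous_map_compose[OF factor_continuous])
  show "continuous_map (subtopology CG_topology Y) euclidean (delta0 :: ('g \<Rightarrow> complex) \<Rightarrow> complex)"
    using continuous_map_curry2[OF continuous_map_eval_sub, of 0 Y] by (simp add: delta0_def[abs_def])
qed

text \<open>Equivariance recovers the whole function \<open>\<Phi> x\<close> from evaluation at 0
  along the orbit: \<open>\<Phi> x t\<close> is \<open>translate (- t) (\<Phi> x)\<close> at 0, that
  is \<open>delta0 (\<Phi> (\<alpha> (- t) x))\<close>.\<close>

lemma diffraction_factor: "diffraction mG n = spectral_measure \<alpha> m (delta0 \<circ> \<Phi>)"
  by (rule diffraction_eq_spectral[OF continuous_delta0_factor factor_continuous _ factor_distr])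
    (simp add: delta0_def factor_equivariant translate_def)

end

end

theorem theorem4p3:
  fixes mG :: "'g::{topological_ab_group_add,t2_space} measure"
    and X :: "'x topology" and \<alpha> :: "'g \<Rightarrow> 'x \<Rightarrow> 'x" and m :: "'x measure"
  assumes "locally_compact_space (euclidean :: 'g topology)"
    and "sigma_compact (UNIV :: 'g set)"
    and "haar_measure mG"
    and "dynamical_system X \<alpha> m"
  shows "(\<forall>Y n \<Phi>. FDS_factor_map X \<alpha> m Y n \<Phi> \<longrightarrow>
            diffraction mG n = spectral_measure \<alpha> m (delta0 \<circ> \<Phi>)) \<and>
         (\<forall>f :: 'x \<Rightarrow> complex. continuous_map X euclidean f \<longrightarrow>
            diffraction mG (orbit_measure X \<alpha> m f) = spectral_measure \<alpha> m f) \<and>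
         (\<lambda>(Y, n). diffraction mG n) ` FDS_factors X \<alpha> m =
            {spectral_measure \<alpha> m f | f :: 'x \<Rightarrow> complex. continuous_map X euclidean f}"
proof -
  interpret dynamical_haar mG X \<alpha> m
    by unfold_locales (fact assms)+
  have "(\<lambda>(Y, n). diffraction mG n) ` FDS_factors X \<alpha> m
      = {spectral_measure \<alpha> m f | f :: 'x \<Rightarrow> complex. continuous_map X euclidean f}"
  proof (intro equalityI subsetI)
    fix \<rho> assume "\<rho> \<in> (\<lambda>(Y, n). diffraction mG n) ` FDS_factors X \<alpha> m"
    then obtain Y n \<Phi> where "FDS_factor_map X \<alpha> m Y n \<Phi>" "\<rho> = diffraction mG n"
      by (auto simp: FDS_factors_def)
    then have "\<rho> = spectral_measure \<alpha> m (delta0 \<circ> \<Phi>)" "continuous_map X euclidean (delta0 \<circ> \<Phi>)"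
      using diffraction_factor continuous_delta0_factor by simp_all
    then show "\<rho> \<in> {spectral_measure \<alpha> m f | f :: 'x \<Rightarrow> complex. continuous_map X euclidean f}"
      by blast
  next
    fix \<rho> assume "\<rho> \<in> {spectral_measure \<alpha> m f | f :: 'x \<Rightarrow> complex. continuous_map X euclidean f}"
    then obtain f :: "'x \<Rightarrow> complex" where f: "continuous_map X euclidean f" "\<rho> = spectral_measure \<alpha> m f"
      by blast
    \<comment> \<open>Surjectivity: the spectral measure of \<open>f\<close> is attained at the
      orbit factor that \<open>f\<close> generates.\<close>
    have "(orbit_space X \<alpha> f, orbit_measure X \<alpha> m f) \<in> FDS_factors X \<alpha> m"
      using FDS_factor_map_orbit[OF f(1)] by (auto simp: FDS_factors_def)
    moreover have "\<rho> = (\<lambda>(Y, n). diffraction mG n) (orbit_space X \<alpha> f, orbit_measure X \<alpha> m f)"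
      by (simp add: f(2) diffraction_orbit[OF f(1)])
    ultimately show "\<rho> \<in> (\<lambda>(Y, n). diffraction mG n) ` FDS_factors X \<alpha> m"
      by (rule rev_image_eqI)
  qed
  then show ?thesis
    using diffraction_factor diffraction_orbit by blast
qed

end
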